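(* Let $E(\lambda,\sigma)$ be the Evans function of the Saint-Venant system linearized about the periodic wave with parameters $(c_\star,\bar q_\star)$, and let $D(\lambda,\nu)$ be the dispersion function of the Whitham system linearized at $(c_\star,\bar q_\star)$, namely $$D(\lambda,\nu)=\lambda^2\Big(\partial_cL_\star\langle\partial_{\bar q}H_\star\rangle_{L_\star}-\partial_{\bar q}L_\star\langle\partial_cH_\star\rangle_{L_\star}\Big)-\lambda\nu\Big(\frac{\partial_cL_\star}{L_\star}+\langle\partial_{\bar q}H_\star\rangle_{L_\star}+\frac{M_\star\,\partial_{\bar q}L_\star}{L_\star}\Big)+\frac{\nu^2}{L_\star}.$$ Then there is a constant $\Gamma\ne0$ such that, as $(\lambda,\nu)\to(0,0)$ in $\mathbb C\times i\mathbb R$, $$E(\lambda,e^{\nu})=\Gamma\,D(\lambda,\nu)+\mathcal O\big((|\lambda|+|\nu|)^3\big).$$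
   Context: **Saint-Venant system.** Fix $\delta>0$, $F>0$ and set $G(h,q)=\frac{q^2}{h}+\frac{h^2}{2F^2}$, $S(h,q)=h-\frac{q^2}{h^2}$. The system is $\partial_t h+\partial_x q=0$, $\partial_t q+\partial_x(G(h,q))=S(h,q)+\delta\partial_x^2 q$. **Periodic travelling waves.** Put $\mathcal G(H,Q;k)=\delta k^2Q''-k(G(H,Q))'+S(H,Q)$, with partial linearizations $\partial_h\mathcal G(H,Q;k)[f]=-k(\partial_hG(H,Q)f)'+\partial_hS(H,Q)f$ and $\partial_q\mathcal G(H,Q;k)[f]=\delta k^2f''-k(\partial_qG(H,Q)f)'+\partial_qS(H,Q)f$. Waves $(H,Q)(kx+\omega t)$ with $1$-periodic $(H,Q)$, $\omega=-kc$, satisfy $cH-Q=\bar q$ for a constant $\bar q$ and $kc^2H'+\mathcal G(H,cH-\bar q;k)=0$. Standing assumption: for $(k,\bar q)$ in the open set of parameters considered, in $\mathbb R^*\times\mathbb R$, this equation has a non-constant $1$-periodic solution for exactly one speed $c=c(k,\bar q)$, and that solution is unique up to translation; everything depends smoothly on $(k,\bar q)$. Moreover the operator $\mathcal L f=-\omega c f'+\partial_h\mathcal G(H,Q;k)[f]+c\,\partial_q\mathcal G(H,Q;k)[f]$ on $1$-periodic $L^2$ functions has kernel spanned by $H'$, and $A^\omega=-2\frac{\omega}{k}H'+\frac1k\partial_q\mathcal G(H,Q;k)[H]$ is not in its range. With $M=\int_0^1H$, it is also assumed that $\partial_{\bar q}M\ne0$, $\partial_kc\neq0$ and $\partial_{\bar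 q}c\neq0$ (as functions of $(k,\bar q)$). Finally $c_\star\neq0$. **$(c,\bar q)$-parametrization.** Since $\partial_kc\ne0$, waves can be parametrized smoothly by $(c,\bar q)$. Let $L(c,\bar q)=1/k$ be the period, and from now on let $H(\cdot;c,\bar q)$ denote the wave profile in the unscaled variable, i.e. an $L(c,\bar q)$-periodic function such that $y\mapsto H(L(c,\bar q)y;c,\bar q)$ is the $1$-periodic solution of the profile equation with $k=1/L(c,\bar q)$; $Q=cH-\bar q$; $M(c,\bar q)=\frac1L\int_0^LH$. The translate is chosen so that $H(0;c,\bar q)=M(c,\bar q)$. The subscript $\star$ means evaluation at a fixed $(c_\star,\bar q_\star)$; $\partial_cH_\star,\partial_{\bar q}H_\star$ are derivatives at fixed space variable; $\langle f\rangle_L=\frac1L\int_0^Lf$. ($D(\lambda,\nu)=0$ is the condition that the linearized Whitham system $\partial_cL_\star\partial_tc+\partial_{\bar q}L_\star\partial_t\bar q-L_\star\partial_xc=0$, $\langle\partial_cH_\star\rangle_{L_\star}\partial_tc+\langle\partial_{\bar q}H_\star\rangle_{L_\star}\partial_t\bar q+M_\star\partial_xc-\partial_x\bar q=0$ has a non-zero solution $e^{\lambda t+\nu x/L_\star}(c_1,\bar q_1)$ with constant $(c_1,\bar q_1)$.) **Evans function.** In the frame $(x-c_\star t,t)$ the linearized spectral problem for $\lambda\in\mathbb C$ is $$\partial_x(q-c_\star h)+\lambda h=0,\qquad \partial_x\big[\partial_hG(H_\star,Q_\star)h+\partial_qG(H_\star,Q_\star)q-c_\star q\big]+\lambda q=\partial_hS(H_\star,Q_\star)h+\partial_qS(H_\star,Q_\star)q+\delta\partial_x^2q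 .$$ Using $q'=c_\star h'-\lambda h$, it is equivalent to a first-order linear system $Y'=A(\cdot\,;\lambda)Y$ for $Y=(q,h,h')$ with $L_\star$-periodic coefficients. Let $\Psi(\cdot;\lambda)$ be its fundamental matrix with $\Psi(0;\lambda)=\mathrm{Id}$. Then $E(\lambda,\sigma)=\det(\Psi(L_\star;\lambda)-\sigma\,\mathrm{Id}_3)$. *)

theory Defs
  imports "HOL-Analysis.Analysis" "HOL-Library.Landau_Symbols"
begin

section \<open>Smoothness in several variables\<close>

text \<open>On open sets, \<open>Ck_on n S f\<close> is the usual \<open>C^n\<close> regularity: all iterated directional
  derivatives up to order \<open>n\<close> exist on \<open>S\<close>, the intermediate ones are Frechet differentiable there,
  and those of order \<open>n\<close> are continuous. Directional derivatives keep the type of \<open>f\<close> unchanged.\<close>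

primrec Ck_on :: "nat \<Rightarrow> 'a::real_normed_vector set \<Rightarrow> ('a \<Rightarrow> 'b::real_normed_vector) \<Rightarrow> bool" where
  "Ck_on 0 S f \<longleftrightarrow> continuous_on S f"
| "Ck_on (Suc n) S f \<longleftrightarrow> (\<forall>x\<in>S. f differentiable (at x)) \<and>
     (\<forall>v. Ck_on n S (\<lambda>x. frechet_derivative f (at x) v))"

definition smooth_on :: "'a::real_normed_vector set \<Rightarrow> ('a \<Rightarrow> 'b::real_normed_vector) \<Rightarrow> bool" where
  "smooth_on S f \<longleftrightarrow> (\<forall>n. Ck_on n S f)"

section \<open>The Saint-Venant system\<close>

definition flux :: "real \<Rightarrow> real \<Rightarrow> real \<Rightarrow> real" where
  "flux F h q = q\<^sup>2 / h + h\<^sup>2 / (2 * F\<^sup>2)"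

definition source :: "real \<Rightarrow> real \<Rightarrow> real" where
  "source h q = h - q\<^sup>2 / h\<^sup>2"

definition flux_h :: "real \<Rightarrow> real \<Rightarrow> real \<Rightarrow> real" where
  "flux_h F h q = deriv (\<lambda>h. flux F h q) h"

definition flux_q :: "real \<Rightarrow> real \<Rightarrow> real \<Rightarrow> real" where
  "flux_q F h q = deriv (\<lambda>q. flux F h q) q"

definition source_h :: "real \<Rightarrow> real \<Rightarrow> real" where
  "source_h h q = deriv (\<lambda>h. source h q) h"

definition source_q :: "real \<Rightarrow> real \<Rightarrow> real" where
  "source_q h q = deriv (\<lambda>q. source h q) q"

lemma flux_h_eq: "F \<noteq> 0 \<Longrightarrow> h \<noteq> 0 \<Longrightarrow> flux_h F h q = h / F\<^sup>2 - q\<^sup>2 / h\<^sup>2"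
  unfolding flux_h_def flux_def
  by (rule DERIV_imp_deriv) (auto intro!: derivative_eq_intros simp: power2_eq_square)

lemma flux_q_eq: "h \<noteq> 0 \<Longrightarrow> flux_q F h q = 2 * q / h"
  unfolding flux_q_def flux_def
  by (rule DERIV_imp_deriv) (auto intro!: derivative_eq_intros)

lemma source_h_eq: "h \<noteq> 0 \<Longrightarrow> source_h h q = 1 + 2 * q\<^sup>2 / h ^ 3"
  unfolding source_h_def source_def
  by (rule DERIV_imp_deriv)
     (auto intro!: derivative_eq_intros simp: field_simps power2_eq_square power3_eq_cube)

lemma source_q_eq: "h \<noteq> 0 \<Longrightarrow> source_q h q = - 2 * q / h\<^sup>2"
  unfolding source_q_def source_def
  by (rule DERIV_imp_deriv) (auto intro!: derivative_eq_intros simp: field_simps power2_eq_square)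

section \<open>Periodic travelling waves\<close>

definition momentum_op ::
  "real \<Rightarrow> real \<Rightarrow> (real \<Rightarrow> real) \<Rightarrow> (real \<Rightarrow> real) \<Rightarrow> real \<Rightarrow> real \<Rightarrow> real" where
  "momentum_op \<delta> F H Q k y =
     \<delta> * k\<^sup>2 * (deriv ^^ 2) Q y - k * deriv (\<lambda>y. flux F (H y) (Q y)) y + source (H y) (Q y)"

definition momentum_op_h ::
  "real \<Rightarrow> real \<Rightarrow> (real \<Rightarrow> real) \<Rightarrow> (real \<Rightarrow> real) \<Rightarrow> real \<Rightarrow> (real \<Rightarrow> real) \<Rightarrow> real \<Rightarrow> real" where
  "momentum_op_h \<delta> F H Q k f y =
     - k * deriv (\<lambda>y. flux_h F (H y) (Q y) * f y) y + source_h (H y) (Q y) * f y"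

definition momentum_op_q ::
  "real \<Rightarrow> real \<Rightarrow> (real \<Rightarrow> real) \<Rightarrow> (real \<Rightarrow> real) \<Rightarrow> real \<Rightarrow> (real \<Rightarrow> real) \<Rightarrow> real \<Rightarrow> real" where
  "momentum_op_q \<delta> F H Q k f y =
     \<delta> * k\<^sup>2 * (deriv ^^ 2) f y - k * deriv (\<lambda>y. flux_q F (H y) (Q y) * f y) y
     + source_q (H y) (Q y) * f y"

text \<open>The profile is a water height, hence positive. (Replacing positivity by \<open>H y \<noteq> 0\<close> would give
  the same solutions: a negative one would make \<open>source H Q\<close> negative, whereas integrating the
  equation over a period shows that its mean vanishes.)\<close>

definition profile_solution ::
  "real \<Rightarrow> real \<Rightarrow> real \<Rightarrow> real \<Rightarrow> real \<Rightarrow> (real \<Rightarrow> real) \<Rightarrow> bool" where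
  "profile_solution \<delta> F k qb c H \<longleftrightarrow>
     (\<forall>y. H (y + 1) = H y) \<and> (\<forall>y. H y > 0) \<and>
     (\<forall>y. H differentiable (at y)) \<and> (\<forall>y. deriv H differentiable (at y)) \<and>
     (\<forall>y. k * c\<^sup>2 * deriv H y + momentum_op \<delta> F H (\<lambda>y. c * H y - qb) k y = 0)"

text \<open>Square-integrable 1-periodic functions and the corresponding second-order Sobolev space, whose
  elements are represented by their \<open>C^1\<close> representative: the (classical) first derivative is an
  indefinite integral of a function in \<open>L2_per\<close>. It is the domain of the operator below, whose
  value \<open>lin_op ... f y\<close> is meaningful for almost every \<open>y\<close>.\<close>

definition L2_per :: "(real \<Rightarrow> real) set" where
  "L2_per = {g. (\<forall>y. g (y + 1) = g y) \<and> g \<in> borel_measurable lebesgue \<and>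
     integrable (lebesgue_on {0..1}) (\<lambda>y. (g y)\<^sup>2)}"

definition H2_per :: "(real \<Rightarrow> real) set" where
  "H2_per = {f. (\<forall>y. f (y + 1) = f y) \<and> (\<forall>y. f differentiable (at y)) \<and>
     (\<exists>g\<in>L2_per. \<forall>a b. a \<le> b \<longrightarrow> (g has_integral (deriv f b - deriv f a)) {a..b})}"

definition lin_op ::
  "real \<Rightarrow> real \<Rightarrow> real \<Rightarrow> real \<Rightarrow> real \<Rightarrow> (real \<Rightarrow> real) \<Rightarrow> (real \<Rightarrow> real) \<Rightarrow> real \<Rightarrow> real" where
  "lin_op \<delta> F k qb c H f y =
     (let \<omega> = - k * c; Q = (\<lambda>y. c * H y - qb) in
        - \<omega> * c * deriv f y + momentum_op_h \<delta> F H Q k f y + c * momentum_op_q \<delta> F H Q k f y)"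

definition lin_op_kernel ::
  "real \<Rightarrow> real \<Rightarrow> real \<Rightarrow> real \<Rightarrow> real \<Rightarrow> (real \<Rightarrow> real) \<Rightarrow> (real \<Rightarrow> real) set" where
  "lin_op_kernel \<delta> F k qb c H = {f \<in> H2_per. AE y in lborel. lin_op \<delta> F k qb c H f y = 0}"

definition lin_op_range ::
  "real \<Rightarrow> real \<Rightarrow> real \<Rightarrow> real \<Rightarrow> real \<Rightarrow> (real \<Rightarrow> real) \<Rightarrow> (real \<Rightarrow> real) set" where
  "lin_op_range \<delta> F k qb c H =
     {g \<in> L2_per. \<exists>f\<in>H2_per. AE y in lborel. lin_op \<delta> F k qb c H f y = g y}"

definition A_omega ::
  "real \<Rightarrow> real \<Rightarrow> real \<Rightarrow> real \<Rightarrow> real \<Rightarrow> (real \<Rightarrow> real) \<Rightarrow> real \<Rightarrow> real" where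
  "A_omega \<delta> F k qb c H y =
     (let \<omega> = - k * c; Q = (\<lambda>y. c * H y - qb) in
        - 2 * (\<omega> / k) * deriv H y + (1 / k) * momentum_op_q \<delta> F H Q k H y)"

text \<open>The integral is oriented, so that negative \<open>L\<close> (i.e. negative wave numbers) is allowed.\<close>

definition mean :: "real \<Rightarrow> (real \<Rightarrow> real) \<Rightarrow> real" where
  "mean L f = (1 / L) * (LBINT x=0..L. f x)"

section \<open>The Evans function\<close>

text \<open>The spectral parameter is called \<open>\<mu>\<close>.\<close>

definition spectral_problem ::
  "real \<Rightarrow> real \<Rightarrow> real \<Rightarrow> (real \<Rightarrow> real) \<Rightarrow> (real \<Rightarrow> real) \<Rightarrow> complex \<Rightarrow>
   (real \<Rightarrow> complex) \<Rightarrow> (real \<Rightarrow> complex) \<Rightarrow> bool" where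
  "spectral_problem \<delta> F c H Q \<mu> h q \<longleftrightarrow>
     (\<exists>h' h'' q' q''. \<forall>x.
        (h has_vector_derivative h' x) (at x) \<and> (h' has_vector_derivative h'' x) (at x) \<and>
        (q has_vector_derivative q' x) (at x) \<and> (q' has_vector_derivative q'' x) (at x) \<and>
        ((\<lambda>x. q x - of_real c * h x) has_vector_derivative - \<mu> * h x) (at x) \<and>
        ((\<lambda>x. of_real (flux_h F (H x) (Q x)) * h x + of_real (flux_q F (H x) (Q x)) * q x
              - of_real c * q x)
           has_vector_derivative
             of_real (source_h (H x) (Q x)) * h x + of_real (source_q (H x) (Q x)) * q x
             + of_real \<delta> * q'' x - \<mu> * q x) (at x))"

text \<open>Coefficient matrix of the first-order system satisfied by \<open>(q, h, h')\<close>, obtained by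
  substituting \<open>q' = c h' - \<mu> h\<close> and \<open>q'' = c h'' - \<mu> h'\<close> in the second spectral equation and
  solving it for \<open>h''\<close>; see \<open>spectral_problem_iff\<close>.\<close>

definition evans_matrix ::
  "real \<Rightarrow> real \<Rightarrow> real \<Rightarrow> (real \<Rightarrow> real) \<Rightarrow> (real \<Rightarrow> real) \<Rightarrow> complex \<Rightarrow> real \<Rightarrow> complex ^ 3 ^ 3" where
  "evans_matrix \<delta> F c H Q \<mu> x =
     (let gh = complex_of_real (flux_h F (H x) (Q x));
          gq = complex_of_real (flux_q F (H x) (Q x));
          gh' = complex_of_real (deriv (\<lambda>x. flux_h F (H x) (Q x)) x);
          gq' = complex_of_real (deriv (\<lambda>x. flux_q F (H x) (Q x)) x);
          sh = complex_of_real (source_h (H x) (Q x));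
          sq = complex_of_real (source_q (H x) (Q x));
          d = complex_of_real (\<delta> * c)
      in vector
        [vector [0, - \<mu>, of_real c],
         vector [0, 0, 1],
         vector [(gq' + \<mu> - sq) / d,
                 (gh' - \<mu> * gq + of_real c * \<mu> - sh) / d,
                 (gh + of_real c * gq - of_real (c\<^sup>2) + of_real \<delta> * \<mu>) / d]])"

lemma has_vector_derivative_vector3_iff:
  fixes a b c :: "real \<Rightarrow> complex" and v :: "complex ^ 3"
  shows "((\<lambda>x. vector [a x, b x, c x] :: complex ^ 3) has_vector_derivative v) (at x) \<longleftrightarrow>
    (a has_vector_derivative v $ 1) (at x) \<and> (b has_vector_derivative v $ 2) (at x) \<and>
    (c has_vector_derivative v $ 3) (at x)" (is "?l \<longleftrightarrow> ?r")
proof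
  assume l: ?l
  have "((\<lambda>x. (vector [a x, b x, c x] :: complex ^ 3) $ i) has_vector_derivative v $ i) (at x)" for i
    using bounded_linear.has_vector_derivative[OF bounded_linear_vec_nth l] .
  from this[of 1] this[of 2] this[of 3] show ?r by simp
next
  assume r: ?r
  have "bounded_linear (\<lambda>z::complex. axis i z :: complex ^ 3)" for i
    by (intro linear_conv_bounded_linear[THEN iffD1] linearI)
       (auto simp: vec_eq_iff axis_def)
  note bl = bounded_linear.has_vector_derivative[OF this]
  have "((\<lambda>x. axis 1 (a x) + axis 2 (b x) + axis 3 (c x) :: complex ^ 3)
      has_vector_derivative axis 1 (v $ 1) + axis 2 (v $ 2) + axis 3 (v $ 3)) (at x)"
    using r by (intro has_vector_derivative_add bl) auto
  moreover have "axis 1 (a x) + axis 2 (b x) + axis 3 (c x) = (vector [a x, b x, c x] :: complex ^ 3)" for x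
    by (auto simp: vec_eq_iff axis_def forall_3)
  moreover have "axis 1 (v $ 1) + axis 2 (v $ 2) + axis 3 (v $ 3) = v"
    by (auto simp: vec_eq_iff axis_def forall_3)
  ultimately show ?l by simp
qed

lemma spectral_problem_iff:
  fixes h q :: "real \<Rightarrow> complex"
  assumes "\<delta> \<noteq> 0" "c \<noteq> 0" "F \<noteq> 0" and pos: "\<And>x. H x > 0"
    and H: "\<And>x. H differentiable (at x)" and Q: "\<And>x. Q differentiable (at x)"
  shows "spectral_problem \<delta> F c H Q \<mu> h q \<longleftrightarrow>
    (\<exists>h'. \<forall>x. ((\<lambda>x. vector [q x, h x, h' x]) has_vector_derivative
        evans_matrix \<delta> F c H Q \<mu> x *v vector [q x, h x, h' x]) (at x))"
proof -
  define gh where "gh = (\<lambda>x. flux_h F (H x) (Q x))"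
  define gq where "gq = (\<lambda>x. flux_q F (H x) (Q x))"
  define sh where "sh = (\<lambda>x. complex_of_real (source_h (H x) (Q x)))"
  define sq where "sq = (\<lambda>x. complex_of_real (source_q (H x) (Q x)))"
  define h2 where "h2 = (\<lambda>x h1. ((complex_of_real (deriv gq x) + \<mu> - sq x) * q x
      + (of_real (deriv gh x) - \<mu> * of_real (gq x) + of_real c * \<mu> - sh x) * h x
      + (of_real (gh x) + of_real c * of_real (gq x) - of_real (c\<^sup>2) + of_real \<delta> * \<mu>) * h1)
      / of_real (\<delta> * c))"
  have neq: "H x \<noteq> 0" for x using pos[of x] by simp
  have gq: "((\<lambda>x. complex_of_real (gq x)) has_vector_derivative of_real (deriv gq x)) (at x)" for x
  proof -
    have "gq = (\<lambda>x. 2 * Q x / H x)"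
      unfolding gq_def using neq by (simp add: flux_q_eq)
    then have "gq differentiable (at x)" using H[of x] Q[of x] neq[of x]
      by (auto intro!: derivative_intros)
    then show ?thesis
      by (intro has_vector_derivative_of_real) (simp add: DERIV_deriv_iff_real_differentiable
            flip: has_real_derivative_iff_has_vector_derivative)
  qed
  have gh: "((\<lambda>x. complex_of_real (gh x)) has_vector_derivative of_real (deriv gh x)) (at x)" for x
  proof -
    have "gh = (\<lambda>x. H x / F\<^sup>2 - (Q x)\<^sup>2 / (H x)\<^sup>2)"
      unfolding gh_def using neq \<open>F \<noteq> 0\<close> by (simp add: flux_h_eq)
    moreover have "(\<lambda>x. (H x) / F\<^sup>2) differentiable (at x)" using H[of x]
      using \<open>F \<noteq> 0\<close> by (auto intro!: derivative_intros)
    ultimately have "gh differentiable (at x)" using H[of x] Q[of x] neq[of x]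
      by (auto intro!: derivative_intros)
    then show ?thesis
      by (intro has_vector_derivative_of_real) (simp add: DERIV_deriv_iff_real_differentiable
            flip: has_real_derivative_iff_has_vector_derivative)
  qed
  have sys: "((\<lambda>x. vector [q x, h x, h' x]) has_vector_derivative
        evans_matrix \<delta> F c H Q \<mu> x *v vector [q x, h x, h' x]) (at x) \<longleftrightarrow>
      (q has_vector_derivative of_real c * h' x - \<mu> * h x) (at x) \<and>
      (h has_vector_derivative h' x) (at x) \<and> (h' has_vector_derivative h2 x (h' x)) (at x)" for h' x
  proof -
    have "(evans_matrix \<delta> F c H Q \<mu> x *v vector [q x, h x, h' x]) $ 3 = h2 x (h' x)"
      by (simp add: evans_matrix_def Let_def matrix_vector_mult_def sum_3 h2_def gh_def gq_def
            sh_def sq_def flip: add_divide_distrib)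
    moreover have "(evans_matrix \<delta> F c H Q \<mu> x *v vector [q x, h x, h' x]) $ 1
        = of_real c * h' x - \<mu> * h x"
      by (simp add: evans_matrix_def Let_def matrix_vector_mult_def sum_3)
    moreover have "(evans_matrix \<delta> F c H Q \<mu> x *v vector [q x, h x, h' x]) $ 2 = h' x"
      by (simp add: evans_matrix_def Let_def matrix_vector_mult_def sum_3)
    ultimately show ?thesis by (simp add: has_vector_derivative_vector3_iff)
  qed
  have alg: "of_real (deriv gh x) * h x + of_real (gh x) * h1
        + (of_real (deriv gq x) * q x + of_real (gq x) * (of_real c * h1 - \<mu> * h x))
        - of_real c * (of_real c * h1 - \<mu> * h x)
      = sh x * h x + sq x * q x + of_real \<delta> * (of_real c * hh - \<mu> * h1) - \<mu> * q x
      \<longleftrightarrow> hh = h2 x h1" for x h1 hh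
    using assms(1,2) unfolding h2_def
    by (simp add: field_simps power2_eq_square) (auto simp: algebra_simps)
  have flux: "((\<lambda>x. of_real (gh x) * h x + of_real (gq x) * q x - of_real c * q x)
      has_vector_derivative of_real (deriv gh x) * h x + of_real (gh x) * h1
        + (of_real (deriv gq x) * q x + of_real (gq x) * q1) - of_real c * q1) (at x)"
    if "(h has_vector_derivative h1) (at x)" "(q has_vector_derivative q1) (at x)" for x h1 q1
    using has_vector_derivative_diff[OF has_vector_derivative_add[OF
        has_vector_derivative_mult[OF gh[of x] that(1)]
        has_vector_derivative_mult[OF gq[of x] that(2)]]
        has_vector_derivative_mult_right[OF that(2), of "of_real c"]]
    by (simp add: algebra_simps)
  show ?thesis
  proof
    assume "spectral_problem \<delta> F c H Q \<mu> h q"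
    then obtain h' h'' q' q'' where
        h: "\<And>x. (h has_vector_derivative h' x) (at x)"
      and h': "\<And>x. (h' has_vector_derivative h'' x) (at x)"
      and q: "\<And>x. (q has_vector_derivative q' x) (at x)"
      and q': "\<And>x. (q' has_vector_derivative q'' x) (at x)"
      and 1: "\<And>x. ((\<lambda>x. q x - of_real c * h x) has_vector_derivative - \<mu> * h x) (at x)"
      and 2: "\<And>x. ((\<lambda>x. of_real (gh x) * h x + of_real (gq x) * q x - of_real c * q x)
           has_vector_derivative
             sh x * h x + sq x * q x + of_real \<delta> * q'' x - \<mu> * q x) (at x)"
      unfolding spectral_problem_def gh_def gq_def sh_def sq_def by blast
    have q'_eq: "q' x = of_real c * h' x - \<mu> * h x" for x
    proof -
      have "((\<lambda>x. q x - of_real c * h x) has_vector_derivative q' x - of_real c * h' x) (at x)"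
        by (intro has_vector_derivative_diff q has_vector_derivative_mult_right h)
      from vector_derivative_unique_at[OF this 1] show ?thesis by (simp add: algebra_simps)
    qed
    have q''_eq: "q'' x = of_real c * h'' x - \<mu> * h' x" for x
    proof -
      have "(q' has_vector_derivative of_real c * h'' x - \<mu> * h' x) (at x)"
        unfolding q'_eq[abs_def]
        by (intro has_vector_derivative_diff has_vector_derivative_mult_right h h')
      from vector_derivative_unique_at[OF q' this] show ?thesis .
    qed
    have "h'' x = h2 x (h' x)" for x
      using vector_derivative_unique_at[OF flux[OF h q] 2, of x] alg[of x "h' x" "h'' x"]
      unfolding q'_eq q''_eq by blast
    then show "\<exists>h'. \<forall>x. ((\<lambda>x. vector [q x, h x, h' x]) has_vector_derivative
        evans_matrix \<delta> F c H Q \<mu> x *v vector [q x, h x, h' x]) (at x)"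
      unfolding sys using h h' q q'_eq by (intro exI[of _ h']) simp
  next
    assume "\<exists>h'. \<forall>x. ((\<lambda>x. vector [q x, h x, h' x]) has_vector_derivative
        evans_matrix \<delta> F c H Q \<mu> x *v vector [q x, h x, h' x]) (at x)"
    then obtain h' where q: "\<And>x. (q has_vector_derivative of_real c * h' x - \<mu> * h x) (at x)"
      and h: "\<And>x. (h has_vector_derivative h' x) (at x)"
      and h': "\<And>x. (h' has_vector_derivative h2 x (h' x)) (at x)"
      unfolding sys by blast
    have q': "((\<lambda>x. of_real c * h' x - \<mu> * h x) has_vector_derivative
        of_real c * h2 x (h' x) - \<mu> * h' x) (at x)" for x
      by (intro has_vector_derivative_diff has_vector_derivative_mult_right h h')
    have 1: "((\<lambda>x. q x - of_real c * h x) has_vector_derivative - \<mu> * h x) (at x)" for x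
      using has_vector_derivative_diff[OF q[of x] has_vector_derivative_mult_right[OF h[of x], of "of_real c"]]
      by simp
    have 2: "((\<lambda>x. of_real (gh x) * h x + of_real (gq x) * q x - of_real c * q x)
           has_vector_derivative sh x * h x + sq x * q x
             + of_real \<delta> * (of_real c * h2 x (h' x) - \<mu> * h' x) - \<mu> * q x) (at x)" for x
      using flux[OF h[of x] q[of x]] alg[of x "h' x" "h2 x (h' x)"] by simp
    show "spectral_problem \<delta> F c H Q \<mu> h q"
      unfolding spectral_problem_def
      by (rule exI[of _ h'], rule exI[of _ "\<lambda>x. h2 x (h' x)"],
          rule exI[of _ "\<lambda>x. of_real c * h' x - \<mu> * h x"],
          rule exI[of _ "\<lambda>x. of_real c * h2 x (h' x) - \<mu> * h' x"])
         (intro allI conjI h h' q q' 1 2[unfolded gh_def gq_def sh_def sq_def])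
  qed
qed

definition fundamental_matrix ::
  "(real \<Rightarrow> complex ^ 3 ^ 3) \<Rightarrow> (real \<Rightarrow> complex ^ 3 ^ 3) \<Rightarrow> bool" where
  "fundamental_matrix A \<Psi> \<longleftrightarrow>
     \<Psi> 0 = mat 1 \<and> (\<forall>x. (\<Psi> has_vector_derivative A x ** \<Psi> x) (at x))"

definition evans :: "(complex \<Rightarrow> real \<Rightarrow> complex ^ 3 ^ 3) \<Rightarrow> real \<Rightarrow> complex \<Rightarrow> complex \<Rightarrow> complex" where
  "evans \<Psi> L \<mu> \<sigma> = det (\<Psi> \<mu> L - mat \<sigma>)"

section \<open>The dispersion function of the Whitham system\<close>

text \<open>The functions \<open>L c q\<close> and \<open>H c q x\<close> are the period and the profile in the unscaled variable,
  parametrized by the speed \<open>c\<close> and by \<open>q\<close>; \<open>Hc\<close> and \<open>Hq\<close> are parameter derivatives at fixed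
  \<open>x\<close>, and need not be periodic.\<close>

definition whitham_dispersion ::
  "(real \<Rightarrow> real \<Rightarrow> real) \<Rightarrow> (real \<Rightarrow> real \<Rightarrow> real \<Rightarrow> real) \<Rightarrow> real \<Rightarrow> real \<Rightarrow> complex \<Rightarrow> complex \<Rightarrow> complex" where
  "whitham_dispersion L H c0 q0 \<mu> \<nu> =
     (let L0 = L c0 q0;
          Lc = deriv (\<lambda>c. L c q0) c0;
          Lq = deriv (\<lambda>q. L c0 q) q0;
          Hc = mean L0 (\<lambda>x. deriv (\<lambda>c. H c q0 x) c0);
          Hq = mean L0 (\<lambda>x. deriv (\<lambda>q. H c0 q x) q0);
          M0 = mean L0 (H c0 q0)
      in \<mu>\<^sup>2 * of_real (Lc * Hq - Lq * Hc)
         - \<mu> * \<nu> * of_real (Lc / L0 + Hq + M0 * Lq / L0)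
         + \<nu>\<^sup>2 / of_real L0)"

end

theory Submission
  imports Defs
begin

text \<open>Write \<open>\<eta>\<close> for the wave, \<open>L\<close> for its period, and \<open>Hc\<close>, \<open>Hq\<close>, \<open>Lc\<close>, \<open>Lq\<close> for the
  derivatives of the profile and of the period with respect to the parameters \<open>c\<close> and \<open>q\<close>. At
  \<open>\<mu> = 0\<close> the spectral problem is the linearization of the profile equation, so that differentiating
  the equation of the wave with respect to \<open>x\<close>, \<open>q\<close> and \<open>c\<close> gives approximate solutions \<open>(q, h, h')\<close>:

  \<^item> \<open>Y1 = (c \<eta>', \<eta>', \<eta>'') - \<mu> (c Hc + \<eta>, Hc, Hc')\<close>, correct up to \<open>O(\<mu>\<^sup>2)\<close>;
  \<^item> \<open>Y2 = (c Hq - 1, Hq, Hq')\<close>, correct up to \<open>O(\<mu>)\<close>;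
  \<^item> \<open>Y3 = (c f, f, f')\<close>, correct up to \<open>O(\<mu>)\<close>, for a solution \<open>f\<close> of the linearized profile
    equation that is independent of \<open>\<eta>'\<close>.

  Up to the factor \<open>det (Y1, Y2, Y3) (0)\<close>, the Evans function is the determinant of the vectors
  \<open>Yj (L) - e\<^sup>\<nu> Yj (0)\<close>, for the exact solutions with these initial values. Two facts determine it up
  to order three. Since the period depends on the parameters, \<open>Hc\<close> and \<open>Hq\<close> are not
  periodic: over one period they change by \<open>- Lc \<eta>'\<close> and \<open>- Lq \<eta>'\<close>. This gives the last two
  components of the columns: \<open>(\<mu> Lc - \<nu>) (\<eta>', \<eta>'')\<close> and \<open>- Lq (\<eta>', \<eta>'')\<close> to leading order for the
  first two columns. And
  conservation of mass, \<open>(q - c h)' = - \<mu> h\<close>, gives the increment of \<open>q - c h\<close> with one more order of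
  precision than the solutions themselves; replacing the first row by this combination, its first two
  entries become \<open>\<mu>\<^sup>2 \<integral>Hc + \<mu> \<nu> \<eta>(0)\<close> and \<open>\<nu> - \<mu> \<integral>Hq\<close>, while the third one is \<open>O(|\<mu>| + |\<nu>|)\<close> and is
  multiplied by a minor of order two, because the first two columns are parallel to leading order.
  Expanding along the first row gives \<open>L D(\<mu>, \<nu>)\<close> times the determinant of \<open>(\<eta>', \<eta>'')\<close> and of the
  increment of \<open>(f, f')\<close> over a period (\<open>evans_expansion\<close>).

  This last determinant does not vanish (\<open>monodromy_nondegenerate\<close>). Otherwise
  \<open>f(x + L) = f(x) + \<alpha> \<eta>'(x)\<close> for some \<open>\<alpha>\<close>. If \<open>\<alpha> = 0\<close>, then \<open>f\<close> is a periodic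
  element of the kernel which is not a multiple of \<open>\<eta>'\<close>. If \<open>\<alpha> \<noteq> 0\<close>, then \<open>Hc + (Lc / \<alpha>) f\<close> is
  periodic, and the equation satisfied by \<open>Hc\<close> shows that \<open>A_omega\<close> is in the range. Both are excluded by the
  spectral assumptions on the wave.\<close>

section \<open>Perturbation of linear ordinary differential equations\<close>

text \<open>A Gronwall estimate for data vanishing at \<open>0\<close>. The function
  \<open>exp (- (2 K + 1) x) (\<parallel>R x\<parallel>\<^sup>2 + e\<^sup>2)\<close> is nonincreasing: working with the square of the norm keeps
  it differentiable where \<open>R\<close> vanishes.\<close>
lemma gronwall_nonneg:
  fixes R :: "real \<Rightarrow> 'a::real_inner"
  assumes "0 \<le> K" "0 \<le> e"
    and d: "\<And>x. 0 \<le> x \<Longrightarrow> x \<le> T \<Longrightarrow> (R has_vector_derivative R' x) (at x)"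
    and b: "\<And>x. 0 \<le> x \<Longrightarrow> x \<le> T \<Longrightarrow> norm (R' x) \<le> K * norm (R x) + e"
    and "R 0 = 0" "0 \<le> x" "x \<le> T"
  shows "norm (R x) \<le> e * exp ((K + 1) * T)"
proof -
  define \<phi> where "\<phi> = (\<lambda>x. exp (- (2 * K + 1) * x) * (R x \<bullet> R x + e\<^sup>2))"
  define \<phi>' where "\<phi>' = (\<lambda>x. exp (- (2 * K + 1) * x) *
     (2 * (R x \<bullet> R' x) - (2 * K + 1) * (R x \<bullet> R x + e\<^sup>2)))"
  have "(\<phi> has_real_derivative \<phi>' y) (at y)" if "0 \<le> y" "y \<le> T" for y
  proof -
    have "((\<lambda>x. R x \<bullet> R x) has_real_derivative 2 * (R y \<bullet> R' y)) (at y)"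
      using has_derivative_inner[OF d[OF that, unfolded has_vector_derivative_def]
          d[OF that, unfolded has_vector_derivative_def]]
      by (simp add: has_field_derivative_def inner_commute algebra_simps mult_commute_abs)
    then show ?thesis unfolding \<phi>_def \<phi>'_def
      by (auto intro!: derivative_eq_intros simp: algebra_simps)
  qed
  moreover have "\<phi>' y \<le> 0" if "0 \<le> y" "y \<le> T" for y
  proof -
    have "R y \<bullet> R' y \<le> norm (R y) * norm (R' y)" by (rule norm_cauchy_schwarz)
    also have "\<dots> \<le> norm (R y) * (K * norm (R y) + e)"
      using b[OF that] by (rule mult_left_mono) simp
    finally have "R y \<bullet> R' y \<le> norm (R y) * (K * norm (R y) + e)" .
    moreover have "2 * (norm (R y) * e) \<le> (norm (R y))\<^sup>2 + e\<^sup>2"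
      using sum_squares_bound[of "norm (R y)" e] by (simp add: algebra_simps)
    moreover have "0 \<le> K * e\<^sup>2" using assms by simp
    ultimately have "2 * (R y \<bullet> R' y) - (2 * K + 1) * (R y \<bullet> R y + e\<^sup>2) \<le> 0"
      by (simp add: power2_norm_eq_inner[symmetric] algebra_simps power2_eq_square)
    then show ?thesis unfolding \<phi>'_def by (simp add: mult_nonneg_nonpos)
  qed
  ultimately have "\<phi> x \<le> \<phi> 0"
    using assms(6,7) by (intro DERIV_nonpos_imp_nonincreasing[OF assms(6), of \<phi>]) force
  then have "exp (- (2 * K + 1) * x) * (R x \<bullet> R x + e\<^sup>2) \<le> e\<^sup>2"
    by (simp add: \<phi>_def \<open>R 0 = 0\<close>)
  note le = this
  have e1: "exp ((2 * K + 1) * x) * exp (- (2 * K + 1) * x) = 1"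
    using exp_minus_inverse[of "(2 * K + 1) * x"] by (simp only: mult_minus_left)
  from le have "exp ((2 * K + 1) * x) * (exp (- (2 * K + 1) * x) * (R x \<bullet> R x + e\<^sup>2))
      \<le> exp ((2 * K + 1) * x) * e\<^sup>2"
    by (rule mult_left_mono) (rule exp_ge_zero)
  then have "R x \<bullet> R x + e\<^sup>2 \<le> exp ((2 * K + 1) * x) * e\<^sup>2"
    by (simp only: mult.assoc[symmetric] e1 mult_1_left)
  then have "(norm (R x))\<^sup>2 \<le> exp ((2 * K + 1) * x) * e\<^sup>2"
    by (simp add: power2_norm_eq_inner) (smt (verit) zero_le_power2)
  also have "\<dots> \<le> exp (2 * ((K + 1) * T)) * e\<^sup>2"
  proof -
    have "(2 * K + 1) * x \<le> (2 * (K + 1)) * T" 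
      using assms by (intro mult_mono) auto
    then show ?thesis by (intro mult_right_mono) (auto simp: algebra_simps)
  qed
  also have "\<dots> = (e * exp ((K + 1) * T))\<^sup>2"
    by (simp add: power_mult_distrib exp_double)
  finally show ?thesis
    by (rule power2_le_imp_le) (use assms in simp)
qed

lemma gronwall:
  fixes R :: "real \<Rightarrow> 'a::real_inner"
  assumes "0 \<le> K" "0 \<le> e"
    and d: "\<And>x. \<bar>x\<bar> \<le> T \<Longrightarrow> (R has_vector_derivative R' x) (at x)"
    and b: "\<And>x. \<bar>x\<bar> \<le> T \<Longrightarrow> norm (R' x) \<le> K * norm (R x) + e"
    and "R 0 = 0" "\<bar>x\<bar> \<le> T"
  shows "norm (R x) \<le> e * exp ((K + 1) * T)"
proof (cases "0 \<le> x")
  case True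
  show ?thesis
    by (rule gronwall_nonneg[OF assms(1,2) d b \<open>R 0 = 0\<close>, of T x]) (use True assms in auto)
next
  case False
  have "norm (R (- (- x))) \<le> e * exp ((K + 1) * T)"
  proof (rule gronwall_nonneg[OF assms(1,2), of T "\<lambda>x. R (- x)" "\<lambda>x. - R' (- x)" "- x"])
    fix y :: real assume "0 \<le> y" "y \<le> T"
    then have *: "\<bar>- y\<bar> \<le> T" by auto
    have "((R \<circ> uminus) has_vector_derivative (- 1) *\<^sub>R R' (- y)) (at y)"
      using * by (intro vector_diff_chain_at)
        (auto intro!: derivative_eq_intros d)
    then show "((\<lambda>x. R (- x)) has_vector_derivative - R' (- y)) (at y)" by (simp add: o_def)
    show "norm (- R' (- y)) \<le> K * norm (R (- y)) + e" using b[OF *] by simp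
  qed (use False assms in auto)
  then show ?thesis by simp
qed

lemma norm_matrix_vector_mult_le:
  fixes A :: "complex ^ 'n ^ 'm"
  shows "norm (A *v x) \<le> real (CARD('m) * CARD('n)) * norm A * norm x"
proof -
  have "norm (A *v x) \<le> (\<Sum>i\<in>UNIV. norm ((A *v x) $ i))"
    unfolding norm_vec_def by (rule L2_set_le_sum) simp
  also have "\<dots> \<le> (\<Sum>i\<in>(UNIV :: 'm set). real CARD('n) * norm A * norm x)"
  proof (rule sum_mono)
    fix i
    have "norm ((A *v x) $ i) \<le> (\<Sum>j\<in>UNIV. norm (A $ i $ j * x $ j))"
      unfolding matrix_vector_mult_def by (simp add: norm_sum)
    also have "\<dots> \<le> (\<Sum>j\<in>(UNIV :: 'n set). norm A * norm x)"
    proof (rule sum_mono)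
      fix j
      have "norm (A $ i $ j) \<le> norm A"
        using Finite_Cartesian_Product.norm_nth_le[of "A $ i" j]
          Finite_Cartesian_Product.norm_nth_le[of A i] by linarith
      then show "norm (A $ i $ j * x $ j) \<le> norm A * norm x"
        unfolding norm_mult by (rule mult_mono) (auto intro: Finite_Cartesian_Product.norm_nth_le)
    qed
    finally show "norm ((A *v x) $ i) \<le> real CARD('n) * norm A * norm x" by simp
  qed
  finally show ?thesis by simp
qed

text \<open>An approximate solution whose defect is \<open>O(\<mu>\<^sup>n)\<close> is \<open>O(\<mu>\<^sup>n)\<close>-close to the exact solution with the
  same initial value. This replaces any discussion of the dependence of the fundamental matrix on
  the spectral parameter.\<close>
lemma fundamental_matrix_perturbation:
  fixes A :: "complex \<Rightarrow> real \<Rightarrow> complex ^ 3 ^ 3" and Y :: "complex \<Rightarrow> real \<Rightarrow> complex ^ 3"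
  assumes "\<And>\<mu>. fundamental_matrix (A \<mu>) (\<Psi> \<mu>)"
    and B: "\<And>\<mu> x. norm \<mu> \<le> 1 \<Longrightarrow> \<bar>x\<bar> \<le> T \<Longrightarrow> norm (A \<mu> x) \<le> B"
    and Y: "\<And>\<mu> x. (Y \<mu> has_vector_derivative A \<mu> x *v Y \<mu> x + g \<mu> x) (at x)"
    and g: "\<And>\<mu> x. norm \<mu> \<le> 1 \<Longrightarrow> \<bar>x\<bar> \<le> T \<Longrightarrow> norm (g \<mu> x) \<le> G * norm \<mu> ^ n"
    and "0 \<le> T" "0 \<le> G"
  shows "\<exists>C\<ge>0. \<forall>\<mu> x. norm \<mu> \<le> 1 \<longrightarrow> \<bar>x\<bar> \<le> T \<longrightarrow>
    norm (\<Psi> \<mu> x *v Y \<mu> 0 - Y \<mu> x) \<le> C * norm \<mu> ^ n"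
proof -
  have "0 \<le> B" by (rule order_trans[OF norm_ge_zero B[of 0 0]]) (use \<open>0 \<le> T\<close> in auto)
  have "norm (\<Psi> \<mu> x *v Y \<mu> 0 - Y \<mu> x) \<le> G * norm \<mu> ^ n * exp ((9 * B + 1) * T)"
    if \<mu>: "norm \<mu> \<le> 1" and x: "\<bar>x\<bar> \<le> T" for \<mu> x
  proof (rule gronwall[OF _ _ _ _ _ x])
    fix y :: real assume y: "\<bar>y\<bar> \<le> T"
    have "(\<Psi> \<mu> has_vector_derivative A \<mu> y ** \<Psi> \<mu> y) (at y)"
      using assms(1) by (auto simp: fundamental_matrix_def)
    moreover have "bounded_linear (\<lambda>M :: complex ^ 3 ^ 3. M *v Y \<mu> 0)"
      by (intro linear_conv_bounded_linear[THEN iffD1] linearI)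
        (auto simp: matrix_vector_mult_add_rdistrib matrix_vector_mult_def vec_eq_iff sum_3 algebra_simps)
    ultimately have "((\<lambda>x. \<Psi> \<mu> x *v Y \<mu> 0) has_vector_derivative (A \<mu> y ** \<Psi> \<mu> y) *v Y \<mu> 0) (at y)"
      using bounded_linear.has_vector_derivative by blast
    from has_vector_derivative_diff[OF this Y[of \<mu> y]]
    show "((\<lambda>x. \<Psi> \<mu> x *v Y \<mu> 0 - Y \<mu> x) has_vector_derivative
        A \<mu> y *v (\<Psi> \<mu> y *v Y \<mu> 0 - Y \<mu> y) - g \<mu> y) (at y)"
      by (simp add: matrix_vector_mul_assoc[symmetric] matrix_vector_mult_diff_distrib algebra_simps)
    have "norm (A \<mu> y *v (\<Psi> \<mu> y *v Y \<mu> 0 - Y \<mu> y)) \<le> 9 * B * norm (\<Psi> \<mu> y *v Y \<mu> 0 - Y \<mu> y)"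
      using norm_matrix_vector_mult_le[of "A \<mu> y" "\<Psi> \<mu> y *v Y \<mu> 0 - Y \<mu> y"] B[OF \<mu> y]
        mult_right_mono[OF B[OF \<mu> y], of "9 * norm (\<Psi> \<mu> y *v Y \<mu> 0 - Y \<mu> y)"]
      by simp
    then show "norm (A \<mu> y *v (\<Psi> \<mu> y *v Y \<mu> 0 - Y \<mu> y) - g \<mu> y)
        \<le> 9 * B * norm (\<Psi> \<mu> y *v Y \<mu> 0 - Y \<mu> y) + G * norm \<mu> ^ n"
      using g[OF \<mu> y]
        norm_triangle_ineq4[of "A \<mu> y *v (\<Psi> \<mu> y *v Y \<mu> 0 - Y \<mu> y)" "g \<mu> y"] by linarith
  qed (use assms \<open>0 \<le> B\<close> in \<open>auto simp: fundamental_matrix_def\<close>)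
  then show ?thesis using \<open>0 \<le> G\<close>
    by (intro exI[of _ "G * exp ((9 * B + 1) * T)"]) (auto simp: algebra_simps)
qed

lemma linear_ode2_unique:
  fixes f g P0 P1 :: "real \<Rightarrow> real"
  assumes f: "\<And>x. (f has_real_derivative g x) (at x)"
    and g: "\<And>x. (g has_real_derivative P1 x * g x + P0 x * f x) (at x)"
    and "continuous_on UNIV P1" "continuous_on UNIV P0" "f 0 = 0" "g 0 = 0"
  shows "f x = 0" "g x = 0"
proof -
  have "\<exists>B\<ge>0. \<forall>y. \<bar>y\<bar> \<le> \<bar>x\<bar> \<longrightarrow> \<bar>P y\<bar> \<le> B" if "continuous_on UNIV P" for P :: "real \<Rightarrow> real"
  proof -
    have "compact (P ` {- \<bar>x\<bar>..\<bar>x\<bar>})"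
      by (intro compact_continuous_image continuous_on_subset[OF that]) auto
    then obtain B where "B > 0" "\<forall>y\<in>P ` {- \<bar>x\<bar>..\<bar>x\<bar>}. norm y \<le> B"
      using compact_imp_bounded bounded_pos by metis
    then show ?thesis by (intro exI[of _ B]) (auto simp: abs_le_iff)
  qed
  from this[OF assms(3)] this[OF assms(4)] obtain B1 B0 where
    B: "B1 \<ge> 0" "B0 \<ge> 0" "\<And>y. \<bar>y\<bar> \<le> \<bar>x\<bar> \<Longrightarrow> \<bar>P1 y\<bar> \<le> B1" "\<And>y. \<bar>y\<bar> \<le> \<bar>x\<bar> \<Longrightarrow> \<bar>P0 y\<bar> \<le> B0"
    by auto
  have "norm (f x, g x) \<le> 0 * exp ((1 + B1 + B0 + 1) * \<bar>x\<bar>)"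
  proof (rule gronwall[where R = "\<lambda>x. (f x, g x)" and R' = "\<lambda>x. (g x, P1 x * g x + P0 x * f x)"])
    show "((\<lambda>x. (f x, g x)) has_vector_derivative (g y, P1 y * g y + P0 y * f y)) (at y)" for y
      using f g by (intro has_vector_derivative_Pair) (auto simp: has_real_derivative_iff_has_vector_derivative)
    fix y assume y: "\<bar>y\<bar> \<le> \<bar>x\<bar>"
    let ?N = "norm (f y, g y)"
    have N: "\<bar>f y\<bar> \<le> ?N" "\<bar>g y\<bar> \<le> ?N"
      using norm_fst_le[of "f y" "g y"] norm_snd_le[of "g y" "f y"] by auto
    have "norm (g y, P1 y * g y + P0 y * f y) \<le> \<bar>g y\<bar> + \<bar>P1 y * g y + P0 y * f y\<bar>"
      using norm_Pair_le[of "g y" "P1 y * g y + P0 y * f y"] by simp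
    also have "\<dots> \<le> \<bar>g y\<bar> + (\<bar>P1 y\<bar> * \<bar>g y\<bar> + \<bar>P0 y\<bar> * \<bar>f y\<bar>)"
      by (simp add: abs_mult[symmetric])
    also have "\<dots> \<le> ?N + (B1 * ?N + B0 * ?N)"
      using N B y by (intro add_mono mult_mono) auto
    finally show "norm (g y, P1 y * g y + P0 y * f y) \<le> (1 + B1 + B0) * ?N + 0"
      by (simp add: algebra_simps)
  qed (use assms B in \<open>auto simp: zero_prod_def\<close>)
  then show "f x = 0" "g x = 0" by (simp_all add: zero_prod_def)
qed

lemma LBINT_eq_antiderivative_diff:
  fixes f J :: "real \<Rightarrow> real"
  assumes "continuous_on UNIV f" "\<And>x. (J has_real_derivative f x) (at x)"
  shows "(LBINT x=0..L. f x) = J L - J 0"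
  unfolding zero_ereal_def
  by (rule interval_integral_FTC_finite)
    (use assms in \<open>auto simp: has_real_derivative_iff_has_vector_derivative
      intro: has_vector_derivative_at_within continuous_on_subset\<close>)

section \<open>Functions vanishing to a given order\<close>

text \<open>The limit is taken as in the final statement, so that the estimate there is an instance.\<close>
definition vanishes_to_order :: "nat \<Rightarrow> (complex \<times> complex \<Rightarrow> complex) \<Rightarrow> bool" where
  "vanishes_to_order n f \<longleftrightarrow>
     f \<in> O[at (0, 0) within UNIV \<times> {\<nu>. Re \<nu> = 0}](\<lambda>(\<mu>, \<nu>). of_real ((norm \<mu> + norm \<nu>) ^ n))"

lemma vanishes_to_orderI:
  assumes "\<And>\<mu> \<nu>. norm \<mu> \<le> 1 \<Longrightarrow> norm \<nu> \<le> 1 \<Longrightarrow> norm (f (\<mu>, \<nu>)) \<le> C * (norm \<mu> + norm \<nu>) ^ n"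
  shows "vanishes_to_order n f"
  unfolding vanishes_to_order_def
proof (rule bigoI[of _ C])
  show "\<forall>\<^sub>F p in at (0, 0) within UNIV \<times> {\<nu>. Re \<nu> = 0}.
      norm (f p) \<le> C * norm (case p of (\<mu>, \<nu>) \<Rightarrow> complex_of_real ((norm \<mu> + norm \<nu>) ^ n))"
    unfolding eventually_at
  proof (intro exI[of _ 1] conjI ballI impI)
    fix p :: "complex \<times> complex" assume d: "p \<noteq> (0, 0) \<and> dist p (0, 0) < 1"
    obtain \<mu> \<nu> where p: "p = (\<mu>, \<nu>)" by force
    have "norm \<mu> \<le> 1" "norm \<nu> \<le> 1"
      using d norm_fst_le[of \<mu> \<nu>] norm_snd_le[of \<nu> \<mu>] unfolding p dist_norm by (auto simp: zero_prod_def[symmetric])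
    from assms[OF this] show "norm (f p) \<le> C * norm (case p of (\<mu>, \<nu>) \<Rightarrow> complex_of_real ((norm \<mu> + norm \<nu>) ^ n))"
      unfolding p prod.case norm_of_real by simp
  qed simp
qed

lemma vanishes_to_order_mult:
  assumes "vanishes_to_order m f" "vanishes_to_order n g"
  shows "vanishes_to_order (m + n) (\<lambda>p. f p * g p)"
proof -
  have "(\<lambda>(\<mu>, \<nu>). complex_of_real ((norm (\<mu> :: complex) + norm (\<nu> :: complex)) ^ (m + n)))
    = (\<lambda>p. (case p of (\<mu>, \<nu>) \<Rightarrow> of_real ((norm \<mu> + norm \<nu>) ^ m)) * (case p of (\<mu>, \<nu>) \<Rightarrow> of_real ((norm \<mu> + norm \<nu>) ^ n)))"
    by (auto simp: power_add)
  then show ?thesis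
    using landau_o.big.mult[OF assms[unfolded vanishes_to_order_def]]
    unfolding vanishes_to_order_def by simp
qed

lemma vanishes_to_order_add:
  assumes "vanishes_to_order n f" "vanishes_to_order n g"
  shows "vanishes_to_order n (\<lambda>p. f p + g p)"
  using sum_in_bigo(1)[OF assms[unfolded vanishes_to_order_def]] unfolding vanishes_to_order_def .

lemma vanishes_to_order_diff:
  assumes "vanishes_to_order n f" "vanishes_to_order n g"
  shows "vanishes_to_order n (\<lambda>p. f p - g p)"
  using sum_in_bigo(2)[OF assms[unfolded vanishes_to_order_def]] unfolding vanishes_to_order_def .

lemma vanishes_to_order_const: "vanishes_to_order 0 (\<lambda>p. a)"
  by (rule vanishes_to_orderI[of _ "norm a"]) simp

lemma vanishes_to_order_fst: "vanishes_to_order 1 fst"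
  by (rule vanishes_to_orderI[of _ 1]) simp

lemma vanishes_to_order_snd: "vanishes_to_order 1 snd"
  by (rule vanishes_to_orderI[of _ 1]) simp

lemma vanishes_to_order_mono:
  assumes "vanishes_to_order n f" "m \<le> n"
  shows "vanishes_to_order m f"
proof -
  have "(\<lambda>(\<mu>, \<nu>). complex_of_real ((norm (\<mu> :: complex) + norm (\<nu> :: complex)) ^ n))
    \<in> O[at (0, 0) within UNIV \<times> {\<nu>. Re \<nu> = 0}](\<lambda>(\<mu>, \<nu>). of_real ((norm \<mu> + norm \<nu>) ^ m))"
    unfolding vanishes_to_order_def[symmetric]
  proof (rule vanishes_to_orderI[of _ "2 ^ (n - m)"], clarsimp)
    fix \<mu> \<nu> :: complex assume *: "norm \<mu> \<le> 1" "norm \<nu> \<le> 1"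
    have "norm (complex_of_real (norm \<mu>) + complex_of_real (norm \<nu>)) = norm \<mu> + norm \<nu>"
      unfolding of_real_add[symmetric] norm_of_real by simp
    moreover have "(norm \<mu> + norm \<nu>) ^ n = (norm \<mu> + norm \<nu>) ^ (n - m) * (norm \<mu> + norm \<nu>) ^ m"
      using \<open>m \<le> n\<close> by (simp add: power_add[symmetric])
    moreover have "(norm \<mu> + norm \<nu>) ^ (n - m) \<le> 2 ^ (n - m)"
      using * by (intro power_mono) auto
    ultimately show "norm ((complex_of_real (norm \<mu>) + complex_of_real (norm \<nu>)) ^ n) 
       \<le> 2 ^ (n - m) * (norm \<mu> + norm \<nu>) ^ m"
      by (simp add: norm_power mult_right_mono)
  qed
  then show ?thesis using assms(1) unfolding vanishes_to_order_def 
    by (rule landau_o.big_trans[rotated])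
qed

lemma vanishes_to_order_fstI:
  assumes "\<And>\<mu>. norm \<mu> \<le> 1 \<Longrightarrow> norm (f \<mu>) \<le> C * norm \<mu> ^ n" "C \<ge> 0"
  shows "vanishes_to_order n (\<lambda>p. f (fst p))"
proof (rule vanishes_to_orderI[of _ C])
  fix \<mu> \<nu> :: complex assume "norm \<mu> \<le> 1" "norm \<nu> \<le> 1"
  have "norm (f \<mu>) \<le> C * norm \<mu> ^ n" by (rule assms) fact
  also have "\<dots> \<le> C * (norm \<mu> + norm \<nu>) ^ n"
    using \<open>C \<ge> 0\<close> by (intro mult_left_mono power_mono) auto
  finally show "norm (f (fst (\<mu>, \<nu>))) \<le> C * (norm \<mu> + norm \<nu>) ^ n" by simp
qed

lemma vanishes_to_order_exp: "vanishes_to_order 2 (\<lambda>p. exp (snd p) - 1 - snd p)"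
proof (rule vanishes_to_orderI[of _ "exp 1"])
  fix \<mu> \<nu> :: complex assume "norm \<mu> \<le> 1" and \<nu>: "norm \<nu> \<le> 1"
  have "norm (exp \<nu> - (\<Sum>k\<le>1. \<nu> ^ k / fact k)) \<le> exp \<bar>Re \<nu>\<bar> * norm \<nu> ^ Suc 1 / fact 1"
    by (rule Taylor_exp)
  also have "\<dots> \<le> exp 1 * (norm \<mu> + norm \<nu>) ^ 2"
    using order_trans[OF abs_Re_le_cmod \<nu>] by (auto simp: power2_eq_square intro!: mult_mono)
  finally show "norm (exp (snd (\<mu>, \<nu>)) - 1 - snd (\<mu>, \<nu>)) \<le> exp 1 * (norm \<mu> + norm \<nu>)\<^sup>2"
    by (simp add: algebra_simps)
qed

text \<open>The basis of approximate solutions depends on \<open>\<mu>\<close>, so its determinant is divided out as a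
  function with a nonzero limit, not as a constant.\<close>
lemma vanishes_to_order_cancel:
  assumes "vanishes_to_order n (\<lambda>p. g p * b p)"
    and "(b \<longlongrightarrow> \<beta>) (at (0, 0) within UNIV \<times> {\<nu>. Re \<nu> = 0})" "\<beta> \<noteq> 0"
  shows "vanishes_to_order n g"
proof -
  have "\<forall>\<^sub>F p in at (0, 0) within UNIV \<times> {\<nu>. Re \<nu> = 0}. norm (b p) > norm \<beta> / 2"
    using tendsto_norm[OF assms(2)] by (rule order_tendstoD) (use assms(3) in simp)
  then have "\<forall>\<^sub>F p in at (0, 0) within UNIV \<times> {\<nu>. Re \<nu> = 0}. norm (g p) \<le> 2 / norm \<beta> * norm (g p * b p)"
  proof eventually_elim
    case (elim p)
    then have "norm (g p) * (norm \<beta> / 2) \<le> norm (g p) * norm (b p)"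
      by (intro mult_left_mono) auto
    then show ?case using assms(3) by (simp add: norm_mult field_simps)
  qed
  then have "g \<in> O[at (0, 0) within UNIV \<times> {\<nu>. Re \<nu> = 0}](\<lambda>p. g p * b p)"
    by (rule bigoI)
  then show ?thesis using assms(1) unfolding vanishes_to_order_def by (rule landau_o.big_trans)
qed

text \<open>The expansion of the determinant, stated for the entries after replacing the first row by
  the mass. The first two columns agree, below the first row, with the multiples \<open>\<xi>\<close> and \<open>- Lq\<close> of
  the same vector \<open>(u1, u2)\<close>, hence the minor that multiplies \<open>e13\<close> is of order two instead of one,
  and knowing \<open>e13\<close> up to order one is enough.\<close>
lemma vanishes_to_order_det:
  fixes a m b u1 u2 w1 w2 Lc Lq :: complex
  defines "r1 \<equiv> (\<lambda>p. fst p ^ 2 * a + fst p * snd p * m)"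
    and "r2 \<equiv> (\<lambda>p. snd p - fst p * b)"
    and "\<xi> \<equiv> (\<lambda>p. fst p * Lc - snd p)"
  assumes 11: "vanishes_to_order 3 (\<lambda>p. e11 p - r1 p)"
    and 21: "vanishes_to_order 2 (\<lambda>p. e21 p - \<xi> p * u1)"
    and 31: "vanishes_to_order 2 (\<lambda>p. e31 p - \<xi> p * u2)"
    and 12: "vanishes_to_order 2 (\<lambda>p. e12 p - r2 p)"
    and 22: "vanishes_to_order 1 (\<lambda>p. e22 p - (- Lq * u1))"
    and 32: "vanishes_to_order 1 (\<lambda>p. e32 p - (- Lq * u2))"
    and 13: "vanishes_to_order 1 e13"
    and 23: "vanishes_to_order 1 (\<lambda>p. e23 p - w1)"
    and 33: "vanishes_to_order 1 (\<lambda>p. e33 p - w2)"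
  shows "vanishes_to_order 3 (\<lambda>p. e11 p * (e22 p * e33 p - e32 p * e23 p)
     - e12 p * (e21 p * e33 p - e31 p * e23 p) + e13 p * (e21 p * e32 p - e31 p * e22 p)
     - (u1 * w2 - u2 * w1) * (- Lq * r1 p - r2 p * \<xi> p))"
proof -
  note c = vanishes_to_order_const and M = vanishes_to_order_mult and A = vanishes_to_order_add
    and S = vanishes_to_order_diff and W = vanishes_to_order_mono
  have mc: "vanishes_to_order n (\<lambda>p. f p * x)" if "vanishes_to_order n f" for n f x
    using M[OF that c] by simp
  have \<xi>: "vanishes_to_order 1 \<xi>" and r2: "vanishes_to_order 1 r2"
    unfolding \<xi>_def r2_def 
    by (intro S mc vanishes_to_order_fst vanishes_to_order_snd)+
  have r1: "vanishes_to_order 2 r1"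
    unfolding r1_def 
    using A[OF mc[OF M[OF vanishes_to_order_fst vanishes_to_order_fst]]
        mc[OF M[OF vanishes_to_order_fst vanishes_to_order_snd]]]
    by (simp add: power2_eq_square numeral_2_eq_2)

  have D: "vanishes_to_order n f" if "vanishes_to_order k (\<lambda>p. f p - g p)" "vanishes_to_order l g" 
      "n \<le> k" "n \<le> l" for f g n k l
    using A[OF W[OF that(1,3)] W[OF that(2,4)]] by simp
  have \<xi>u: "vanishes_to_order 1 (\<lambda>p. \<xi> p * u)" for u using \<xi> by (rule mc)
  have e12: "vanishes_to_order 1 e12" and e21: "vanishes_to_order 1 e21" and e31: "vanishes_to_order 1 e31"
    and e22: "vanishes_to_order 0 e22" and e32: "vanishes_to_order 0 e32"
    and e23: "vanishes_to_order 0 e23" and e33: "vanishes_to_order 0 e33"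
    by (rule D[OF 12 r2] D[OF 21 \<xi>u] D[OF 31 \<xi>u] D[OF 22 c] D[OF 32 c] D[OF 23 c] D[OF 33 c]; simp)+
\<comment> \<open>The error of order one in the second factor is multiplied by \<open>f'\<close>, which vanishes to order \<open>n\<close>.\<close>
  have P: "vanishes_to_order (Suc n) (\<lambda>p. f p * h p - f' p * h' p)" 
    if "vanishes_to_order (Suc n) (\<lambda>p. f p - f' p)" "vanishes_to_order 1 (\<lambda>p. h p - h' p)" 
      "vanishes_to_order 0 h" "vanishes_to_order n f'" for f f' h h' n
  proof -
    have "f p * h p - f' p * h' p = (f p - f' p) * h p + f' p * (h p - h' p)" for p
      by (simp add: algebra_simps)
    then show ?thesis using A[OF M[OF that(1,3)], of "\<lambda>p. f' p * (h p - h' p)"] M[OF that(4,2)] by simp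
  qed
  have P1: "vanishes_to_order 1 (\<lambda>p. f p * h p - f' p * h' p)"
    if "vanishes_to_order 1 (\<lambda>p. f p - f' p)" "vanishes_to_order 1 (\<lambda>p. h p - h' p)"
      "vanishes_to_order 0 h" "vanishes_to_order 0 f'" for f f' h h'
    using P[of 0 f f' h h'] that by (simp add: eval_nat_numeral)
  have P2: "vanishes_to_order 2 (\<lambda>p. f p * h p - f' p * h' p)"
    if "vanishes_to_order 2 (\<lambda>p. f p - f' p)" "vanishes_to_order 1 (\<lambda>p. h p - h' p)"
      "vanishes_to_order 0 h" "vanishes_to_order 1 f'" for f f' h h'
    using P[of 1 f f' h h'] that by (simp add: eval_nat_numeral)
  have P3: "vanishes_to_order 3 (\<lambda>p. f p * h p - f' p * h' p)"
    if "vanishes_to_order 3 (\<lambda>p. f p - f' p)" "vanishes_to_order 1 (\<lambda>p. h p - h' p)"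
      "vanishes_to_order 0 h" "vanishes_to_order 2 f'" for f f' h h'
    using P[of 2 f f' h h'] that by (simp add: eval_nat_numeral)
  define w where "w = u1 * w2 - u2 * w1"
  have d1: "vanishes_to_order 1 (\<lambda>p. (e22 p * e33 p - e32 p * e23 p) - (- Lq * w))"
    using S[OF P1[OF 22 33 e33 c] P1[OF 32 23 e23 c]] 
    by (simp add: w_def algebra_simps)
  have d2: "vanishes_to_order 2 (\<lambda>p. (e21 p * e33 p - e31 p * e23 p) - \<xi> p * w)"
    using S[OF P2[OF 21 33 e33 \<xi>u] P2[OF 31 23 e23 \<xi>u]]
    by (simp add: w_def algebra_simps numeral_2_eq_2)
  have d3: "vanishes_to_order 2 (\<lambda>p. e21 p * e32 p - e31 p * e22 p)"
    using S[OF P2[OF 21 32 e32 \<xi>u] P2[OF 31 22 e22 \<xi>u]]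
    by (simp add: algebra_simps numeral_2_eq_2)
  have 1: "vanishes_to_order 3 (\<lambda>p. e11 p * (e22 p * e33 p - e32 p * e23 p) - r1 p * (- Lq * w))"
    using P3[OF 11 d1 _ r1] S[OF M[OF e22 e33] M[OF e32 e23]] by simp
  have 2: "vanishes_to_order 3 (\<lambda>p. e12 p * (e21 p * e33 p - e31 p * e23 p) - r2 p * (\<xi> p * w))"
  proof -
    have "vanishes_to_order 1 (\<lambda>p. e21 p * e33 p - e31 p * e23 p)"
      using S[OF M[OF e21 e33] M[OF e31 e23]] by simp
    then have "vanishes_to_order 3 (\<lambda>p. (e12 p - r2 p) * (e21 p * e33 p - e31 p * e23 p))"
      "vanishes_to_order 3 (\<lambda>p. r2 p * ((e21 p * e33 p - e31 p * e23 p) - \<xi> p * w))"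
      using M[OF 12] M[OF r2 d2] by (simp_all add: eval_nat_numeral)
    from A[OF this] show ?thesis
      by (simp add: algebra_simps)
  qed
  have 3: "vanishes_to_order 3 (\<lambda>p. e13 p * (e21 p * e32 p - e31 p * e22 p))"
    using M[OF 13 d3] by (simp add: eval_nat_numeral)
  have "(\<lambda>p. e11 p * (e22 p * e33 p - e32 p * e23 p)
     - e12 p * (e21 p * e33 p - e31 p * e23 p) + e13 p * (e21 p * e32 p - e31 p * e22 p)
     - w * (- Lq * r1 p - r2 p * \<xi> p))
    = (\<lambda>p. (e11 p * (e22 p * e33 p - e32 p * e23 p) - r1 p * (- Lq * w))
       - (e12 p * (e21 p * e33 p - e31 p * e23 p) - r2 p * (\<xi> p * w))
       + e13 p * (e21 p * e32 p - e31 p * e22 p))"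
    by (rule ext) (simp add: algebra_simps)
  with A[OF S[OF 1 2] 3] show ?thesis by (simp add: w_def[symmetric])
qed

text \<open>In the \<open>(q, h, h')\<close> coordinates the operation on the first row is the passage to \<open>q - c h\<close>.\<close>
lemma det_columns_row_op:
  fixes X :: "complex ^ 3 ^ 3" and c :: complex
  shows "det X * det (transpose (vector [y1, y2, y3] :: complex ^ 3 ^ 3)) =
    (let e = (\<lambda>y. (X *v y) $ 1 - c * (X *v y) $ 2) in
      e y1 * ((X *v y2) $ 2 * (X *v y3) $ 3 - (X *v y2) $ 3 * (X *v y3) $ 2)
      - e y2 * ((X *v y1) $ 2 * (X *v y3) $ 3 - (X *v y1) $ 3 * (X *v y3) $ 2)
      + e y3 * ((X *v y1) $ 2 * (X *v y2) $ 3 - (X *v y1) $ 3 * (X *v y2) $ 2))"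
proof -
  have "(X ** transpose (vector [y1, y2, y3] :: complex ^ 3 ^ 3)) $ i $ 1 = (X *v y1) $ i"
    "(X ** transpose (vector [y1, y2, y3] :: complex ^ 3 ^ 3)) $ i $ 2 = (X *v y2) $ i"
    "(X ** transpose (vector [y1, y2, y3] :: complex ^ 3 ^ 3)) $ i $ 3 = (X *v y3) $ i" for i
    by (simp_all add: matrix_matrix_mult_def matrix_vector_mult_def transpose_def)
  then show ?thesis
    unfolding det_mul[symmetric] unfolding det_3 Let_def by (simp add: algebra_simps)
qed

lemma diff_mat_mult_vec:
  "((M - mat \<sigma>) *v y) $ i = (M *v y) $ i - \<sigma> * (y :: complex ^ 3) $ i"
  using exhaust_3[of i] by (auto simp: matrix_vector_mult_def sum_3 mat_def algebra_simps)

lemma has_vector_derivative_complex_of_real: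
  "(f has_real_derivative d) (at x) \<Longrightarrow>
    ((\<lambda>x. complex_of_real (f x)) has_vector_derivative of_real d) (at x)"
  by (simp add: has_real_derivative_iff_has_vector_derivative has_vector_derivative_of_real)

section \<open>The linearized profile equation\<close>

text \<open>On substituting \<open>Q = c H - q\<close>, the profile equation reads
  \<open>\<delta> c H'' = lin1 F q H H' - (H - (c - q / H)\<^sup>2)\<close>. The derivative of its right-hand side in direction
  \<open>(f, f')\<close> is \<open>lin1 f' + lin0 f\<close>, and its derivative with respect to \<open>q\<close> is \<open>- linq\<close>.\<close>
definition lin1 :: "real \<Rightarrow> real \<Rightarrow> real \<Rightarrow> real" where
  "lin1 F q h = h / F\<^sup>2 - q\<^sup>2 / h\<^sup>2"

definition lin0 :: "real \<Rightarrow> real \<Rightarrow> real \<Rightarrow> real \<Rightarrow> real \<Rightarrow> real" where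
  "lin0 F c q h h1 = (1 / F\<^sup>2 + 2 * q\<^sup>2 / h ^ 3) * h1 - 1 + 2 * (c - q / h) * q / h\<^sup>2"

definition linq :: "real \<Rightarrow> real \<Rightarrow> real \<Rightarrow> real \<Rightarrow> real" where
  "linq c q h h1 = 2 * q * h1 / h\<^sup>2 + 2 * (c - q / h) / h"

lemma DERIV_flux_h:
  assumes "F \<noteq> 0" "\<And>x. \<eta> x > 0" "(\<eta> has_real_derivative \<eta>1) (at x)"
  shows "((\<lambda>x. flux_h F (\<eta> x) (c * \<eta> x - q)) has_real_derivative
    \<eta>1 / F\<^sup>2 - 2 * (c - q / \<eta> x) * (q * \<eta>1 / (\<eta> x)\<^sup>2)) (at x)"
proof -
  have nz: "\<eta> x \<noteq> 0" for x using assms(2)[of x] by simp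
  have "(\<lambda>x. flux_h F (\<eta> x) (c * \<eta> x - q)) = (\<lambda>x. \<eta> x / F\<^sup>2 - (c - q / \<eta> x)\<^sup>2)"
    using nz assms(1) by (auto simp: flux_h_eq power_divide[symmetric] diff_divide_distrib)
  then show ?thesis using assms nz[of x]
    by (auto intro!: derivative_eq_intros simp: power2_eq_square)
qed

lemma DERIV_flux_q:
  assumes "\<And>x. \<eta> x > 0" "(\<eta> has_real_derivative \<eta>1) (at x)"
  shows "((\<lambda>x. flux_q F (\<eta> x) (c * \<eta> x - q)) has_real_derivative 2 * q * \<eta>1 / (\<eta> x)\<^sup>2) (at x)"
proof -
  have nz: "\<eta> x \<noteq> 0" for x using assms(1)[of x] by simp
  have "(\<lambda>x. flux_q F (\<eta> x) (c * \<eta> x - q)) = (\<lambda>x. 2 * (c - q / \<eta> x))"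
    using nz by (auto simp: flux_q_eq diff_divide_distrib algebra_simps)
  then show ?thesis using assms nz[of x]
    by (auto intro!: derivative_eq_intros simp: power2_eq_square)
qed

text \<open>The row for \<open>h''\<close>, sorted by powers of \<open>\<mu>\<close>. At \<open>\<mu> = 0\<close> it becomes
  \<open>lin1 h' + lin0 h + linq (q - c h)\<close>, up to the factor \<open>\<delta> c\<close>: the linearized profile equation, where
  \<open>q - c h\<close> is a constant.\<close>
lemma evans_matrix_eq:
  assumes "F \<noteq> 0" "\<And>x. \<eta> x > 0" "(\<eta> has_real_derivative \<eta>1) (at x)"
  shows "evans_matrix \<delta> F c \<eta> (\<lambda>x. c * \<eta> x - q) \<mu> x =
    vector [vector [0, - \<mu>, of_real c], vector [0, 0, 1],
      vector [(of_real (linq c q (\<eta> x) \<eta>1) + \<mu>) / of_real (\<delta> * c),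
        (of_real (lin0 F c q (\<eta> x) \<eta>1 - c * linq c q (\<eta> x) \<eta>1)
          + \<mu> * of_real (2 * q / \<eta> x - c)) / of_real (\<delta> * c),
        (of_real (lin1 F q (\<eta> x)) + of_real \<delta> * \<mu>) / of_real (\<delta> * c)]]"
proof -
  have nz: "\<eta> x \<noteq> 0" using assms(2)[of x] by simp
  note gh = DERIV_imp_deriv[OF DERIV_flux_h[OF assms, of c q]]
  note gq = DERIV_imp_deriv[OF DERIV_flux_q[OF assms(2,3), of F c q]]
  have 1: "2 * q * \<eta>1 / (\<eta> x)\<^sup>2 - source_q (\<eta> x) (c * \<eta> x - q) = linq c q (\<eta> x) \<eta>1"
    using nz by (simp add: source_q_eq linq_def field_simps power2_eq_square)
  have 2: "\<eta>1 / F\<^sup>2 - 2 * (c - q / \<eta> x) * (q * \<eta>1 / (\<eta> x)\<^sup>2) - source_h (\<eta> x) (c * \<eta> x - q)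
      = lin0 F c q (\<eta> x) \<eta>1 - c * linq c q (\<eta> x) \<eta>1"
    using nz assms(1) unfolding source_h_eq[OF nz] lin0_def linq_def
    by (simp add: divide_simps) (simp add: algebra_simps power2_eq_square power3_eq_cube)
  have 3: "flux_q F (\<eta> x) (c * \<eta> x - q) = 2 * (c - q / \<eta> x)"
    using nz by (simp add: flux_q_eq diff_divide_distrib algebra_simps)
  have 4: "flux_h F (\<eta> x) (c * \<eta> x - q) + c * (2 * (c - q / \<eta> x)) - c\<^sup>2 = lin1 F q (\<eta> x)"
    using nz assms(1) unfolding flux_h_eq[OF assms(1) nz] lin1_def
    by (simp add: divide_simps) (simp add: algebra_simps power2_eq_square)
  have 1: "source_q (\<eta> x) (c * \<eta> x - q) = 2 * q * \<eta>1 / (\<eta> x)\<^sup>2 - linq c q (\<eta> x) \<eta>1"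
    and 2: "source_h (\<eta> x) (c * \<eta> x - q) = \<eta>1 / F\<^sup>2 - 2 * (c - q / \<eta> x) * (q * \<eta>1 / (\<eta> x)\<^sup>2)
      - (lin0 F c q (\<eta> x) \<eta>1 - c * linq c q (\<eta> x) \<eta>1)"
    and 4: "flux_h F (\<eta> x) (c * \<eta> x - q) = lin1 F q (\<eta> x) - c * (2 * (c - q / \<eta> x)) + c\<^sup>2"
    using 1 2 4 by linarith+
  show ?thesis
    unfolding evans_matrix_def Let_def gh gq 1 2 3 4
    by (simp add: vec_eq_iff forall_3 algebra_simps)
qed

lemma continuous_on_bounded_symmetric_interval:
  fixes f :: "real \<Rightarrow> 'a::real_normed_vector"
  assumes "continuous_on UNIV f"
  shows "\<exists>B\<ge>0. \<forall>x. \<bar>x\<bar> \<le> T \<longrightarrow> norm (f x) \<le> B"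
proof -
  have "compact (f ` {- T..T})"
    by (intro compact_continuous_image continuous_on_subset[OF assms]) auto
  then obtain B where "B > 0" "\<forall>y\<in>f ` {- T..T}. norm y \<le> B"
    using compact_imp_bounded bounded_pos by metis
  then show ?thesis by (intro exI[of _ B]) (auto simp: abs_le_iff)
qed

lemma continuous_on_vector3:
  assumes "\<And>i. continuous_on S (\<lambda>x. f x $ i)"
  shows "continuous_on S (f :: _ \<Rightarrow> 'a::topological_space ^ 3)"
  using continuous_on_vec_lambda[of S "\<lambda>i x. f x $ i"] assms by simp

section \<open>Expansion of the Evans function at a wave\<close>

text \<open>What the expansion uses of the family of waves, at one wave: \<open>hc\<close> and \<open>hq\<close> stand for the
  parameter derivatives of the profile, \<open>hc1\<close> and \<open>hq1\<close> for those of its slope, \<open>Lc\<close> and \<open>Lq\<close> for those of the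
  period. The last two assumptions are the ones on the kernel and on the range of the linearized
  operator, in the unscaled variable.\<close>
locale wave_linearization =
  fixes \<delta> F c q L Lc Lq :: real and \<eta> \<eta>1 hc hc1 hq hq1 :: "real \<Rightarrow> real"
  assumes nz: "\<delta> \<noteq> 0" "F \<noteq> 0" "c \<noteq> 0"
    and pos: "\<And>x. \<eta> x > 0"
    and \<eta>: "\<And>x. (\<eta> has_real_derivative \<eta>1 x) (at x)"
    and \<eta>1: "\<And>x. (\<eta>1 has_real_derivative
          (lin1 F q (\<eta> x) * \<eta>1 x - (\<eta> x - (c - q / \<eta> x)\<^sup>2)) / (\<delta> * c)) (at x)"
    and hq: "\<And>x. (hq has_real_derivative hq1 x) (at x)"
    and hq1: "\<And>x. (hq1 has_real_derivative
          (lin1 F q (\<eta> x) * hq1 x + lin0 F c q (\<eta> x) (\<eta>1 x) * hq x - linq c q (\<eta> x) (\<eta>1 x))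
            / (\<delta> * c)) (at x)"
    and hc: "\<And>x. (hc has_real_derivative hc1 x) (at x)"
    and hc1: "\<And>x. (hc1 has_real_derivative
          (lin1 F q (\<eta> x) * hc1 x + lin0 F c q (\<eta> x) (\<eta>1 x) * hc x + 2 * (c - q / \<eta> x)
            - \<delta> * deriv \<eta>1 x) / (\<delta> * c)) (at x)"
    and periodic: "\<And>x. \<eta> (x + L) = \<eta> x"
    and hc_shift: "\<And>x. hc (x + L) = hc x - Lc * \<eta>1 x"
    and hc1_shift: "\<And>x. hc1 (x + L) = hc1 x - Lc * deriv \<eta>1 x"
    and hq_shift: "\<And>x. hq (x + L) = hq x - Lq * \<eta>1 x"
    and hq1_shift: "\<And>x. hq1 (x + L) = hq1 x - Lq * deriv \<eta>1 x"
    and nonconstant: "\<exists>x. \<eta>1 x \<noteq> 0"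
    and simple_kernel: "\<And>f f1.
          (\<And>x. (f has_real_derivative f1 x) (at x)) \<Longrightarrow>
          (\<And>x. (f1 has_real_derivative
             (lin1 F q (\<eta> x) * f1 x + lin0 F c q (\<eta> x) (\<eta>1 x) * f x) / (\<delta> * c)) (at x)) \<Longrightarrow>
          (\<And>x. f (x + L) = f x) \<Longrightarrow> \<exists>a. \<forall>x. f x = a * \<eta>1 x"
    and not_in_range: "\<And>f f1.
          (\<And>x. (f has_real_derivative f1 x) (at x)) \<Longrightarrow>
          (\<And>x. (f1 has_real_derivative
             (lin1 F q (\<eta> x) * f1 x + lin0 F c q (\<eta> x) (\<eta>1 x) * f x + 2 * (c - q / \<eta> x)
               - \<delta> * deriv \<eta>1 x) / (\<delta> * c)) (at x)) \<Longrightarrow>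
          (\<And>x. f (x + L) = f x) \<Longrightarrow> False"
begin

abbreviation "\<eta>2 \<equiv> deriv \<eta>1"
abbreviation "p1 x \<equiv> lin1 F q (\<eta> x)"
abbreviation "p0 x \<equiv> lin0 F c q (\<eta> x) (\<eta>1 x)"
abbreviation "pq x \<equiv> linq c q (\<eta> x) (\<eta>1 x)"
abbreviation "A \<equiv> evans_matrix \<delta> F c \<eta> (\<lambda>x. c * \<eta> x - q)"

lemma eta_neq_0: "\<eta> x \<noteq> 0"
  using pos[of x] by simp

lemma eta2_eq: "\<eta>2 x = (p1 x * \<eta>1 x - (\<eta> x - (c - q / \<eta> x)\<^sup>2)) / (\<delta> * c)"
  by (rule DERIV_imp_deriv) (rule \<eta>1)

lemma \<eta>1': "(\<eta>1 has_real_derivative \<eta>2 x) (at x)"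
  unfolding eta2_eq by (rule \<eta>1)

lemma \<eta>2: "(\<eta>2 has_real_derivative (p1 x * \<eta>2 x + p0 x * \<eta>1 x) / (\<delta> * c)) (at x)"
proof -
  have d1: "((\<lambda>x. lin1 F q (\<eta> x)) has_real_derivative (1 / F\<^sup>2 + 2 * q\<^sup>2 / \<eta> x ^ 3) * \<eta>1 x) (at x)"
    unfolding lin1_def using nz eta_neq_0[of x]
    by (auto intro!: derivative_eq_intros \<eta> simp: field_simps power2_eq_square power3_eq_cube)
  have d2: "((\<lambda>x. \<eta> x - (c - q / \<eta> x)\<^sup>2) has_real_derivative
      (1 - 2 * (c - q / \<eta> x) * q / (\<eta> x)\<^sup>2) * \<eta>1 x) (at x)"
    using eta_neq_0[of x]
    by (auto intro!: derivative_eq_intros \<eta> simp: field_simps power2_eq_square power3_eq_cube)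
  from DERIV_cdivide[OF DERIV_diff[OF DERIV_mult[OF d1 \<eta>1'] d2], of "\<delta> * c"]
  have "((\<lambda>x. (lin1 F q (\<eta> x) * \<eta>1 x - (\<eta> x - (c - q / \<eta> x)\<^sup>2)) / (\<delta> * c)) has_real_derivative
      (p1 x * \<eta>2 x + p0 x * \<eta>1 x) / (\<delta> * c)) (at x)"
    by (simp add: lin0_def algebra_simps)
  then show ?thesis unfolding eta2_eq[abs_def, symmetric] .
qed

lemma cont: "continuous_on UNIV \<eta>" "continuous_on UNIV \<eta>1" "continuous_on UNIV \<eta>2"
    "continuous_on UNIV hc" "continuous_on UNIV hc1" "continuous_on UNIV hq" "continuous_on UNIV hq1"
  using DERIV_isCont[OF \<eta>] DERIV_isCont[OF \<eta>1'] DERIV_isCont[OF \<eta>2] DERIV_isCont[OF hc]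
    DERIV_isCont[OF hc1] DERIV_isCont[OF hq] DERIV_isCont[OF hq1]
  by (auto intro: continuous_at_imp_continuous_on)

lemma cont_coeffs: "continuous_on UNIV p1" "continuous_on UNIV p0" "continuous_on UNIV pq"
  unfolding lin1_def lin0_def linq_def
  by (auto intro!: continuous_intros cont simp: nz eta_neq_0)

lemma eta_derivs_periodic: "\<eta>1 (x + L) = \<eta>1 x" "\<eta>2 (x + L) = \<eta>2 x"
proof -
  have "\<eta>1 (x + L) = \<eta>1 x" for x
  proof -
    have "((\<lambda>x. \<eta> (x + L)) has_real_derivative \<eta>1 (x + L)) (at x)"
      using \<eta>[of "x + L"] by (rule DERIV_shift[THEN iffD1])
    then show ?thesis unfolding periodic using \<eta>[of x] DERIV_unique by blast
  qed
  then show "\<eta>1 (x + L) = \<eta>1 x" "\<eta>2 (x + L) = \<eta>2 x" unfolding eta2_eq by (simp_all add: periodic)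
qed

lemma A_mult:
  "A \<mu> x *v vector [y1, y2, y3] = vector [- \<mu> * y2 + of_real c * y3, y3,
     ((of_real (pq x) + \<mu>) * y1 + (of_real (p0 x - c * pq x) + \<mu> * of_real (2 * q / \<eta> x - c)) * y2
       + (of_real (p1 x) + of_real \<delta> * \<mu>) * y3) / of_real (\<delta> * c)]"
  unfolding evans_matrix_eq[OF nz(2) pos \<eta>]
  by (simp add: vec_eq_iff forall_3 matrix_vector_mult_def sum_3 flip: add_divide_distrib)

lemma A_bounded: "\<exists>B. \<forall>\<mu> x. norm \<mu> \<le> 1 \<longrightarrow> \<bar>x\<bar> \<le> T \<longrightarrow> norm (A \<mu> x) \<le> B"
proof -
  let ?S = "cball 0 1 \<times> {- T..T} :: (complex \<times> real) set"
  have *: "continuous_on ?S (\<lambda>p. complex_of_real (f (snd p)))"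
    if "continuous_on UNIV f" for f :: "real \<Rightarrow> real"
    by (rule continuous_on_of_real, rule continuous_on_compose2[OF that])
      (auto intro: continuous_intros)
  note c = *[OF cont(1)] *[OF cont_coeffs(1)] *[OF cont_coeffs(2)] *[OF cont_coeffs(3)]
  have "\<forall>i j. continuous_on ?S (\<lambda>p. A (fst p) (snd p) $ i $ j)"
    unfolding evans_matrix_eq[OF nz(2) pos \<eta>] forall_3 vector_3 of_real_diff of_real_mult of_real_divide
    by (intro conjI continuous_on_const continuous_on_add continuous_on_diff continuous_on_mult
        continuous_on_minus continuous_on_divide c continuous_on_fst continuous_on_id ballI)
      (simp_all add: nz eta_neq_0)
  then have "continuous_on ?S (\<lambda>p. A (fst p) (snd p))"
    by (intro continuous_on_vector3) (erule allE, erule allE, assumption)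
  then have "bounded ((\<lambda>p. A (fst p) (snd p)) ` ?S)"
    by (intro compact_imp_bounded compact_continuous_image compact_Times) auto
  then obtain B where "\<forall>y\<in>(\<lambda>p. A (fst p) (snd p)) ` ?S. norm y \<le> B"
    unfolding bounded_iff by (rule exE)
  then have "\<forall>p\<in>?S. norm (A (fst p) (snd p)) \<le> B" by (rule ball_imageD)
  from bspec[OF this, of "(\<mu>, x)" for \<mu> x] show ?thesis
    by (intro exI[of _ B]) (auto simp: abs_le_iff)
qed


text \<open>The equation for \<open>h\<close> is required to hold exactly: all approximations used below
  have \<open>y3 = y2'\<close>.\<close>
lemma approximate_spectral_solution:
  assumes \<Psi>: "\<And>\<mu>. fundamental_matrix (A \<mu>) (\<Psi> \<mu>)"
    and "\<And>\<mu> x. (y1 \<mu> has_vector_derivative - \<mu> * y2 \<mu> x + of_real c * y3 \<mu> x + \<mu> ^ n * g1 x) (at x)"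
    and "\<And>\<mu> x. (y2 \<mu> has_vector_derivative y3 \<mu> x) (at x)"
    and "\<And>\<mu> x. (y3 \<mu> has_vector_derivative
        ((of_real (pq x) + \<mu>) * y1 \<mu> x + (of_real (p0 x - c * pq x) + \<mu> * of_real (2 * q / \<eta> x - c)) * y2 \<mu> x
       + (of_real (p1 x) + of_real \<delta> * \<mu>) * y3 \<mu> x) / of_real (\<delta> * c) + \<mu> ^ n * g3 x) (at x)"
    and "continuous_on UNIV g1" "continuous_on UNIV g3"
  shows "\<exists>C\<ge>0. \<forall>\<mu> x. norm \<mu> \<le> 1 \<longrightarrow> \<bar>x\<bar> \<le> \<bar>L\<bar> \<longrightarrow>
    norm (\<Psi> \<mu> x *v vector [y1 \<mu> 0, y2 \<mu> 0, y3 \<mu> 0] - vector [y1 \<mu> x, y2 \<mu> x, y3 \<mu> x]) \<le> C * norm \<mu> ^ n"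
proof -
  obtain B where B: "\<And>\<mu> x. norm \<mu> \<le> 1 \<Longrightarrow> \<bar>x\<bar> \<le> \<bar>L\<bar> \<Longrightarrow> norm (A \<mu> x) \<le> B"
    using A_bounded[of "\<bar>L\<bar>"] by auto
  define g :: "real \<Rightarrow> complex ^ 3" where "g = (\<lambda>x. vector [g1 x, 0, g3 x])"
  have "continuous_on UNIV (\<lambda>x. g x $ i)" for i
    using exhaust_3[of i] assms(5,6) by (auto simp: g_def)
  then have "continuous_on UNIV g" by (rule continuous_on_vector3)
  then obtain G where G: "0 \<le> G" "\<And>x. \<bar>x\<bar> \<le> \<bar>L\<bar> \<Longrightarrow> norm (g x) \<le> G"
    using continuous_on_bounded_symmetric_interval by blast
  have n: "norm (z *s v) = norm z * norm v" for z :: complex and v :: "complex ^ 3"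
    by (simp add: norm_vec_def norm_mult L2_set_right_distrib)
  show ?thesis
  proof (rule fundamental_matrix_perturbation[OF \<Psi> B, where g = "\<lambda>\<mu> x. \<mu> ^ n *s g x" and G = G])
    show "((\<lambda>x. vector [y1 \<mu> x, y2 \<mu> x, y3 \<mu> x]) has_vector_derivative
        A \<mu> x *v vector [y1 \<mu> x, y2 \<mu> x, y3 \<mu> x] + \<mu> ^ n *s g x) (at x)" for \<mu> x
      unfolding has_vector_derivative_vector3_iff A_mult g_def using assms(2-4)[where x = x] by simp
    show "norm (\<mu> ^ n *s g x) \<le> G * norm \<mu> ^ n" if "\<bar>x\<bar> \<le> \<bar>L\<bar>" for \<mu> x
      unfolding n using mult_right_mono[OF G(2)[OF that], of "norm \<mu> ^ n"] by (simp add: norm_power mult.commute)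
  qed (use G in auto)
qed

text \<open>Since \<open>(q - c h)' = - \<mu> h\<close>, an approximation of \<open>h\<close> up to \<open>O(\<mu>\<^sup>n)\<close> with antiderivative \<open>K\<close> gives
  the increment of \<open>q - c h\<close> over a period up to \<open>O(\<mu>\<^sup>n\<^sup>+\<^sup>1)\<close>. The estimate is obtained from
  \<open>gronwall\<close> with \<open>K = 0\<close>.\<close>
lemma mass_increment:
  fixes Y0 :: "complex \<Rightarrow> complex ^ 3"
  assumes \<Psi>: "\<And>\<mu>. fundamental_matrix (A \<mu>) (\<Psi> \<mu>)"
    and K: "\<And>\<mu> x. (K \<mu> has_vector_derivative k \<mu> x) (at x)"
    and C: "0 \<le> C" "\<And>\<mu> x. norm \<mu> \<le> 1 \<Longrightarrow> \<bar>x\<bar> \<le> \<bar>L\<bar> \<Longrightarrow> norm ((\<Psi> \<mu> x *v Y0 \<mu>) $ 2 - k \<mu> x) \<le> C * norm \<mu> ^ n"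
  shows "\<exists>C\<ge>0. \<forall>\<mu>. norm \<mu> \<le> 1 \<longrightarrow>
    norm ((\<Psi> \<mu> L *v Y0 \<mu>) $ 1 - of_real c * (\<Psi> \<mu> L *v Y0 \<mu>) $ 2 
      - (Y0 \<mu> $ 1 - of_real c * Y0 \<mu> $ 2 - \<mu> * (K \<mu> L - K \<mu> 0))) \<le> C * norm \<mu> ^ Suc n"
proof -
  have "norm ((\<Psi> \<mu> L *v Y0 \<mu>) $ 1 - of_real c * (\<Psi> \<mu> L *v Y0 \<mu>) $ 2 
      - (Y0 \<mu> $ 1 - of_real c * Y0 \<mu> $ 2 - \<mu> * (K \<mu> L - K \<mu> 0))) \<le> C * norm \<mu> ^ Suc n * exp ((0 + 1) * \<bar>L\<bar>)"
    if \<mu>: "norm \<mu> \<le> 1" for \<mu>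
  proof (rule gronwall[where R = "\<lambda>x. (\<Psi> \<mu> x *v Y0 \<mu>) $ 1 - of_real c * (\<Psi> \<mu> x *v Y0 \<mu>) $ 2 
      - (Y0 \<mu> $ 1 - of_real c * Y0 \<mu> $ 2 - \<mu> * (K \<mu> x - K \<mu> 0))" and R' = "\<lambda>x. - \<mu> * ((\<Psi> \<mu> x *v Y0 \<mu>) $ 2 - k \<mu> x)"])
    fix y :: real assume y: "\<bar>y\<bar> \<le> \<bar>L\<bar>"
    have "(\<Psi> \<mu> has_vector_derivative A \<mu> y ** \<Psi> \<mu> y) (at y)"
      using \<Psi> by (auto simp: fundamental_matrix_def)
    moreover have "bounded_linear (\<lambda>M :: complex ^ 3 ^ 3. (M *v Y0 \<mu>) $ i)" for i
      by (intro linear_conv_bounded_linear[THEN iffD1] linearI)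
        (auto simp: matrix_vector_mult_def sum_3 algebra_simps)
    from bounded_linear.has_vector_derivative[OF this calculation]
    have d: "((\<lambda>x. (\<Psi> \<mu> x *v Y0 \<mu>) $ i) has_vector_derivative ((A \<mu> y ** \<Psi> \<mu> y) *v Y0 \<mu>) $ i) (at y)" for i .
    define v where "v = \<Psi> \<mu> y *v Y0 \<mu>"
    have v: "v = vector [v $ 1, v $ 2, v $ 3]" by (simp add: vec_eq_iff forall_3)
    have Av: "A \<mu> y *v v = vector [- \<mu> * v $ 2 + of_real c * v $ 3, v $ 3,
     ((of_real (pq y) + \<mu>) * v $ 1 + (of_real (p0 y - c * pq y) + \<mu> * of_real (2 * q / \<eta> y - c)) * v $ 2
       + (of_real (p1 y) + of_real \<delta> * \<mu>) * v $ 3) / of_real (\<delta> * c)]"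
      using A_mult[of \<mu> y "v $ 1" "v $ 2" "v $ 3"] unfolding v[symmetric] .
    have d1: "((\<lambda>x. (\<Psi> \<mu> x *v Y0 \<mu>) $ 1) has_vector_derivative - \<mu> * v $ 2 + of_real c * v $ 3) (at y)"
      using d[of 1] unfolding matrix_vector_mul_assoc[symmetric] v_def[symmetric]
      unfolding Av by simp
    have d2: "((\<lambda>x. (\<Psi> \<mu> x *v Y0 \<mu>) $ 2) has_vector_derivative v $ 3) (at y)"
      using d[of 2] unfolding matrix_vector_mul_assoc[symmetric] v_def[symmetric]
      unfolding Av by simp
    have "((\<lambda>x. (\<Psi> \<mu> x *v Y0 \<mu>) $ 1 - of_real c * (\<Psi> \<mu> x *v Y0 \<mu>) $ 2 
      - (Y0 \<mu> $ 1 - of_real c * Y0 \<mu> $ 2 - \<mu> * (K \<mu> x - K \<mu> 0))) has_vector_derivative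
      (- \<mu> * v $ 2 + of_real c * v $ 3) - of_real c * v $ 3 - (0 - \<mu> * (k \<mu> y - 0))) (at y)"
      by (intro has_vector_derivative_diff has_vector_derivative_mult_right has_vector_derivative_const d1 d2 K)
    then show "((\<lambda>x. (\<Psi> \<mu> x *v Y0 \<mu>) $ 1 - of_real c * (\<Psi> \<mu> x *v Y0 \<mu>) $ 2 
      - (Y0 \<mu> $ 1 - of_real c * Y0 \<mu> $ 2 - \<mu> * (K \<mu> x - K \<mu> 0))) has_vector_derivative
      - \<mu> * ((\<Psi> \<mu> y *v Y0 \<mu>) $ 2 - k \<mu> y)) (at y)"
      by (simp add: v_def[symmetric] algebra_simps)
    show "norm (- \<mu> * ((\<Psi> \<mu> y *v Y0 \<mu>) $ 2 - k \<mu> y)) \<le> 0 * norm ((\<Psi> \<mu> y *v Y0 \<mu>) $ 1 - of_real c * (\<Psi> \<mu> y *v Y0 \<mu>) $ 2 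
      - (Y0 \<mu> $ 1 - of_real c * Y0 \<mu> $ 2 - \<mu> * (K \<mu> y - K \<mu> 0))) + C * norm \<mu> ^ Suc n"
      using mult_left_mono[OF C(2)[OF \<mu> y], of "norm \<mu>"] by (simp add: norm_mult mult_ac)
  qed (use \<open>0 \<le> C\<close> \<Psi> in \<open>auto simp: fundamental_matrix_def\<close>)
  then show ?thesis using \<open>0 \<le> C\<close>
    by (intro exI[of _ "C * exp \<bar>L\<bar>"]) (auto simp: algebra_simps)
qed

text \<open>The fundamental matrix provides solutions of the linearized profile equation with any initial
  values: start from \<open>q - c h = 0\<close>, a relation that is preserved at \<open>\<mu> = 0\<close>, and take real parts, the
  coefficients being real.\<close>

lemma massless_solution:
  assumes \<Psi>: "fundamental_matrix (A 0) \<Psi>0"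
  obtains f f1 where "\<And>x. (f has_real_derivative f1 x) (at x)"
    "\<And>x. (f1 has_real_derivative (p1 x * f1 x + p0 x * f x) / (\<delta> * c)) (at x)"
    "f 0 = a" "f1 0 = b"
proof -
  define Z :: "real \<Rightarrow> complex ^ 3" where "Z = (\<lambda>x. \<Psi>0 x *v vector [of_real (c * a), of_real a, of_real b])"
  have Z0: "Z 0 = vector [of_real (c * a), of_real a, of_real b]"
    using \<Psi> by (simp add: Z_def fundamental_matrix_def)
  have "(Z has_vector_derivative A 0 x *v Z x) (at x)" for x
  proof -
    have "(\<Psi>0 has_vector_derivative A 0 x ** \<Psi>0 x) (at x)"
      using \<Psi> by (auto simp: fundamental_matrix_def)
    moreover have "bounded_linear (\<lambda>M :: complex ^ 3 ^ 3. M *v vector [of_real (c * a), of_real a, of_real b])"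
      by (intro linear_conv_bounded_linear[THEN iffD1] linearI)
        (auto simp: matrix_vector_mult_add_rdistrib matrix_vector_mult_def vec_eq_iff sum_3 algebra_simps)
    from bounded_linear.has_vector_derivative[OF this calculation]
    show ?thesis unfolding Z_def matrix_vector_mul_assoc .
  qed
  moreover have Z: "vector [Z x $ 1, Z x $ 2, Z x $ 3] = Z x" for x by (simp add: vec_eq_iff forall_3)
  ultimately have "((\<lambda>x. vector [Z x $ 1, Z x $ 2, Z x $ 3]) has_vector_derivative 
     A 0 x *v vector [Z x $ 1, Z x $ 2, Z x $ 3]) (at x)" for x unfolding Z by blast
  note D = this[unfolded has_vector_derivative_vector3_iff A_mult, simplified]
  define z where "z = (\<lambda>i x. Re (Z x $ i))"
  have z1: "(z 1 has_real_derivative c * z 3 x) (at x)"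
   and z2: "(z 2 has_real_derivative z 3 x) (at x)"
   and z3: "(z 3 has_real_derivative (pq x * z 1 x + (p0 x - c * pq x) * z 2 x + p1 x * z 3 x) / (\<delta> * c)) (at x)" for x
    using bounded_linear.has_vector_derivative[OF bounded_linear_Re D[of x, THEN conjunct1]]
      bounded_linear.has_vector_derivative[OF bounded_linear_Re D[of x, THEN conjunct2, THEN conjunct1]]
      bounded_linear.has_vector_derivative[OF bounded_linear_Re D[of x, THEN conjunct2, THEN conjunct2]]
    by (simp_all add: z_def has_real_derivative_iff_has_vector_derivative flip: of_real_mult of_real_diff)
  have "((\<lambda>x. z 1 x - c * z 2 x) has_real_derivative c * z 3 x - c * z 3 x) (at x)" for x
    by (intro DERIV_diff DERIV_cmult z1 z2)
  then have "\<forall>x. ((\<lambda>x. z 1 x - c * z 2 x) has_real_derivative 0) (at x)" by simp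
  from DERIV_isconst_all[OF this, of _ 0] have "z 1 x = c * z 2 x" for x
    by (simp add: z_def Z0)
  then have "(z 3 has_real_derivative (p1 x * z 3 x + p0 x * z 2 x) / (\<delta> * c)) (at x)" for x
    using z3[of x] by (simp add: algebra_simps)
  then show ?thesis using that[OF z2] by (simp add: z_def Z0)
qed


lemma cont_quotients:
  "continuous_on UNIV (\<lambda>x. p1 x / (\<delta> * c))" "continuous_on UNIV (\<lambda>x. p0 x / (\<delta> * c))"
  by (auto intro!: continuous_on_divide continuous_on_const cont_coeffs simp: nz)

text \<open>The derivative of the wave solves a linear second-order equation, so by uniqueness it would vanish
  identically.\<close>
lemma eta_derivs_at_0_nonzero: "(\<eta>1 0)\<^sup>2 + (\<eta>2 0)\<^sup>2 \<noteq> 0"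
proof
  assume "(\<eta>1 0)\<^sup>2 + (\<eta>2 0)\<^sup>2 = 0"
  then have "\<eta>1 0 = 0" and "\<eta>2 0 = 0" by (simp_all add: sum_power2_eq_zero_iff)
  have H: "(\<eta>2 has_real_derivative p1 x / (\<delta> * c) * \<eta>2 x + p0 x / (\<delta> * c) * \<eta>1 x) (at x)" for x
    using \<eta>2[of x] by (simp add: add_divide_distrib)
  have "\<eta>1 x = 0" for x
    by (rule linear_ode2_unique(1)[OF \<eta>1' H cont_quotients]) fact+
  with nonconstant show False by simp
qed

text \<open>The initial values of \<open>f\<close> are orthogonal to \<open>(\<eta>', \<eta>'')(0)\<close>, so \<open>f\<close> is independent of \<open>\<eta>'\<close>. A
  vanishing determinant means that the increment of \<open>(f, f')\<close> over a period is \<open>\<alpha> (\<eta>', \<eta>'')\<close>, that is, that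
  \<open>1\<close> is a double Floquet multiplier of the linearized profile equation. An eigenfunction \<open>f\<close>
  (\<open>\<alpha> = 0\<close>) contradicts the simplicity of the kernel; if \<open>f\<close> belongs to a Jordan block
  (\<open>\<alpha> \<noteq> 0\<close>), adding a multiple of it makes \<open>hc\<close> periodic.\<close>
lemma monodromy_nondegenerate:
  assumes f: "\<And>x. (f has_real_derivative f1 x) (at x)"
    and f1: "\<And>x. (f1 has_real_derivative (p1 x * f1 x + p0 x * f x) / (\<delta> * c)) (at x)"
    and f0: "f 0 = - \<eta>2 0" "f1 0 = \<eta>1 0"
  shows "\<eta>1 0 * (f1 L - f1 0) - \<eta>2 0 * (f L - f 0) \<noteq> 0"
proof
  assume det: "\<eta>1 0 * (f1 L - f1 0) - \<eta>2 0 * (f L - f 0) = 0"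
  define n where "n = (\<eta>1 0)\<^sup>2 + (\<eta>2 0)\<^sup>2"
  have "n \<noteq> 0" unfolding n_def by (rule eta_derivs_at_0_nonzero)
  define \<alpha> where "\<alpha> = (\<eta>1 0 * (f L - f 0) + \<eta>2 0 * (f1 L - f1 0)) / n"
  have "f L - f 0 = \<alpha> * \<eta>1 0" 
  proof -
    have "n * (f L - f 0) = \<eta>1 0 * (\<eta>1 0 * (f L - f 0) + \<eta>2 0 * (f1 L - f1 0))
      - \<eta>2 0 * (\<eta>1 0 * (f1 L - f1 0) - \<eta>2 0 * (f L - f 0))"
      by (simp add: n_def algebra_simps power2_eq_square)
    then show ?thesis using \<open>n \<noteq> 0\<close> unfolding det \<alpha>_def by (simp add: field_simps)
  qed
  moreover have "f1 L - f1 0 = \<alpha> * \<eta>2 0"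
  proof -
    have "n * (f1 L - f1 0) = \<eta>2 0 * (\<eta>1 0 * (f L - f 0) + \<eta>2 0 * (f1 L - f1 0))
      + \<eta>1 0 * (\<eta>1 0 * (f1 L - f1 0) - \<eta>2 0 * (f L - f 0))"
      by (simp add: n_def algebra_simps power2_eq_square)
    then show ?thesis using \<open>n \<noteq> 0\<close> unfolding det \<alpha>_def by (simp add: field_simps)
  qed
  ultimately have jump: "f L - f 0 = \<alpha> * \<eta>1 0" "f1 L - f1 0 = \<alpha> * \<eta>2 0" by simp_all
  define g where "g = (\<lambda>x. f (x + L) - f x - \<alpha> * \<eta>1 x)"
  define g1 where "g1 = (\<lambda>x. f1 (x + L) - f1 x - \<alpha> * \<eta>2 x)"
  have shift: "f (x + L) = f x + \<alpha> * \<eta>1 x" for x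
  proof -
    have g: "(g has_real_derivative g1 x) (at x)" for x
      unfolding g_def g1_def
      by (intro DERIV_diff DERIV_cmult f \<eta>1' f[THEN DERIV_shift[THEN iffD1]])
    have "(g1 has_real_derivative (p1 (x + L) * f1 (x + L) + p0 (x + L) * f (x + L)) / (\<delta> * c)
        - (p1 x * f1 x + p0 x * f x) / (\<delta> * c) - \<alpha> * ((p1 x * \<eta>2 x + p0 x * \<eta>1 x) / (\<delta> * c))) (at x)" for x
      unfolding g1_def
      by (intro DERIV_diff DERIV_cmult f1 \<eta>2 f1[THEN DERIV_shift[THEN iffD1]])
    note g1' = this
    have g1: "(g1 has_real_derivative p1 x / (\<delta> * c) * g1 x + p0 x / (\<delta> * c) * g x) (at x)" for x
      unfolding periodic eta_derivs_periodic g_def g1_def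
      by (rule DERIV_cong[OF g1'[unfolded periodic eta_derivs_periodic g1_def]])
        (simp add: algebra_simps add_divide_distrib diff_divide_distrib)
    have "g x = 0"
      by (rule linear_ode2_unique(1)[OF g g1 cont_quotients])
        (use jump in \<open>simp_all add: g_def g1_def\<close>)
    then show ?thesis by (simp add: g_def)
  qed
  show False
  proof (cases "\<alpha> = 0")
    case True
    then obtain a where a: "\<And>x. f x = a * \<eta>1 x"
      using simple_kernel[OF f f1] shift by auto
    then have "(f has_real_derivative a * \<eta>2 x) (at x)" for x
      using DERIV_cmult[OF \<eta>1'[of x], of a] by (simp add: a[abs_def])
    then have "f1 0 = a * \<eta>2 0" using f[of 0] DERIV_unique by blast
    then have 1: "\<eta>1 0 = a * \<eta>2 0" and 2: "\<eta>2 0 = - (a * \<eta>1 0)" using a[of 0] f0 by auto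
    have "n = \<eta>1 0 * (a * \<eta>2 0) + \<eta>2 0 * - (a * \<eta>1 0)"
      unfolding n_def power2_eq_square 1[symmetric] 2[symmetric] ..
    then have "n = 0" by simp
    with \<open>n \<noteq> 0\<close> show False by simp
  next
    case False
    show False
    proof (rule not_in_range[of "\<lambda>x. hc x + Lc / \<alpha> * f x" "\<lambda>x. hc1 x + Lc / \<alpha> * f1 x"])
      show "((\<lambda>x. hc x + Lc / \<alpha> * f x) has_real_derivative hc1 x + Lc / \<alpha> * f1 x) (at x)" for x
        by (intro DERIV_add DERIV_cmult hc f)
      show "((\<lambda>x. hc1 x + Lc / \<alpha> * f1 x) has_real_derivative
         (p1 x * (hc1 x + Lc / \<alpha> * f1 x) + p0 x * (hc x + Lc / \<alpha> * f x) + 2 * (c - q / \<eta> x)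
               - \<delta> * \<eta>2 x) / (\<delta> * c)) (at x)" for x
        by (rule DERIV_cong[OF DERIV_add[OF hc1 DERIV_cmult[OF f1]]])
          (simp add: algebra_simps add_divide_distrib diff_divide_distrib)
      show "hc (x + L) + Lc / \<alpha> * f (x + L) = hc x + Lc / \<alpha> * f x" for x
        unfolding hc_shift shift using False by (simp add: algebra_simps)
    qed
  qed
qed

text \<open>In the proof, \<open>Y1\<close>, \<open>Y2\<close>, \<open>Y3\<close> are the approximate solutions described at the beginning,
  \<open>\<omega>\<close> is the determinant of \<open>monodromy_nondegenerate\<close>, and \<open>n\<close> is the value at \<open>\<mu> = 0\<close> of the
  determinant of the initial values of the three solutions; the constant is \<open>\<omega> / n\<close>.\<close>
lemma evans_expansion:
  assumes \<Psi>: "\<And>\<mu>. fundamental_matrix (A \<mu>) (\<Psi> \<mu>)"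
    and Jc: "\<And>x. (Jc has_real_derivative hc x) (at x)"
    and Jq: "\<And>x. (Jq has_real_derivative hq x) (at x)"
  defines "a \<equiv> Jc L - Jc 0" and "b \<equiv> Jq L - Jq 0"
  shows "\<exists>\<Gamma>. \<Gamma> \<noteq> 0 \<and> vanishes_to_order 3 (\<lambda>p. evans \<Psi> L (fst p) (exp (snd p))
    - \<Gamma> * (fst p ^ 2 * of_real (Lc * b - Lq * a) - fst p * snd p * of_real (Lc + b + \<eta> 0 * Lq) + snd p ^ 2))"
proof -
  obtain f f1 where f: "\<And>x. (f has_real_derivative f1 x) (at x)"
    and f1: "\<And>x. (f1 has_real_derivative (p1 x * f1 x + p0 x * f x) / (\<delta> * c)) (at x)"
    and f0: "f 0 = - \<eta>2 0" "f1 0 = \<eta>1 0"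
    using massless_solution[OF \<Psi>, of "- \<eta>2 0" "\<eta>1 0"] by blast
  have contf: "continuous_on UNIV f" "continuous_on UNIV f1"
    using DERIV_isCont[OF f] DERIV_isCont[OF f1] by (auto intro: continuous_at_imp_continuous_on)
  define w1 w2 where "w1 = f L - f 0" and "w2 = f1 L - f1 0"
  define \<omega> where "\<omega> = \<eta>1 0 * w2 - \<eta>2 0 * w1"
  have "\<omega> \<noteq> 0"
    unfolding \<omega>_def w1_def w2_def by (rule monodromy_nondegenerate[OF f f1 f0])
  note R = has_vector_derivative_complex_of_real
  note cc = continuous_on_of_real[OF cont(1)] continuous_on_of_real[OF cont(2)] continuous_on_of_real[OF cont(3)]
    continuous_on_of_real[OF cont(4)] continuous_on_of_real[OF cont(5)] continuous_on_of_real[OF cont(6)] 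
    continuous_on_of_real[OF cont(7)] continuous_on_of_real[OF contf(1)] continuous_on_of_real[OF contf(2)]
  define Y1 :: "complex \<Rightarrow> real \<Rightarrow> complex ^ 3" where "Y1 = (\<lambda>\<mu> x. vector 
    [of_real (c * \<eta>1 x) - \<mu> * of_real (c * hc x + \<eta> x), of_real (\<eta>1 x) - \<mu> * of_real (hc x), of_real (\<eta>2 x) - \<mu> * of_real (hc1 x)])"
  define Y2 :: "real \<Rightarrow> complex ^ 3" where "Y2 = (\<lambda>x. vector 
    [of_real (c * hq x - 1), of_real (hq x), of_real (hq1 x)])"
  define Y3 :: "real \<Rightarrow> complex ^ 3" where "Y3 = (\<lambda>x. vector 
    [of_real (c * f x), of_real (f x), of_real (f1 x)])"
  have "\<exists>C\<ge>0. \<forall>\<mu> x. norm \<mu> \<le> 1 \<longrightarrow> \<bar>x\<bar> \<le> \<bar>L\<bar> \<longrightarrow> norm (\<Psi> \<mu> x *v Y1 \<mu> 0 - Y1 \<mu> x) \<le> C * norm \<mu> ^ 2"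
    unfolding Y1_def
  proof (rule approximate_spectral_solution[OF \<Psi>, where ?g1.0 = "\<lambda>x. - of_real (hc x)" and 
        ?g3.0 = "\<lambda>x. of_real (((c * hc x + \<eta> x) + (2 * q / \<eta> x - c) * hc x + \<delta> * hc1 x) / (\<delta> * c))"])
    fix \<mu> :: complex and x :: real
    show "((\<lambda>x. of_real (c * \<eta>1 x) - \<mu> * of_real (c * hc x + \<eta> x)) has_vector_derivative
      - \<mu> * (of_real (\<eta>1 x) - \<mu> * of_real (hc x)) + of_real c * (of_real (\<eta>2 x) - \<mu> * of_real (hc1 x)) + \<mu>\<^sup>2 * - of_real (hc x)) (at x)"
      by (rule has_vector_derivative_eq_rhs, (rule has_vector_derivative_diff has_vector_derivative_mult_right R DERIV_cmult DERIV_add \<eta> \<eta>1' hc)+)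
        (simp add: algebra_simps power2_eq_square)
    show "((\<lambda>x. of_real (\<eta>1 x) - \<mu> * of_real (hc x)) has_vector_derivative of_real (\<eta>2 x) - \<mu> * of_real (hc1 x)) (at x)"
      by (intro has_vector_derivative_diff has_vector_derivative_mult_right R \<eta>1' hc)
    show "((\<lambda>x. of_real (\<eta>2 x) - \<mu> * of_real (hc1 x)) has_vector_derivative
      ((of_real (pq x) + \<mu>) * (of_real (c * \<eta>1 x) - \<mu> * of_real (c * hc x + \<eta> x)) +
         (of_real (p0 x - c * pq x) + \<mu> * of_real (2 * q / \<eta> x - c)) * (of_real (\<eta>1 x) - \<mu> * of_real (hc x)) +
         (of_real (p1 x) + of_real \<delta> * \<mu>) * (of_real (\<eta>2 x) - \<mu> * of_real (hc1 x))) / of_real (\<delta> * c) +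
        \<mu>\<^sup>2 * of_real (((c * hc x + \<eta> x) + (2 * q / \<eta> x - c) * hc x + \<delta> * hc1 x) / (\<delta> * c))) (at x)"
    proof (rule has_vector_derivative_eq_rhs, (rule has_vector_derivative_diff has_vector_derivative_mult_right R \<eta>2 hc1)+)
\<comment> \<open>This identity cancels the terms linear in \<open>\<mu>\<close> against the derivative of the profile equation
        with respect to the speed.\<close>
      have k: "pq x * \<eta> x = 2 * (c - q / \<eta> x) + 2 * q * \<eta>1 x / \<eta> x" 
        using eta_neq_0[of x] by (simp add: linq_def field_simps power2_eq_square)
      have "of_real ((p1 x * \<eta>2 x + p0 x * \<eta>1 x)) - \<mu> * of_real
         (p1 x * hc1 x + p0 x * hc x + 2 * (c - q / \<eta> x) - \<delta> * \<eta>2 x)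
       = (of_real (pq x) + \<mu>) * (of_real (c * \<eta>1 x) - \<mu> * of_real (c * hc x + \<eta> x)) +
         (of_real (p0 x - c * pq x) + \<mu> * of_real (2 * q / \<eta> x - c)) * (of_real (\<eta>1 x) - \<mu> * of_real (hc x)) +
         (of_real (p1 x) + of_real \<delta> * \<mu>) * (of_real (\<eta>2 x) - \<mu> * of_real (hc1 x)) +
        \<mu>\<^sup>2 * of_real (((c * hc x + \<eta> x) + (2 * q / \<eta> x - c) * hc x + \<delta> * hc1 x))
        + \<mu> * of_real (pq x * \<eta> x - (2 * (c - q / \<eta> x) + 2 * q * \<eta>1 x / \<eta> x))"
        by (simp add: algebra_simps power2_eq_square add_divide_distrib diff_divide_distrib)
      then show "of_real ((p1 x * \<eta>2 x + p0 x * \<eta>1 x) / (\<delta> * c)) - \<mu> * of_real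
         ((p1 x * hc1 x + p0 x * hc x + 2 * (c - q / \<eta> x) - \<delta> * \<eta>2 x) / (\<delta> * c))
       = ((of_real (pq x) + \<mu>) * (of_real (c * \<eta>1 x) - \<mu> * of_real (c * hc x + \<eta> x)) +
         (of_real (p0 x - c * pq x) + \<mu> * of_real (2 * q / \<eta> x - c)) * (of_real (\<eta>1 x) - \<mu> * of_real (hc x)) +
         (of_real (p1 x) + of_real \<delta> * \<mu>) * (of_real (\<eta>2 x) - \<mu> * of_real (hc1 x))) / of_real (\<delta> * c) +
        \<mu>\<^sup>2 * of_real (((c * hc x + \<eta> x) + (2 * q / \<eta> x - c) * hc x + \<delta> * hc1 x) / (\<delta> * c))"
        unfolding k using nz by (simp add: divide_simps)
    qed
    show "continuous_on UNIV (\<lambda>x. - complex_of_real (hc x))"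
      by (intro continuous_intros cc)
    show "continuous_on UNIV (\<lambda>x. complex_of_real (((c * hc x + \<eta> x) + (2 * q / \<eta> x - c) * hc x + \<delta> * hc1 x) / (\<delta> * c)))"
      by (intro continuous_intros cont) (auto simp: nz eta_neq_0)
  qed
  then obtain C1 where C1: "0 \<le> C1" "\<And>\<mu> x. norm \<mu> \<le> 1 \<Longrightarrow> \<bar>x\<bar> \<le> \<bar>L\<bar> \<Longrightarrow> norm (\<Psi> \<mu> x *v Y1 \<mu> 0 - Y1 \<mu> x) \<le> C1 * norm \<mu> ^ 2"
    by blast

  have "\<exists>C\<ge>0. \<forall>\<mu> x. norm \<mu> \<le> 1 \<longrightarrow> \<bar>x\<bar> \<le> \<bar>L\<bar> \<longrightarrow> norm (\<Psi> \<mu> x *v Y2 0 - Y2 x) \<le> C * norm \<mu> ^ 1"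
    unfolding Y2_def
  proof (rule approximate_spectral_solution[OF \<Psi>, where ?g1.0 = "\<lambda>x. of_real (hq x)" and 
        ?g3.0 = "\<lambda>x. of_real (- ((c * hq x - 1) + (2 * q / \<eta> x - c) * hq x + \<delta> * hq1 x) / (\<delta> * c))"])
    fix \<mu> :: complex and x :: real
    show "((\<lambda>x. of_real (c * hq x - 1)) has_vector_derivative
      - \<mu> * of_real (hq x) + of_real c * of_real (hq1 x) + \<mu> ^ 1 * of_real (hq x)) (at x)"
      by (rule has_vector_derivative_eq_rhs, (rule R DERIV_diff DERIV_const DERIV_cmult hq)+) simp
    show "((\<lambda>x. complex_of_real (hq x)) has_vector_derivative of_real (hq1 x)) (at x)"
      by (rule R hq)+
    show "((\<lambda>x. of_real (hq1 x)) has_vector_derivative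
      ((of_real (pq x) + \<mu>) * of_real (c * hq x - 1) +
         (of_real (p0 x - c * pq x) + \<mu> * of_real (2 * q / \<eta> x - c)) * of_real (hq x) +
         (of_real (p1 x) + of_real \<delta> * \<mu>) * of_real (hq1 x)) / of_real (\<delta> * c) +
        \<mu> ^ 1 * of_real (- ((c * hq x - 1) + (2 * q / \<eta> x - c) * hq x + \<delta> * hq1 x) / (\<delta> * c))) (at x)"
    proof (rule has_vector_derivative_eq_rhs, (rule R hq1)+)
      have "of_real (p1 x * hq1 x + p0 x * hq x - pq x)
        = (of_real (pq x) + \<mu>) * of_real (c * hq x - 1) +
         (of_real (p0 x - c * pq x) + \<mu> * of_real (2 * q / \<eta> x - c)) * of_real (hq x) +
         (of_real (p1 x) + of_real \<delta> * \<mu>) * of_real (hq1 x) +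
        \<mu> ^ 1 * of_real (- ((c * hq x - 1) + (2 * q / \<eta> x - c) * hq x + \<delta> * hq1 x))"
        by (simp add: algebra_simps add_divide_distrib diff_divide_distrib)
      then show "of_real ((p1 x * hq1 x + p0 x * hq x - pq x) / (\<delta> * c))
        = ((of_real (pq x) + \<mu>) * of_real (c * hq x - 1) +
         (of_real (p0 x - c * pq x) + \<mu> * of_real (2 * q / \<eta> x - c)) * of_real (hq x) +
         (of_real (p1 x) + of_real \<delta> * \<mu>) * of_real (hq1 x)) / of_real (\<delta> * c) +
        \<mu> ^ 1 * of_real (- ((c * hq x - 1) + (2 * q / \<eta> x - c) * hq x + \<delta> * hq1 x) / (\<delta> * c))"
        unfolding of_real_divide by (simp only: add_divide_distrib times_divide_eq_right)
    qed
    show "continuous_on UNIV (\<lambda>x. complex_of_real (hq x))"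
      by (intro cc)
    show "continuous_on UNIV (\<lambda>x. complex_of_real (- ((c * hq x - 1) + (2 * q / \<eta> x - c) * hq x + \<delta> * hq1 x) / (\<delta> * c)))"
      by (intro continuous_intros cont) (auto simp: nz eta_neq_0)
  qed
  then obtain C2 where C2: "0 \<le> C2" "\<And>\<mu> x. norm \<mu> \<le> 1 \<Longrightarrow> \<bar>x\<bar> \<le> \<bar>L\<bar> \<Longrightarrow> norm (\<Psi> \<mu> x *v Y2 0 - Y2 x) \<le> C2 * norm \<mu> ^ 1"
    by blast
  have "\<exists>C\<ge>0. \<forall>\<mu> x. norm \<mu> \<le> 1 \<longrightarrow> \<bar>x\<bar> \<le> \<bar>L\<bar> \<longrightarrow> norm (\<Psi> \<mu> x *v Y3 0 - Y3 x) \<le> C * norm \<mu> ^ 1"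
    unfolding Y3_def
  proof (rule approximate_spectral_solution[OF \<Psi>, where ?g1.0 = "\<lambda>x. of_real (f x)" and 
        ?g3.0 = "\<lambda>x. of_real (- (c * f x + (2 * q / \<eta> x - c) * f x + \<delta> * f1 x) / (\<delta> * c))"])
    fix \<mu> :: complex and x :: real
    show "((\<lambda>x. of_real (c * f x)) has_vector_derivative
      - \<mu> * of_real (f x) + of_real c * of_real (f1 x) + \<mu> ^ 1 * of_real (f x)) (at x)"
      by (rule has_vector_derivative_eq_rhs, (rule R DERIV_cmult f)+) simp
    show "((\<lambda>x. complex_of_real (f x)) has_vector_derivative of_real (f1 x)) (at x)"
      by (rule R f)+
    show "((\<lambda>x. of_real (f1 x)) has_vector_derivative
      ((of_real (pq x) + \<mu>) * of_real (c * f x) +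
         (of_real (p0 x - c * pq x) + \<mu> * of_real (2 * q / \<eta> x - c)) * of_real (f x) +
         (of_real (p1 x) + of_real \<delta> * \<mu>) * of_real (f1 x)) / of_real (\<delta> * c) +
        \<mu> ^ 1 * of_real (- (c * f x + (2 * q / \<eta> x - c) * f x + \<delta> * f1 x) / (\<delta> * c))) (at x)"
    proof (rule has_vector_derivative_eq_rhs, (rule R f1)+)
      have "of_real (p1 x * f1 x + p0 x * f x)
        = (of_real (pq x) + \<mu>) * of_real (c * f x) +
         (of_real (p0 x - c * pq x) + \<mu> * of_real (2 * q / \<eta> x - c)) * of_real (f x) +
         (of_real (p1 x) + of_real \<delta> * \<mu>) * of_real (f1 x) +
        \<mu> ^ 1 * of_real (- (c * f x + (2 * q / \<eta> x - c) * f x + \<delta> * f1 x))"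
        by (simp add: algebra_simps add_divide_distrib diff_divide_distrib)
      then show "of_real ((p1 x * f1 x + p0 x * f x) / (\<delta> * c))
        = ((of_real (pq x) + \<mu>) * of_real (c * f x) +
         (of_real (p0 x - c * pq x) + \<mu> * of_real (2 * q / \<eta> x - c)) * of_real (f x) +
         (of_real (p1 x) + of_real \<delta> * \<mu>) * of_real (f1 x)) / of_real (\<delta> * c) +
        \<mu> ^ 1 * of_real (- (c * f x + (2 * q / \<eta> x - c) * f x + \<delta> * f1 x) / (\<delta> * c))"
        unfolding of_real_divide by (simp only: add_divide_distrib times_divide_eq_right)
    qed
    show "continuous_on UNIV (\<lambda>x. complex_of_real (f x))"
      by (intro cc)
    show "continuous_on UNIV (\<lambda>x. complex_of_real (- (c * f x + (2 * q / \<eta> x - c) * f x + \<delta> * f1 x) / (\<delta> * c)))"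
      by (intro continuous_intros cont contf) (auto simp: nz eta_neq_0)
  qed
  then obtain C3 where C3: "0 \<le> C3" "\<And>\<mu> x. norm \<mu> \<le> 1 \<Longrightarrow> \<bar>x\<bar> \<le> \<bar>L\<bar> \<Longrightarrow> norm (\<Psi> \<mu> x *v Y3 0 - Y3 x) \<le> C3 * norm \<mu> ^ 1"
    by blast
  have comp: "norm (u $ i - v $ i) \<le> B" if "norm (u - v) \<le> B" for u v :: "complex ^ 3" and i B
    using Finite_Cartesian_Product.norm_nth_le[of "u - v" i] that by simp
  have c1: "norm ((\<Psi> \<mu> x *v Y1 \<mu> 0) $ i - Y1 \<mu> x $ i) \<le> C1 * norm \<mu> ^ 2"
    and c2: "norm ((\<Psi> \<mu> x *v Y2 0) $ i - Y2 x $ i) \<le> C2 * norm \<mu> ^ 1"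
    and c3: "norm ((\<Psi> \<mu> x *v Y3 0) $ i - Y3 x $ i) \<le> C3 * norm \<mu> ^ 1"
    if "norm \<mu> \<le> 1" "\<bar>x\<bar> \<le> \<bar>L\<bar>" for \<mu> x i
    using C1(2)[OF that] C2(2)[OF that] C3(2)[OF that] by (simp_all only: comp)
  define e where "e = (\<lambda>y :: complex ^ 3. y $ 1 - of_real c * y $ 2)"
  obtain D1 where D1: "0 \<le> D1" "\<And>\<mu>. norm \<mu> \<le> 1 \<Longrightarrow> 
      norm (e (\<Psi> \<mu> L *v Y1 \<mu> 0) - (e (Y1 \<mu> 0) + \<mu> ^ 2 * of_real a)) \<le> D1 * norm \<mu> ^ 3"
  proof -
    have "((\<lambda>x. of_real (\<eta> x) - \<mu> * of_real (Jc x)) has_vector_derivative Y1 \<mu> x $ 2) (at x)" for \<mu> x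
      unfolding Y1_def vector_3
      by (intro has_vector_derivative_diff has_vector_derivative_mult_right R \<eta> Jc)
    from mass_increment[where ?Y0.0 = "\<lambda>\<mu>. Y1 \<mu> 0", OF \<Psi> this C1(1) c1]
    obtain D1 where "0 \<le> D1" "\<And>\<mu>. norm \<mu> \<le> 1 \<Longrightarrow> norm (e (\<Psi> \<mu> L *v Y1 \<mu> 0) - (e (Y1 \<mu> 0)
      - \<mu> * ((of_real (\<eta> L) - \<mu> * of_real (Jc L)) - (of_real (\<eta> 0) - \<mu> * of_real (Jc 0))))) \<le> D1 * norm \<mu> ^ Suc 2"
      unfolding e_def by blast
    with that show ?thesis using periodic[of 0] by (simp add: a_def algebra_simps power2_eq_square)
  qed
  obtain D2 where D2: "0 \<le> D2" "\<And>\<mu>. norm \<mu> \<le> 1 \<Longrightarrow> 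
      norm (e (\<Psi> \<mu> L *v Y2 0) - (e (Y2 0) - \<mu> * of_real b)) \<le> D2 * norm \<mu> ^ 2"
  proof -
    have "((\<lambda>x. of_real (Jq x)) has_vector_derivative Y2 x $ 2) (at x)" for x
      unfolding Y2_def vector_3 by (intro R Jq)
    from mass_increment[where ?Y0.0 = "\<lambda>\<mu>. Y2 0", OF \<Psi> this C2(1) c2]
    obtain D2 where "0 \<le> D2" "\<And>\<mu>. norm \<mu> \<le> 1 \<Longrightarrow> norm (e (\<Psi> \<mu> L *v Y2 0) - (e (Y2 0)
      - \<mu> * (of_real (Jq L) - of_real (Jq 0)))) \<le> D2 * norm \<mu> ^ Suc 1"
      unfolding e_def by blast
    with that show ?thesis by (simp add: b_def numeral_2_eq_2)
  qed
\<comment> \<open>For \<open>Y3\<close> boundedness of \<open>h\<close> suffices, with \<open>K = 0\<close>: the mass vanishes initially.\<close>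
  obtain D3 where D3: "0 \<le> D3" "\<And>\<mu>. norm \<mu> \<le> 1 \<Longrightarrow> norm (e (\<Psi> \<mu> L *v Y3 0)) \<le> D3 * norm \<mu> ^ 1"
  proof -
    obtain B where B: "0 \<le> B" "\<And>x. \<bar>x\<bar> \<le> \<bar>L\<bar> \<Longrightarrow> \<bar>f x\<bar> \<le> B"
      using continuous_on_bounded_symmetric_interval[OF contf(1)] by auto
    have bd: "norm ((\<Psi> \<mu> x *v Y3 0) $ 2 - 0) \<le> (C3 + B) * norm \<mu> ^ 0" if "norm \<mu> \<le> 1" "\<bar>x\<bar> \<le> \<bar>L\<bar>" for \<mu> x
    proof -
      have "norm ((\<Psi> \<mu> x *v Y3 0) $ 2 - Y3 x $ 2) \<le> C3 * norm \<mu>"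
        using c3[OF that, of 2] by simp
      also have "\<dots> \<le> C3" using C3(1) that(1) by (simp add: mult_left_le)
      finally have "norm ((\<Psi> \<mu> x *v Y3 0) $ 2 - Y3 x $ 2) \<le> C3" .
      moreover have "norm (Y3 x $ 2) \<le> B" using B(2)[OF that(2)] by (simp add: Y3_def)
      ultimately show ?thesis
        using norm_triangle_sub[of "(\<Psi> \<mu> x *v Y3 0) $ 2" "Y3 x $ 2"] by simp
    qed
    have "((\<lambda>x. 0) has_vector_derivative (0 :: complex)) (at x)" for x :: real by (rule has_vector_derivative_const)
    from mass_increment[where ?Y0.0 = "\<lambda>\<mu>. Y3 0", OF \<Psi> this _ bd] B(1) C3(1)
    obtain D3 where "0 \<le> D3" "\<And>\<mu>. norm \<mu> \<le> 1 \<Longrightarrow> norm (e (\<Psi> \<mu> L *v Y3 0) - (e (Y3 0) - \<mu> * (0 - 0))) \<le> D3 * norm \<mu> ^ Suc 0"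
      unfolding e_def by (meson add_nonneg_nonneg)
    moreover have "e (Y3 0) = 0" by (simp add: e_def Y3_def)
    ultimately show ?thesis using that by simp
  qed
  have at_L: "\<eta>1 L = \<eta>1 0" "\<eta>2 L = \<eta>2 0" "hc L = hc 0 - Lc * \<eta>1 0" "hc1 L = hc1 0 - Lc * \<eta>2 0"
    "hq L = hq 0 - Lq * \<eta>1 0" "hq1 L = hq1 0 - Lq * \<eta>2 0"
    using eta_derivs_periodic[of 0] hc_shift[of 0] hc1_shift[of 0] hq_shift[of 0] hq1_shift[of 0]
    by simp_all
  note O = vanishes_to_order_const vanishes_to_order_fst vanishes_to_order_snd
  note M = vanishes_to_order_mult and A = vanishes_to_order_add and S = vanishes_to_order_diff
  have mc: "vanishes_to_order n (\<lambda>p. x * g p)" if "vanishes_to_order n g" for n g x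
    using M[OF O(1) that] by simp
\<comment> \<open>Each entry equals its leading term, plus an error of \<open>Yj\<close>, plus terms containing \<open>e\<^sup>\<nu> - 1 - \<nu>\<close>
    or \<open>e\<^sup>\<nu> - 1\<close>.\<close>
  define T where "T = (\<lambda>p :: complex \<times> complex. exp (snd p) - 1 - snd p)"
  define s where "s = (\<lambda>p :: complex \<times> complex. exp (snd p) - 1)"
  have T: "vanishes_to_order 2 T" unfolding T_def by (rule vanishes_to_order_exp)
  have s: "vanishes_to_order 1 s"
    using A[OF vanishes_to_order_mono[OF T, of 1] vanishes_to_order_snd] by (simp add: s_def T_def)
  have fs: "vanishes_to_order 2 (\<lambda>p. fst p * (x * s p))" for x
    using M[OF O(2) mc[OF s]] by (simp add: numeral_2_eq_2)
  have fT: "vanishes_to_order 3 (\<lambda>p. fst p * (x * T p))" for x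
    using M[OF O(2) mc[OF T]] by (simp add: eval_nat_numeral)
  define X where "X = (\<lambda>p. \<Psi> (fst p) L - mat (exp (snd p)))"
  have X: "(X p *v y) $ i = (\<Psi> (fst p) L *v y) $ i - exp (snd p) * y $ i" for p y i
    unfolding X_def by (rule diff_mat_mult_vec)
  have eX: "e (X p *v y) = e (\<Psi> (fst p) L *v y) - exp (snd p) * e y" for p y
    unfolding e_def X by (simp add: algebra_simps)
  define N where "N = (\<lambda>p. det (X p) * det (transpose (vector [Y1 (fst p) 0, Y2 0, Y3 0]) :: complex ^ 3 ^ 3))"
  define Dd where "Dd = (\<lambda>p :: complex \<times> complex. fst p ^ 2 * of_real (Lc * b - Lq * a)
      - fst p * snd p * of_real (Lc + b + \<eta> 0 * Lq) + snd p ^ 2)"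
  have "vanishes_to_order 3 (\<lambda>p. N p - of_real \<omega> * Dd p)"
  proof -
    have "vanishes_to_order 3 (\<lambda>p. e (X p *v Y1 (fst p) 0)
        * ((X p *v Y2 0) $ 2 * (X p *v Y3 0) $ 3 - (X p *v Y2 0) $ 3 * (X p *v Y3 0) $ 2)
      - e (X p *v Y2 0)
        * ((X p *v Y1 (fst p) 0) $ 2 * (X p *v Y3 0) $ 3 - (X p *v Y1 (fst p) 0) $ 3 * (X p *v Y3 0) $ 2)
      + e (X p *v Y3 0)
        * ((X p *v Y1 (fst p) 0) $ 2 * (X p *v Y2 0) $ 3 - (X p *v Y1 (fst p) 0) $ 3 * (X p *v Y2 0) $ 2)
      - (of_real (\<eta>1 0) * of_real w2 - of_real (\<eta>2 0) * of_real w1)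
        * (- of_real Lq * (fst p ^ 2 * of_real a + fst p * snd p * of_real (\<eta> 0))
           - (snd p - fst p * of_real b) * (fst p * of_real Lc - snd p)))"
    proof (rule vanishes_to_order_det)
      have "(\<lambda>p. e (X p *v Y1 (fst p) 0) - (fst p ^ 2 * of_real a + fst p * snd p * of_real (\<eta> 0)))
        = (\<lambda>p. (e (\<Psi> (fst p) L *v Y1 (fst p) 0) - (e (Y1 (fst p) 0) + fst p ^ 2 * of_real a))
           + fst p * (of_real (\<eta> 0) * T p))"
        unfolding eX by (rule ext) (simp add: e_def Y1_def T_def algebra_simps)
      then show "vanishes_to_order 3 (\<lambda>p. e (X p *v Y1 (fst p) 0)
          - (fst p ^ 2 * of_real a + fst p * snd p * of_real (\<eta> 0)))"
        using A[OF vanishes_to_order_fstI[OF D1(2,1)] fT] by simp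
      have "(\<lambda>p. (X p *v Y1 (fst p) 0) $ 2 - (fst p * of_real Lc - snd p) * of_real (\<eta>1 0))
        = (\<lambda>p. (\<Psi> (fst p) L *v Y1 (fst p) 0) $ 2 - Y1 (fst p) L $ 2
           - of_real (\<eta>1 0) * T p + fst p * (of_real (hc 0) * s p))"
        unfolding X by (intro ext) (simp add: at_L Y1_def T_def s_def algebra_simps)
      then show "vanishes_to_order 2 (\<lambda>p. (X p *v Y1 (fst p) 0) $ 2 - (fst p * of_real Lc - snd p) * of_real (\<eta>1 0))"
        using A[OF S[OF vanishes_to_order_fstI[OF c1[OF _ order_refl] C1(1)] mc[OF T]] fs] by simp
      have "(\<lambda>p. (X p *v Y1 (fst p) 0) $ 3 - (fst p * of_real Lc - snd p) * of_real (\<eta>2 0))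
        = (\<lambda>p. (\<Psi> (fst p) L *v Y1 (fst p) 0) $ 3 - Y1 (fst p) L $ 3
           - of_real (\<eta>2 0) * T p + fst p * (of_real (hc1 0) * s p))"
        unfolding X by (intro ext) (simp add: at_L Y1_def T_def s_def algebra_simps)
      then show "vanishes_to_order 2 (\<lambda>p. (X p *v Y1 (fst p) 0) $ 3 - (fst p * of_real Lc - snd p) * of_real (\<eta>2 0))"
        using A[OF S[OF vanishes_to_order_fstI[OF c1[OF _ order_refl] C1(1)] mc[OF T]] fs] by simp
      have "(\<lambda>p. e (X p *v Y2 0) - (snd p - fst p * of_real b))
        = (\<lambda>p. (e (\<Psi> (fst p) L *v Y2 0) - (e (Y2 0) - fst p * of_real b)) + T p)"
        unfolding eX by (rule ext) (simp add: e_def Y2_def T_def algebra_simps)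
      then show "vanishes_to_order 2 (\<lambda>p. e (X p *v Y2 0) - (snd p - fst p * of_real b))"
        using A[OF vanishes_to_order_fstI[OF D2(2,1)] T] by simp
      have "(\<lambda>p. (X p *v Y2 0) $ 2 - (- of_real Lq * of_real (\<eta>1 0)))
        = (\<lambda>p. (\<Psi> (fst p) L *v Y2 0) $ 2 - Y2 L $ 2 - of_real (hq 0) * s p)"
        unfolding X by (intro ext) (simp add: at_L Y2_def s_def algebra_simps)
      then show "vanishes_to_order 1 (\<lambda>p. (X p *v Y2 0) $ 2 - (- of_real Lq * of_real (\<eta>1 0)))"
        using S[OF vanishes_to_order_fstI[OF c2[OF _ order_refl] C2(1)] mc[OF s]] by simp
      have "(\<lambda>p. (X p *v Y2 0) $ 3 - (- of_real Lq * of_real (\<eta>2 0)))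
        = (\<lambda>p. (\<Psi> (fst p) L *v Y2 0) $ 3 - Y2 L $ 3 - of_real (hq1 0) * s p)"
        unfolding X by (intro ext) (simp add: at_L Y2_def s_def algebra_simps)
      then show "vanishes_to_order 1 (\<lambda>p. (X p *v Y2 0) $ 3 - (- of_real Lq * of_real (\<eta>2 0)))"
        using S[OF vanishes_to_order_fstI[OF c2[OF _ order_refl] C2(1)] mc[OF s]] by simp
      have "(\<lambda>p. e (X p *v Y3 0)) = (\<lambda>p. e (\<Psi> (fst p) L *v Y3 0))"
        unfolding eX by (rule ext) (simp add: e_def Y3_def)
      then show "vanishes_to_order 1 (\<lambda>p. e (X p *v Y3 0))"
        using vanishes_to_order_fstI[OF D3(2,1)] by simp
      have "(\<lambda>p. (X p *v Y3 0) $ 2 - of_real w1)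
        = (\<lambda>p. (\<Psi> (fst p) L *v Y3 0) $ 2 - Y3 L $ 2 - of_real (f 0) * s p)"
        unfolding X by (intro ext) (simp add: Y3_def s_def w1_def algebra_simps)
      then show "vanishes_to_order 1 (\<lambda>p. (X p *v Y3 0) $ 2 - of_real w1)"
        using S[OF vanishes_to_order_fstI[OF c3[OF _ order_refl] C3(1)] mc[OF s]] by simp
      have "(\<lambda>p. (X p *v Y3 0) $ 3 - of_real w2)
        = (\<lambda>p. (\<Psi> (fst p) L *v Y3 0) $ 3 - Y3 L $ 3 - of_real (f1 0) * s p)"
        unfolding X by (intro ext) (simp add: Y3_def s_def w2_def algebra_simps)
      then show "vanishes_to_order 1 (\<lambda>p. (X p *v Y3 0) $ 3 - of_real w2)"
        using S[OF vanishes_to_order_fstI[OF c3[OF _ order_refl] C3(1)] mc[OF s]] by simp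
    qed
    moreover have "- of_real Lq * (fst p ^ 2 * of_real a + fst p * snd p * of_real (\<eta> 0))
           - (snd p - fst p * of_real b) * (fst p * of_real Lc - snd p) = Dd p" for p
      by (simp add: Dd_def algebra_simps power2_eq_square)
    ultimately show ?thesis
      unfolding N_def det_columns_row_op[where c = "of_real c"] Let_def e_def \<omega>_def
      by simp
  qed
  note N = this
  define n where "n = (\<eta>1 0)\<^sup>2 + (\<eta>2 0)\<^sup>2"
  have "n \<noteq> 0" unfolding n_def by (rule eta_derivs_at_0_nonzero)
  define \<beta> where "\<beta> = complex_of_real (\<eta> 0 * (hq1 0 * f 0 - hq 0 * f1 0) + (hc1 0 * f 0 - hc 0 * f1 0) :: real)"
  have det: "det (transpose (vector [Y1 \<mu> 0, Y2 0, Y3 0]) :: complex ^ 3 ^ 3) = of_real n + \<mu> * \<beta>" for \<mu>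
    unfolding det_3 transpose_def by (simp add: Y1_def Y2_def Y3_def f0 n_def \<beta>_def algebra_simps power2_eq_square)
  have "vanishes_to_order 3 (\<lambda>p. (det (X p) - of_real (\<omega> / n) * Dd p) * (of_real n + fst p * \<beta>))"
  proof -
    have ff: "vanishes_to_order 2 (\<lambda>p. fst p ^ 2 * x)" and fs: "vanishes_to_order 2 (\<lambda>p. fst p * snd p * x)"
      and ss: "vanishes_to_order 2 (\<lambda>p. snd p ^ 2)" for x
      using M[OF M[OF O(2) O(2)] O(1)] M[OF M[OF O(2) O(3)] O(1)] M[OF O(3) O(3)]
      by (simp_all add: power2_eq_square numeral_2_eq_2)
    have Dd: "vanishes_to_order 2 Dd" unfolding Dd_def by (intro A S ff fs ss)
    have "vanishes_to_order 3 (\<lambda>p. of_real (\<omega> / n) * \<beta> * (Dd p * fst p))"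
      using mc[OF M[OF Dd O(2)], where x = "of_real (\<omega> / n) * \<beta>"] by simp
    moreover have "(\<lambda>p. (det (X p) - of_real (\<omega> / n) * Dd p) * (of_real n + fst p * \<beta>))
      = (\<lambda>p. (N p - of_real \<omega> * Dd p) - of_real (\<omega> / n) * \<beta> * (Dd p * fst p))"
      unfolding N_def det using \<open>n \<noteq> 0\<close> by (intro ext) (simp add: field_simps)
    ultimately show ?thesis using S[OF N] by simp
  qed
  then have "vanishes_to_order 3 (\<lambda>p. det (X p) - of_real (\<omega> / n) * Dd p)"
  proof (rule vanishes_to_order_cancel)
    have "((\<lambda>p. fst p) \<longlongrightarrow> fst (0 :: complex, 0 :: complex)) (at (0, 0) within UNIV \<times> {\<nu>. Re \<nu> = 0})"
      by (intro tendsto_fst tendsto_ident_at)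
    from tendsto_add[OF tendsto_const tendsto_mult_right[OF this]]
    show "((\<lambda>p. of_real n + fst p * \<beta>) \<longlongrightarrow> of_real n)
      (at (0, 0) within UNIV \<times> {\<nu> :: complex. Re \<nu> = 0})" by fastforce
  qed (use \<open>n \<noteq> 0\<close> in simp)
  then show ?thesis
    using \<open>\<omega> \<noteq> 0\<close> \<open>n \<noteq> 0\<close> unfolding X_def Dd_def evans_def
    by (intro exI[of _ "of_real (\<omega> / n)"]) simp
qed

end

section \<open>Smooth families of periodic functions\<close>

lemma smooth_onD:
  assumes "smooth_on S f"
  shows "continuous_on S f" "x \<in> S \<Longrightarrow> f differentiable (at x)"
    "smooth_on S (\<lambda>x. frechet_derivative f (at x) v)"
proof -
  show "continuous_on S f" using assms unfolding smooth_on_def by (metis Ck_on.simps(1))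
  show "f differentiable (at x)" if "x \<in> S"
    using assms that unfolding smooth_on_def by (metis Ck_on.simps(2))
  show "smooth_on S (\<lambda>x. frechet_derivative f (at x) v)"
    using assms unfolding smooth_on_def by (metis Ck_on.simps(2))
qed

lemma smooth_on_subset:
  assumes "smooth_on S f" "T \<subseteq> S"
  shows "smooth_on T f"
proof -
  have "Ck_on n S f \<Longrightarrow> Ck_on n T f" for n and f :: "'a \<Rightarrow> 'b"
    using assms(2) by (induction n arbitrary: f) (auto intro: continuous_on_subset)
  then show ?thesis using assms(1) unfolding smooth_on_def by blast
qed

lemma DERIV_frechet_chain:
  fixes g :: "'a::real_normed_vector \<Rightarrow> real"
  assumes "g differentiable (at (\<gamma> t))" "(\<gamma> has_vector_derivative w) (at t)"
  shows "((\<lambda>s. g (\<gamma> s)) has_real_derivative frechet_derivative g (at (\<gamma> t)) w) (at t)"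
proof -
  have g: "(g has_derivative frechet_derivative g (at (\<gamma> t))) (at (\<gamma> t))"
    using assms(1) by (simp add: frechet_derivative_works)
  from diff_chain_at[OF assms(2)[unfolded has_vector_derivative_def] g]
  have "((\<lambda>s. g (\<gamma> s)) has_derivative (\<lambda>x. frechet_derivative g (at (\<gamma> t)) (x *\<^sub>R w))) (at t)"
    by (simp add: o_def)
  moreover have "frechet_derivative g (at (\<gamma> t)) (x *\<^sub>R w) = frechet_derivative g (at (\<gamma> t)) w * x" for x
    using linear_cmul[OF linear_frechet_derivative[OF assms(1)]] by (simp add: mult.commute)
  ultimately show ?thesis by (simp add: has_field_derivative_def)
qed

lemma line_in_open:
  fixes a v :: "'a::real_normed_vector"
  assumes "open W" "a \<in> W"
  shows "\<exists>r>0. \<forall>t. \<bar>t\<bar> \<le> r \<longrightarrow> a + t *\<^sub>R v \<in> W"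
proof -
  obtain d where d: "d > 0" "ball a d \<subseteq> W" using assms openE by blast
  have "a + t *\<^sub>R v \<in> W" if "\<bar>t\<bar> \<le> d / 2 / (1 + norm v)" for t
  proof -
    have "norm (t *\<^sub>R v) \<le> \<bar>t\<bar> * (1 + norm v)" by (simp add: algebra_simps)
    also have "\<dots> \<le> d / 2" 
      using that add_pos_nonneg[OF zero_less_one norm_ge_zero[of v]] by (simp add: pos_le_divide_eq algebra_simps)
    also have "\<dots> < d" using d by simp
    finally show ?thesis using d(2) by (auto simp: dist_norm mem_ball)
  qed
  moreover have "d / 2 / (1 + norm v) > 0" using d add_pos_nonneg[OF zero_less_one norm_ge_zero[of v]] by simp
  ultimately show ?thesis by blast
qed

lemma line_derivative: "((\<lambda>t. (a + t *\<^sub>R v, x)) has_vector_derivative (v, 0)) (at t)"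
  by (auto intro!: derivative_eq_intros has_vector_derivative_Pair)

text \<open>Symmetry of mixed second derivatives, by differentiating \<open>h t x = h t a + \<integral> hx t\<close> under the
  integral sign.\<close>
lemma mixed_partials:
  fixes h hx hxt :: "real \<Rightarrow> real \<Rightarrow> real"
  assumes "r > 0"
    and hx: "\<And>t x. \<bar>t\<bar> \<le> r \<Longrightarrow> (h t has_real_derivative hx t x) (at x)"
    and hxt: "\<And>t x. \<bar>t\<bar> \<le> r \<Longrightarrow> ((\<lambda>s. hx s x) has_real_derivative hxt t x) (at t)"
    and cx: "\<And>t. \<bar>t\<bar> \<le> r \<Longrightarrow> continuous_on UNIV (hx t)"
    and cont: "continuous_on ({- r..r} \<times> UNIV) (\<lambda>(t, x). hxt t x)"
    and ht: "\<And>x. ((\<lambda>s. h s x) has_real_derivative ht x) (at 0)"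
  shows "(ht has_real_derivative hxt 0 x0) (at x0)"
proof -
  define a b where "a = x0 - 1" and "b = x0 + 1"
  have int: "((\<lambda>t. integral {a..x} (hx t)) has_real_derivative integral {a..x} (hxt 0)) (at 0)"
    if "a \<le> x" "x \<le> b" for x
  proof -
    have "((\<lambda>t. integral (cbox a x) (hx t)) has_real_derivative integral (cbox a x) (hxt 0))
        (at 0 within {-r..r})"
    proof (rule leibniz_rule_field_derivative)
      show "((\<lambda>t. hx t y) has_real_derivative hxt t y) (at t within {- r..r})"
        if "t \<in> {- r..r}" for t y
        using hxt[of t y] that by (auto intro: has_field_derivative_at_within)
      show "hx t integrable_on cbox a x" if "t \<in> {- r..r}" for t
        using that by (intro integrable_continuous continuous_on_subset[OF cx[of t]]) auto
      show "continuous_on ({- r..r} \<times> cbox a x) (\<lambda>(t, x). hxt t x)"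
        using cont by (rule continuous_on_subset) auto
    qed (use \<open>r > 0\<close> in auto)
    moreover have "at 0 within {- r..r} = at (0::real)"
      using \<open>r > 0\<close> by (intro at_within_interior) auto
    ultimately show ?thesis by simp
  qed
  have eq: "ht x = ht a + integral {a..x} (hxt 0)" if "a \<le> x" "x \<le> b" for x
  proof -
    have "((\<lambda>t. h t a + integral {a..x} (hx t)) has_real_derivative
        ht a + integral {a..x} (hxt 0)) (at 0)"
      by (intro derivative_intros ht int that)
    moreover have "\<forall>\<^sub>F t in nhds 0. h t a + integral {a..x} (hx t) = h t x"
    proof -
      have "\<forall>\<^sub>F t in nhds (0::real). t \<in> {-r<..<r}"
        using \<open>r > 0\<close> by (intro eventually_nhds_in_open) auto
      then show ?thesis
      proof (rule eventually_mono)
        fix t assume "t \<in> {-r<..<r}"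
        then have t: "\<bar>t\<bar> \<le> r" by auto
        have "(hx t has_integral (h t x - h t a)) {a..x}"
          by (rule fundamental_theorem_of_calculus[OF that(1)])
            (auto simp: has_real_derivative_iff_has_vector_derivative[symmetric]
              intro: has_field_derivative_at_within hx t)
        then show "h t a + integral {a..x} (hx t) = h t x" by (simp add: integral_unique)
      qed
    qed
    ultimately have "((\<lambda>t. h t x) has_real_derivative ht a + integral {a..x} (hxt 0)) (at 0)"
      by (subst (asm) DERIV_cong_ev[OF refl _ refl]) auto
    then show ?thesis using ht[of x] DERIV_unique by blast
  qed
  have "continuous_on {a..b} (\<lambda>x. (\<lambda>(t, x). hxt t x) (0, x))"
    by (rule continuous_on_compose2[OF cont]) (use \<open>r > 0\<close> in \<open>auto intro!: continuous_intros\<close>)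
  then have "((\<lambda>x. integral {a..x} (hxt 0)) has_real_derivative hxt 0 x0) (at x0 within {a..b})"
    by (intro integral_has_real_derivative) (auto simp: a_def b_def)
  then have "((\<lambda>x. ht a + integral {a..x} (hxt 0)) has_real_derivative hxt 0 x0) (at x0 within {a..b})"
    by (auto intro!: derivative_eq_intros)
  then have "(ht has_real_derivative hxt 0 x0) (at x0 within {a..b})"
  proof (rule has_field_derivative_transform_within[OF _ zero_less_one])
    show "x0 \<in> {a..b}" by (simp add: a_def b_def)
    show "ht a + integral {a..x} (hxt 0) = ht x" if "x \<in> {a..b}" for x
      using eq[of x] that by simp
  qed
  moreover have "at x0 within {a..b} = at x0"
    by (intro at_within_interior) (auto simp: a_def b_def)
  ultimately show ?thesis by simp
qed

lemma smooth_mixed_partials: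
  fixes f :: "'a::real_normed_vector \<times> real \<Rightarrow> real"
  assumes "open W" "a \<in> W" and f: "smooth_on (W \<times> UNIV) f"
  defines "fx \<equiv> \<lambda>p. frechet_derivative f (at p) (0, 1)"
  shows "((\<lambda>x. frechet_derivative f (at (a, x)) (v, 0)) has_real_derivative
      frechet_derivative fx (at (a, x)) (v, 0)) (at x)"
proof -
  have fx: "smooth_on (W \<times> UNIV) fx" unfolding fx_def by (rule smooth_onD(3)[OF f])
  obtain r where r: "r > 0" "\<And>t. \<bar>t\<bar> \<le> r \<Longrightarrow> a + t *\<^sub>R v \<in> W"
    using line_in_open[OF assms(1,2)] by blast
  let ?fxt = "\<lambda>p. frechet_derivative fx (at p) (v, 0)"
  have "((\<lambda>x. frechet_derivative f (at (a, x)) (v, 0)) has_real_derivative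
      (\<lambda>t x. ?fxt (a + t *\<^sub>R v, x)) 0 x) (at x)"
  proof (rule mixed_partials[where h = "\<lambda>t x. f (a + t *\<^sub>R v, x)" and hx = "\<lambda>t x. fx (a + t *\<^sub>R v, x)"
        and ht = "\<lambda>x. frechet_derivative f (at (a, x)) (v, 0)" and hxt = "\<lambda>t x. ?fxt (a + t *\<^sub>R v, x)", OF r(1)])
    fix t x :: real assume t: "\<bar>t\<bar> \<le> r"
    have in_W: "(a + t *\<^sub>R v, x) \<in> W \<times> UNIV" for x using r(2)[OF t] by simp
    have "((\<lambda>x. (a + t *\<^sub>R v, x)) has_vector_derivative (0, 1)) (at x)"
      by (auto intro!: derivative_eq_intros has_vector_derivative_Pair)
    from DERIV_frechet_chain[OF smooth_onD(2)[OF f in_W] this]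
    show "((\<lambda>x. f (a + t *\<^sub>R v, x)) has_real_derivative fx (a + t *\<^sub>R v, x)) (at x)"
      by (simp add: fx_def)
    show "((\<lambda>s. fx (a + s *\<^sub>R v, x)) has_real_derivative ?fxt (a + t *\<^sub>R v, x)) (at t)"
      by (rule DERIV_frechet_chain[OF smooth_onD(2)[OF fx in_W] line_derivative])
    show "continuous_on UNIV (\<lambda>x. fx (a + t *\<^sub>R v, x))"
      by (rule continuous_on_compose2[OF smooth_onD(1)[OF fx]]) (use in_W in \<open>auto intro!: continuous_intros\<close>)
  next
    have "continuous_on ({- r..r} \<times> UNIV) (\<lambda>p. ?fxt ((\<lambda>p. (a + fst p *\<^sub>R v, snd p)) p))"
      by (rule continuous_on_compose2[OF smooth_onD(1)[OF smooth_onD(3)[OF fx]]])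
        (use r(2) in \<open>auto intro!: continuous_intros simp: abs_le_iff\<close>)
    then show "continuous_on ({- r..r} \<times> UNIV) (\<lambda>(t, x). ?fxt (a + t *\<^sub>R v, x))"
      by (simp add: case_prod_unfold)
  next
    fix x :: real
    have "(a + 0 *\<^sub>R v, x) \<in> W \<times> UNIV" using assms by simp
    from DERIV_frechet_chain[OF smooth_onD(2)[OF f this] line_derivative]
    show "((\<lambda>s. f (a + s *\<^sub>R v, x)) has_real_derivative frechet_derivative f (at (a, x)) (v, 0)) (at 0)"
      by simp
  qed
  then show ?thesis by simp
qed

text \<open>Differentiate \<open>g (b, x + l b) = g (b, x)\<close> with respect to the parameter \<open>b\<close>.\<close>
lemma periodic_family_variation:
  fixes g :: "'a::real_normed_vector \<times> real \<Rightarrow> real"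
  assumes "open W" "a \<in> W" and per: "\<And>b x. b \<in> W \<Longrightarrow> g (b, x + l b) = g (b, x)"
    and g: "\<And>x. g differentiable (at (a, x))" and l: "l differentiable (at a)"
  shows "frechet_derivative g (at (a, x + l a)) (v, 0) =
    frechet_derivative g (at (a, x)) (v, 0)
    - frechet_derivative l (at a) v * frechet_derivative g (at (a, x + l a)) (0, 1)"
proof -
  let ?G = "frechet_derivative g (at (a, x + l a))"
  let ?l = "frechet_derivative l (at a) v"
  obtain r where r: "r > 0" "\<And>t. \<bar>t\<bar> \<le> r \<Longrightarrow> a + t *\<^sub>R v \<in> W"
    using line_in_open[OF assms(1,2)] by blast
  have "((\<lambda>t. l (a + t *\<^sub>R v)) has_real_derivative frechet_derivative l (at (a + 0 *\<^sub>R v)) v) (at 0)"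
    by (rule DERIV_frechet_chain) (use l in \<open>auto intro!: derivative_eq_intros\<close>)
  then have dl: "((\<lambda>t. l (a + t *\<^sub>R v)) has_real_derivative ?l) (at 0)" by simp
  have "((\<lambda>t. (a + t *\<^sub>R v, x + l (a + t *\<^sub>R v))) has_vector_derivative (v, ?l)) (at 0)"
    by (intro has_vector_derivative_Pair)
      (use dl in \<open>auto intro!: derivative_eq_intros simp: has_real_derivative_iff_has_vector_derivative\<close>)
  from DERIV_frechet_chain[OF _ this, of g] g
  have "((\<lambda>t. g (a + t *\<^sub>R v, x + l (a + t *\<^sub>R v))) has_real_derivative ?G (v, ?l)) (at 0)" by simp
  then have "((\<lambda>t. g (a + t *\<^sub>R v, x)) has_real_derivative ?G (v, ?l)) (at 0)"
    by (rule has_field_derivative_transform_within[OF _ r(1)]) (auto simp: per r(2))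
  moreover have "((\<lambda>t. g (a + t *\<^sub>R v, x)) has_real_derivative frechet_derivative g (at (a, x)) (v, 0)) (at 0)"
    using DERIV_frechet_chain[OF _ line_derivative[of a v x 0], of g] g by simp
  ultimately have "?G (v, ?l) = frechet_derivative g (at (a, x)) (v, 0)" by (rule DERIV_unique)
  moreover have "?G (v, ?l) = ?G (v, 0) + ?l * ?G (0, 1)"
  proof -
    note lin = linear_frechet_derivative[OF g]
    have "?G (v, ?l) = ?G ((v, 0) + ?l *\<^sub>R (0, 1))" by simp
    also have "\<dots> = ?G (v, 0) + ?l * ?G (0, 1)"
      unfolding linear_add[OF lin] linear_cmul[OF lin] by simp
    finally show ?thesis .
  qed
  ultimately show ?thesis by simp
qed

section \<open>From the scaled to the unscaled variable\<close>

lemma DERIV_affine: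
  fixes g :: "real \<Rightarrow> real"
  assumes "\<And>x. (g has_real_derivative g' x) (at x)"
  shows "((\<lambda>y. g (L * (y - s))) has_real_derivative L * g' (L * (y - s))) (at y)"
proof -
  have "((\<lambda>y. L * (y - s)) has_real_derivative L) (at y)"
    by (auto intro!: derivative_eq_intros)
  from DERIV_chain2[OF assms this] show ?thesis by (simp add: mult.commute)
qed

lemma deriv_affine:
  fixes g :: "real \<Rightarrow> real"
  assumes "\<And>x. (g has_real_derivative g' x) (at x)"
  shows "deriv (\<lambda>y. g (L * (y - s))) = (\<lambda>y. L * g' (L * (y - s)))"
  by (rule ext, rule DERIV_imp_deriv, rule DERIV_affine, rule assms)

lemma DERIV_flux_profile:
  assumes "F \<noteq> 0" "\<And>x. \<eta> x > 0" "\<And>x. (\<eta> has_real_derivative \<eta>1 x) (at x)"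
  shows "((\<lambda>x. flux F (\<eta> x) (c * \<eta> x - q)) has_real_derivative
    (lin1 F q (\<eta> x) + c\<^sup>2) * \<eta>1 x) (at x)"
proof -
  have nz: "\<eta> x \<noteq> 0" for x using assms(2)[of x] by simp
  have "(\<lambda>x. flux F (\<eta> x) (c * \<eta> x - q)) = (\<lambda>x. c\<^sup>2 * \<eta> x - 2 * c * q + q\<^sup>2 / \<eta> x + (\<eta> x)\<^sup>2 / (2 * F\<^sup>2))"
    unfolding flux_def using nz by (intro ext) (simp add: field_simps power2_eq_square)
  then show ?thesis using assms nz[of x]
    by (auto intro!: derivative_eq_intros simp: lin1_def field_simps power2_eq_square)
qed

text \<open>The sign of \<open>L\<close> is arbitrary, since the wave number may be negative; the change of variable is
  \<open>x = L y\<close>.\<close>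
lemma profile_solution_unscaled:
  assumes nz: "F \<noteq> 0" "\<delta> \<noteq> 0" "c \<noteq> 0" "L \<noteq> 0"
    and P: "profile_solution \<delta> F (1 / L) q c (\<lambda>y. \<eta> (L * y))"
    and \<eta>: "\<And>x. (\<eta> has_real_derivative \<eta>1 x) (at x)"
    and \<eta>1: "\<And>x. (\<eta>1 has_real_derivative \<eta>2 x) (at x)"
  shows "\<eta> x > 0" "\<eta> (x + L) = \<eta> x"
    "\<eta>2 x = (lin1 F q (\<eta> x) * \<eta>1 x - (\<eta> x - (c - q / \<eta> x)\<^sup>2)) / (\<delta> * c)"
proof -
  have "\<eta> (L * (x / L)) > 0" for x using P unfolding profile_solution_def by blast
  then show pos: "\<eta> x > 0" for x using \<open>L \<noteq> 0\<close> by simp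
  have "\<eta> (L * (x / L + 1)) = \<eta> (L * (x / L))" using P unfolding profile_solution_def by blast
  then show "\<eta> (x + L) = \<eta> x" using \<open>L \<noteq> 0\<close> by (simp add: distrib_left)
  have "\<eta> x \<noteq> 0" using pos[of x] by simp
  have 1: "deriv (\<lambda>y. \<eta> (L * y)) = (\<lambda>y. L * \<eta>1 (L * y))"
    using deriv_affine[OF \<eta>, of L 0] by simp
  have "((\<lambda>x. c * \<eta> x - q) has_real_derivative c * \<eta>1 x) (at x)" for x
    by (auto intro!: derivative_eq_intros \<eta>)
  from deriv_affine[OF this, of L 0]
  have d: "deriv (\<lambda>y. c * \<eta> (L * y) - q) = (\<lambda>y. L * (c * \<eta>1 (L * y)))" by simp
  have "((\<lambda>x. L * (c * \<eta>1 x)) has_real_derivative L * (c * \<eta>2 x)) (at x)" for x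
    by (auto intro!: derivative_eq_intros \<eta>1)
  from deriv_affine[OF this, of L 0]
  have dd: "deriv (\<lambda>y. L * (c * \<eta>1 (L * y))) = (\<lambda>y. L * (L * (c * \<eta>2 (L * y))))" by simp
  have 2: "(deriv ^^ 2) (\<lambda>y. c * \<eta> (L * y) - q) y = L\<^sup>2 * (c * \<eta>2 (L * y))" for y
    by (simp add: numeral_2_eq_2 d dd power2_eq_square)
  have 3: "deriv (\<lambda>y. flux F (\<eta> (L * y)) (c * \<eta> (L * y) - q)) = (\<lambda>y. L * ((lin1 F q (\<eta> (L * y)) + c\<^sup>2) * \<eta>1 (L * y)))"
    using deriv_affine[OF DERIV_flux_profile[OF nz(1) pos \<eta>, of c q], of L 0] by simp
  have "1 / L * c\<^sup>2 * deriv (\<lambda>y. \<eta> (L * y)) (x / L) + momentum_op \<delta> F (\<lambda>y. \<eta> (L * y)) (\<lambda>y. c * \<eta> (L * y) - q) (1 / L) (x / L) = 0"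
    using P unfolding profile_solution_def by blast
  then have "c\<^sup>2 * \<eta>1 x + (\<delta> * (c * \<eta>2 x) - (lin1 F q (\<eta> x) + c\<^sup>2) * \<eta>1 x + source (\<eta> x) (c * \<eta> x - q)) = 0"
    unfolding momentum_op_def 1 2 3 using \<open>L \<noteq> 0\<close> by (simp add: power_divide)
  moreover have "source (\<eta> x) (c * \<eta> x - q) = \<eta> x - (c - q / \<eta> x)\<^sup>2"
    unfolding source_def using \<open>\<eta> x \<noteq> 0\<close> by (simp add: power_divide[symmetric] diff_divide_distrib)
  ultimately have "\<delta> * c * \<eta>2 x = lin1 F q (\<eta> x) * \<eta>1 x - (\<eta> x - (c - q / \<eta> x)\<^sup>2)"
    by (simp add: algebra_simps)
  then show "\<eta>2 x = (lin1 F q (\<eta> x) * \<eta>1 x - (\<eta> x - (c - q / \<eta> x)\<^sup>2)) / (\<delta> * c)"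
    using nz by (simp add: field_simps)
qed

text \<open>The translation by \<open>s\<close> accounts for the fact that the scaled and the unscaled families may
  select different translates of the same wave.\<close>
lemma lin_op_unscaled:
  assumes nz: "F \<noteq> 0" "L \<noteq> 0" and pos: "\<And>x. \<eta> x > 0"
    and \<eta>: "\<And>x. (\<eta> has_real_derivative \<eta>1 x) (at x)"
    and f: "\<And>x. (f has_real_derivative f1 x) (at x)"
    and f1: "\<And>x. (f1 has_real_derivative f2 x) (at x)"
  shows "lin_op \<delta> F (1 / L) q c (\<lambda>y. \<eta> (L * (y - s))) (\<lambda>y. f (L * (y - s))) y =
    (let x = L * (y - s) in \<delta> * c * f2 x - lin1 F q (\<eta> x) * f1 x - lin0 F c q (\<eta> x) (\<eta>1 x) * f x)"
proof -
  define x where "x = L * (y - s)"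
  have nx: "\<eta> x \<noteq> 0" for x using pos[of x] by simp
  have 1: "deriv (\<lambda>y. f (L * (y - s))) = (\<lambda>y. L * f1 (L * (y - s)))" by (rule deriv_affine[OF f])
  have "deriv (\<lambda>y. (\<lambda>x. L * f1 x) (L * (y - s))) = (\<lambda>y. L * (L * f2 (L * (y - s))))"
    by (rule deriv_affine) (auto intro!: derivative_eq_intros f1)
  then have 2: "(deriv ^^ 2) (\<lambda>y. f (L * (y - s))) y = L * (L * f2 x)"
    by (simp add: numeral_2_eq_2 1 x_def)
  have 3: "deriv (\<lambda>y. flux_h F (\<eta> (L * (y - s))) (c * \<eta> (L * (y - s)) - q) * f (L * (y - s))) y
    = L * (flux_h F (\<eta> x) (c * \<eta> x - q) * f1 x
        + (\<eta>1 x / F\<^sup>2 - 2 * (c - q / \<eta> x) * (q * \<eta>1 x / (\<eta> x)\<^sup>2)) * f x)"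
    unfolding x_def
    by (rule fun_cong[OF deriv_affine[OF DERIV_cong[OF DERIV_mult[OF DERIV_flux_h[OF nz(1) pos \<eta>] f]]]]) simp
  have 4: "deriv (\<lambda>y. flux_q F (\<eta> (L * (y - s))) (c * \<eta> (L * (y - s)) - q) * f (L * (y - s))) y
    = L * (flux_q F (\<eta> x) (c * \<eta> x - q) * f1 x + (2 * q * \<eta>1 x / (\<eta> x)\<^sup>2) * f x)"
    unfolding x_def
    by (rule fun_cong[OF deriv_affine[OF DERIV_cong[OF DERIV_mult[OF DERIV_flux_q[OF pos \<eta>] f]]]]) simp
  have 5: "flux_q F (\<eta> x) (c * \<eta> x - q) = 2 * (c - q / \<eta> x)" for x
    using nx[of x] by (simp add: flux_q_eq diff_divide_distrib algebra_simps)
  have 6: "flux_h F (\<eta> x) (c * \<eta> x - q) = lin1 F q (\<eta> x) + c\<^sup>2 - c * (2 * (c - q / \<eta> x))" for x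
    using nx[of x] nz(1) unfolding flux_h_eq[OF nz(1) nx] lin1_def
    by (simp add: divide_simps) (simp add: algebra_simps power2_eq_square)
  have 7: "\<eta>1 x / F\<^sup>2 - 2 * (c - q / \<eta> x) * (q * \<eta>1 x / (\<eta> x)\<^sup>2) + c * (2 * q * \<eta>1 x / (\<eta> x)\<^sup>2)
    - source_h (\<eta> x) (c * \<eta> x - q) - c * source_q (\<eta> x) (c * \<eta> x - q) = lin0 F c q (\<eta> x) (\<eta>1 x)"
    using nx[of x] nz(1) unfolding source_h_eq[OF nx] source_q_eq[OF nx] lin0_def
    by (simp add: divide_simps) (simp add: algebra_simps power2_eq_square power3_eq_cube)
  have "lin_op \<delta> F (1 / L) q c (\<lambda>y. \<eta> (L * (y - s))) (\<lambda>y. f (L * (y - s))) y =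
     c\<^sup>2 * f1 x - ((lin1 F q (\<eta> x) + c\<^sup>2 - c * (2 * (c - q / \<eta> x))) * f1 x
        + (\<eta>1 x / F\<^sup>2 - 2 * (c - q / \<eta> x) * (q * \<eta>1 x / (\<eta> x)\<^sup>2)) * f x)
     + source_h (\<eta> x) (c * \<eta> x - q) * f x
     + c * (\<delta> * f2 x - (2 * (c - q / \<eta> x) * f1 x + (2 * q * \<eta>1 x / (\<eta> x)\<^sup>2) * f x) + source_q (\<eta> x) (c * \<eta> x - q) * f x)"
    unfolding lin_op_def Let_def momentum_op_h_def momentum_op_q_def 1 2 3 4
    unfolding 5 6 x_def[symmetric]
    using nz(2) by (simp add: power2_eq_square)
  also have "\<dots> = \<delta> * c * f2 x - lin1 F q (\<eta> x) * f1 x - lin0 F c q (\<eta> x) (\<eta>1 x) * f x"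
    unfolding 7[symmetric] by (simp add: algebra_simps)
  finally show ?thesis unfolding Let_def x_def[symmetric] .
qed

text \<open>\<open>A_omega\<close> is \<open>1 / k\<close> times the derivative of the scaled profile equation with respect to \<open>c\<close>, at
  fixed profile. Hence it is, up to sign and the factor \<open>L\<close>, the inhomogeneity in the
  equation satisfied by the derivative of the unscaled profile with respect to the speed.\<close>
lemma A_omega_unscaled:
  assumes nz: "L \<noteq> 0" and pos: "\<And>x. \<eta> x > 0"
    and \<eta>: "\<And>x. (\<eta> has_real_derivative \<eta>1 x) (at x)"
    and \<eta>1: "\<And>x. (\<eta>1 has_real_derivative \<eta>2 x) (at x)"
  shows "A_omega \<delta> F (1 / L) q c (\<lambda>y. \<eta> (L * (y - s))) y =
    (let x = L * (y - s) in L * (\<delta> * \<eta>2 x - 2 * (c - q / \<eta> x)))"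
proof -
  define x where "x = L * (y - s)"
  have nx: "\<eta> x \<noteq> 0" for x using pos[of x] by simp
  have 1: "deriv (\<lambda>y. \<eta> (L * (y - s))) = (\<lambda>y. L * \<eta>1 (L * (y - s)))" by (rule deriv_affine[OF \<eta>])
  have "deriv (\<lambda>y. (\<lambda>x. L * \<eta>1 x) (L * (y - s))) = (\<lambda>y. L * (L * \<eta>2 (L * (y - s))))"
    by (rule deriv_affine) (auto intro!: derivative_eq_intros \<eta>1)
  then have 2: "(deriv ^^ 2) (\<lambda>y. \<eta> (L * (y - s))) y = L * (L * \<eta>2 x)"
    by (simp add: numeral_2_eq_2 1 x_def)
  have flux: "(\<lambda>y. flux_q F (\<eta> (L * (y - s))) (c * \<eta> (L * (y - s)) - q) * \<eta> (L * (y - s)))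
    = (\<lambda>y. (2 * (c * \<eta> (L * (y - s)) - q)))"
    using nx by (simp add: flux_q_eq)
  have "((\<lambda>x. 2 * (c * \<eta> x - q)) has_real_derivative 2 * (c * \<eta>1 x)) (at x)" for x
    by (auto intro!: derivative_eq_intros \<eta>)
  from deriv_affine[OF this, of L s]
  have 3: "deriv (\<lambda>y. flux_q F (\<eta> (L * (y - s))) (c * \<eta> (L * (y - s)) - q) * \<eta> (L * (y - s))) y
    = L * (2 * (c * \<eta>1 x))" unfolding flux x_def by simp
  have 4: "source_q (\<eta> x) (c * \<eta> x - q) * \<eta> x = - 2 * (c - q / \<eta> x)"
    unfolding source_q_eq[OF nx] using nx[of x] by (simp add: field_simps power2_eq_square)
  show ?thesis
    unfolding A_omega_def Let_def momentum_op_q_def 1 2 3 x_def[symmetric] 4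
    using nz by (simp add: field_simps power2_eq_square)
qed

lemma continuous_periodic_in_L2_per:
  assumes "continuous_on UNIV g" "\<And>y. g (y + 1) = g y"
  shows "g \<in> L2_per"
proof -
  have "g \<in> borel_measurable borel" by (rule borel_measurable_continuous_onI[OF assms(1)])
  then have "g \<in> borel_measurable lebesgue" by (auto intro: measurable_completion)
  moreover have "integrable (lebesgue_on {0..1}) (\<lambda>y. (g y)\<^sup>2)"
    using continuous_imp_integrable_real[of 0 1 "\<lambda>y. (g y)\<^sup>2"] assms(1)
    by (auto intro!: continuous_intros intro: continuous_on_subset)
  ultimately show ?thesis using assms(2) by (simp add: L2_per_def)
qed

lemma twice_differentiable_periodic_in_H2_per:
  assumes "L \<noteq> 0" and f: "\<And>x. (f has_real_derivative f1 x) (at x)"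
    and f1: "\<And>x. (f1 has_real_derivative f2 x) (at x)" and "continuous_on UNIV f2"
    and per: "\<And>x. f (x + L) = f x"
  shows "(\<lambda>y. f (L * (y - s))) \<in> H2_per"
proof -
  have shift: "L * (y + 1 - s) = L * (y - s) + L" for y by (simp add: algebra_simps)
  have per1: "f1 (x + L) = f1 x" for x
    using DERIV_unique[OF f[of "x + L", THEN DERIV_shift[THEN iffD1], unfolded per] f[of x]] .
  have per2: "f2 (x + L) = f2 x" for x
    using DERIV_unique[OF f1[of "x + L", THEN DERIV_shift[THEN iffD1], unfolded per1] f1[of x]] .
  define g where "g = (\<lambda>y. L * (L * f2 (L * (y - s))))"
  have d: "deriv (\<lambda>y. f (L * (y - s))) = (\<lambda>y. (\<lambda>x. L * f1 x) (L * (y - s)))"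
    using deriv_affine[OF f] by simp
  have dd: "((\<lambda>y. L * f1 (L * (y - s))) has_real_derivative g y) (at y)" for y
    unfolding g_def by (rule DERIV_affine) (auto intro!: derivative_eq_intros f1)
  have "g \<in> L2_per"
    by (rule continuous_periodic_in_L2_per)
      (auto simp: g_def shift per2 intro!: continuous_intros continuous_on_compose2[OF assms(4)])
  moreover have "(g has_integral (deriv (\<lambda>y. f (L * (y - s))) b - deriv (\<lambda>y. f (L * (y - s))) a)) {a..b}" if "a \<le> b" for a b
    unfolding d using that dd
    by (intro fundamental_theorem_of_calculus)
      (auto simp: has_real_derivative_iff_has_vector_derivative intro: has_vector_derivative_at_within)
  moreover have "(\<lambda>y. f (L * (y - s))) differentiable (at y)" for y
    using DERIV_affine[OF f] by (auto simp: real_differentiable_def)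
  ultimately show ?thesis unfolding H2_per_def by (auto simp: shift per)
qed

text \<open>Periodic solutions of the linearized profile equation are in the kernel, and a periodic solution
  \<open>f\<close> of the equation satisfied by the derivative with respect to the speed shows that \<open>A_omega\<close> is in
  the range: it is the image of \<open>- L f\<close>.\<close>
lemma unscaled_kernel_and_range:
  assumes nz: "\<delta> \<noteq> 0" "F \<noteq> 0" "c \<noteq> 0" "L \<noteq> 0" and pos: "\<And>x. \<eta> x > 0"
    and \<eta>: "\<And>x. (\<eta> has_real_derivative \<eta>1 x) (at x)"
    and \<eta>1: "\<And>x. (\<eta>1 has_real_derivative \<eta>2 x) (at x)" and cont: "continuous_on UNIV \<eta>2"
    and f: "\<And>x. (f has_real_derivative f1 x) (at x)" and per: "\<And>x. f (x + L) = f x"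
  shows
    "\<lbrakk>\<And>x. (f1 has_real_derivative
        (lin1 F q (\<eta> x) * f1 x + lin0 F c q (\<eta> x) (\<eta>1 x) * f x) / (\<delta> * c)) (at x)\<rbrakk> \<Longrightarrow>
      (\<lambda>y. f (L * (y - s))) \<in> lin_op_kernel \<delta> F (1 / L) q c (\<lambda>y. \<eta> (L * (y - s)))"
    "\<lbrakk>\<And>x. (f1 has_real_derivative
        (lin1 F q (\<eta> x) * f1 x + lin0 F c q (\<eta> x) (\<eta>1 x) * f x + 2 * (c - q / \<eta> x)
          - \<delta> * \<eta>2 x) / (\<delta> * c)) (at x); \<And>x. \<eta> (x + L) = \<eta> x\<rbrakk> \<Longrightarrow>
      A_omega \<delta> F (1 / L) q c (\<lambda>y. \<eta> (L * (y - s)))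
        \<in> lin_op_range \<delta> F (1 / L) q c (\<lambda>y. \<eta> (L * (y - s)))"
proof -
  have nx: "\<eta> x \<noteq> 0" for x using pos[of x] by simp
  have c: "continuous_on UNIV \<eta>" "continuous_on UNIV \<eta>1" "continuous_on UNIV f"
    using DERIV_isCont[OF \<eta>] DERIV_isCont[OF \<eta>1] DERIV_isCont[OF f] by (auto intro: continuous_at_imp_continuous_on)
  have cl: "continuous_on UNIV (\<lambda>x. lin1 F q (\<eta> x))" "continuous_on UNIV (\<lambda>x. lin0 F c q (\<eta> x) (\<eta>1 x))"
    unfolding lin1_def lin0_def using nz nx by (auto intro!: continuous_intros c)
  {
    assume f1: "\<And>x. (f1 has_real_derivative
        (lin1 F q (\<eta> x) * f1 x + lin0 F c q (\<eta> x) (\<eta>1 x) * f x) / (\<delta> * c)) (at x)"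
    have cf1: "continuous_on UNIV f1"
      using DERIV_isCont[OF f1] by (auto intro: continuous_at_imp_continuous_on)
    have "(\<lambda>y. f (L * (y - s))) \<in> H2_per"
      by (rule twice_differentiable_periodic_in_H2_per[OF nz(4) f f1 _ per])
        (use nz in \<open>auto intro!: continuous_on_divide continuous_on_add continuous_on_mult cl c cf1 continuous_on_const\<close>)
    moreover have "lin_op \<delta> F (1 / L) q c (\<lambda>y. \<eta> (L * (y - s))) (\<lambda>y. f (L * (y - s))) y = 0" for y
      unfolding lin_op_unscaled[OF nz(2,4) pos \<eta> f f1] Let_def using nz by simp
    ultimately show "(\<lambda>y. f (L * (y - s))) \<in> lin_op_kernel \<delta> F (1 / L) q c (\<lambda>y. \<eta> (L * (y - s)))"
      unfolding lin_op_kernel_def by simp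
  next
    assume f1: "\<And>x. (f1 has_real_derivative
        (lin1 F q (\<eta> x) * f1 x + lin0 F c q (\<eta> x) (\<eta>1 x) * f x + 2 * (c - q / \<eta> x)
          - \<delta> * \<eta>2 x) / (\<delta> * c)) (at x)" and per\<eta>: "\<And>x. \<eta> (x + L) = \<eta> x"
    have cf1: "continuous_on UNIV f1"
      using DERIV_isCont[OF f1] by (auto intro: continuous_at_imp_continuous_on)
    have Lf: "((\<lambda>x. - L * f x) has_real_derivative - L * f1 x) (at x)"
      and Lf1: "((\<lambda>x. - L * f1 x) has_real_derivative - L * ((lin1 F q (\<eta> x) * f1 x + lin0 F c q (\<eta> x) (\<eta>1 x) * f x + 2 * (c - q / \<eta> x)
          - \<delta> * \<eta>2 x) / (\<delta> * c))) (at x)" for x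
      by (intro DERIV_cmult f f1)+
    have cq: "continuous_on UNIV (\<lambda>x. 2 * (c - q / \<eta> x))"
      using nx by (auto intro!: continuous_intros c)
    have H2: "(\<lambda>y. - L * f (L * (y - s))) \<in> H2_per"
      by (rule twice_differentiable_periodic_in_H2_per[OF nz(4) Lf Lf1])
        (use nz per in \<open>auto intro!: continuous_on_divide continuous_on_add continuous_on_diff continuous_on_mult cl c cf1 cont cq continuous_on_const continuous_on_minus simp: nx\<close>)
    have A: "A_omega \<delta> F (1 / L) q c (\<lambda>y. \<eta> (L * (y - s)))
        = (\<lambda>y. (\<lambda>x. L * (\<delta> * \<eta>2 x - 2 * (c - q / \<eta> x))) (L * (y - s)))"
      by (rule ext) (simp only: A_omega_unscaled[OF nz(4) pos \<eta> \<eta>1] Let_def)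
    have per1: "\<eta>1 (x + L) = \<eta>1 x" for x
      using DERIV_unique[OF \<eta>[of "x + L", THEN DERIV_shift[THEN iffD1], unfolded per\<eta>] \<eta>[of x]] .
    have per2: "\<eta>2 (x + L) = \<eta>2 x" for x
      using DERIV_unique[OF \<eta>1[of "x + L", THEN DERIV_shift[THEN iffD1], unfolded per1] \<eta>1[of x]] .
    have shift: "L * (y + 1 - s) = L * (y - s) + L" for y by (simp add: algebra_simps)
    have "A_omega \<delta> F (1 / L) q c (\<lambda>y. \<eta> (L * (y - s))) \<in> L2_per"
      unfolding A
    proof (rule continuous_periodic_in_L2_per)
      have "continuous_on UNIV (\<lambda>x. L * (\<delta> * \<eta>2 x - 2 * (c - q / \<eta> x)))"
        by (intro continuous_on_mult continuous_on_diff continuous_on_const cont cq[unfolded mult.assoc])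
      then show "continuous_on UNIV (\<lambda>y. L * (\<delta> * \<eta>2 (L * (y - s)) - 2 * (c - q / \<eta> (L * (y - s)))))"
        by (rule continuous_on_compose2) (auto intro!: continuous_intros)
    qed (simp add: shift per2 per\<eta>)
    moreover have "lin_op \<delta> F (1 / L) q c (\<lambda>y. \<eta> (L * (y - s))) (\<lambda>y. - L * f (L * (y - s))) y
      = A_omega \<delta> F (1 / L) q c (\<lambda>y. \<eta> (L * (y - s))) y" for y
      unfolding lin_op_unscaled[OF nz(2,4) pos \<eta> Lf Lf1] A Let_def using nz by (simp add: field_simps)
    ultimately show "A_omega \<delta> F (1 / L) q c (\<lambda>y. \<eta> (L * (y - s)))
        \<in> lin_op_range \<delta> F (1 / L) q c (\<lambda>y. \<eta> (L * (y - s)))"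
      unfolding lin_op_range_def using H2 by auto
  }
qed

section \<open>Parameter derivatives of the waves\<close>

text \<open>Here \<open>h\<close> and \<open>k\<close> are the profile and its slope at a fixed point, along a line in the parameter
  plane with direction \<open>(vc, vq)\<close>. The term with \<open>\<delta>\<close> comes from the factor \<open>1 / (\<delta> c)\<close>: its inner
  fraction is \<open>H''\<close>, by the profile equation.\<close>
lemma profile_rhs_variation:
  fixes h k :: "real \<Rightarrow> real" and c q vc vq :: real
  assumes "\<delta> \<noteq> 0" "F \<noteq> 0" "c \<noteq> 0" "h 0 > 0"
    and h: "(h has_real_derivative h') (at 0)" and k: "(k has_real_derivative k') (at 0)"
  shows "((\<lambda>t. (lin1 F (q + t * vq) (h t) * k t - (h t - ((c + t * vc) - (q + t * vq) / h t)\<^sup>2)) / (\<delta> * (c + t * vc)))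
    has_real_derivative
     (lin1 F q (h 0) * k' + lin0 F c q (h 0) (k 0) * h'
      + vc * (2 * (c - q / h 0) - \<delta> * ((lin1 F q (h 0) * k 0 - (h 0 - (c - q / h 0)\<^sup>2)) / (\<delta> * c)))
      - vq * linq c q (h 0) (k 0)) / (\<delta> * c)) (at 0)"
proof -
  have nz: "h 0 \<noteq> 0" using assms by simp
  have dc: "((\<lambda>t. c + t * vc) has_real_derivative vc) (at 0)" and dq: "((\<lambda>t. q + t * vq) has_real_derivative vq) (at 0)"
    by (auto intro!: derivative_eq_intros)
  have d1: "((\<lambda>t. lin1 F (q + t * vq) (h t)) has_real_derivative
      (1 / F\<^sup>2 + 2 * q\<^sup>2 / h 0 ^ 3) * h' - vq * (2 * q / (h 0)\<^sup>2)) (at 0)"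
    unfolding lin1_def using nz \<open>F \<noteq> 0\<close>
    by (auto intro!: derivative_eq_intros h simp: field_simps power2_eq_square power3_eq_cube)
  have d2: "((\<lambda>t. h t - ((c + t * vc) - (q + t * vq) / h t)\<^sup>2) has_real_derivative
      h' - 2 * (c - q / h 0) * (vc - vq / h 0 + q * h' / (h 0)\<^sup>2)) (at 0)"
    using nz by (auto intro!: derivative_eq_intros h simp: field_simps power2_eq_square)
  have "\<delta> * (c + 0 * vc) \<noteq> 0" using assms by simp
  note D = DERIV_divide[OF DERIV_diff[OF DERIV_mult[OF d1 k] d2] DERIV_cmult[OF dc, of \<delta>] this]
  show ?thesis
  proof (rule DERIV_cong[OF D])
    define Z where "Z = lin1 F q (h 0) * k 0 - (h 0 - (c - q / h 0)\<^sup>2)"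
    define U where "U = ((1 / F\<^sup>2 + 2 * q\<^sup>2 / h 0 ^ 3) * h' - vq * (2 * q / (h 0)\<^sup>2)) * k 0 + k' * lin1 F q (h 0)
       - (h' - 2 * (c - q / h 0) * (vc - vq / h 0 + q * h' / (h 0)\<^sup>2))"
    have U: "U = lin1 F q (h 0) * k' + lin0 F c q (h 0) (k 0) * h' + vc * (2 * (c - q / h 0)) - vq * linq c q (h 0) (k 0)"
      unfolding U_def lin0_def linq_def
      by (simp add: algebra_simps add_divide_distrib diff_divide_distrib)
    have "(U * (\<delta> * c) - Z * (\<delta> * vc)) / ((\<delta> * c) * (\<delta> * c)) = (U - vc * (\<delta> * (Z / (\<delta> * c)))) / (\<delta> * c)"
      using assms(1,3) by (simp add: field_simps)
    then show "((((1 / F\<^sup>2 + 2 * q\<^sup>2 / h 0 ^ 3) * h' - vq * (2 * q / (h 0)\<^sup>2)) * k 0 + k' * lin1 F (q + 0 * vq) (h 0) -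
          (h' - 2 * (c - q / h 0) * (vc - vq / h 0 + q * h' / (h 0)\<^sup>2))) * (\<delta> * (c + 0 * vc)) -
         (lin1 F (q + 0 * vq) (h 0) * k 0 - (h 0 - (c + 0 * vc - (q + 0 * vq) / h 0)\<^sup>2)) * (\<delta> * vc)) /
        (\<delta> * (c + 0 * vc) * (\<delta> * (c + 0 * vc))) =
       (lin1 F q (h 0) * k' + lin0 F c q (h 0) (k 0) * h'
      + vc * (2 * (c - q / h 0) - \<delta> * ((lin1 F q (h 0) * k 0 - (h 0 - (c - q / h 0)\<^sup>2)) / (\<delta> * c)))
      - vq * linq c q (h 0) (k 0)) / (\<delta> * c)"
      unfolding U_def[symmetric] Z_def[symmetric] mult_zero_left add_0_right
      unfolding U by (simp add: algebra_simps)
  qed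
qed

text \<open>The parameter derivatives of the wave in direction \<open>v\<close>. Their second-order equation
  results from differentiating the profile equation, solved for \<open>H''\<close>, along \<open>v\<close>;
  symmetry of mixed derivatives turns the derivative of \<open>H''\<close> into that of \<open>h1\<close>.\<close>
lemma wave_family_variation:
  fixes f :: "(real \<times> real) \<times> real \<Rightarrow> real" and l :: "real \<times> real \<Rightarrow> real" and v :: "real \<times> real"
  assumes nz: "\<delta> \<noteq> 0" "F \<noteq> 0" and "open W" and a: "(c, q) \<in> W"
    and f: "smooth_on (W \<times> UNIV) f" and l: "smooth_on W l"
    and W: "\<And>c q. (c, q) \<in> W \<Longrightarrow> c \<noteq> 0 \<and> l (c, q) \<noteq> 0 \<and>
      profile_solution \<delta> F (1 / l (c, q)) q c (\<lambda>y. f ((c, q), l (c, q) * y))"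
  defines "f1 \<equiv> \<lambda>p. frechet_derivative f (at p) (0, 1)"
  defines "\<eta> \<equiv> \<lambda>x. f ((c, q), x)" and "\<eta>1 \<equiv> \<lambda>x. f1 ((c, q), x)"
    and "h \<equiv> \<lambda>x. frechet_derivative f (at ((c, q), x)) (v, 0)"
    and "h1 \<equiv> \<lambda>x. frechet_derivative f1 (at ((c, q), x)) (v, 0)"
    and "lv \<equiv> frechet_derivative l (at (c, q)) v"
  shows "\<eta> x > 0" "\<eta> (x + l (c, q)) = \<eta> x"
    and "(\<eta> has_real_derivative \<eta>1 x) (at x)"
    and "(\<eta>1 has_real_derivative
          (lin1 F q (\<eta> x) * \<eta>1 x - (\<eta> x - (c - q / \<eta> x)\<^sup>2)) / (\<delta> * c)) (at x)"
    and "(h has_real_derivative h1 x) (at x)"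
    and "(h1 has_real_derivative
          (lin1 F q (\<eta> x) * h1 x + lin0 F c q (\<eta> x) (\<eta>1 x) * h x
            + fst v * (2 * (c - q / \<eta> x) - \<delta> * deriv \<eta>1 x)
            - snd v * linq c q (\<eta> x) (\<eta>1 x)) / (\<delta> * c)) (at x)"
    and "h (x + l (c, q)) = h x - lv * \<eta>1 x"
    and "h1 (x + l (c, q)) = h1 x - lv * deriv \<eta>1 x"
proof -
  define f2 where "f2 = (\<lambda>p. frechet_derivative f1 (at p) (0, 1))"
  have f1: "smooth_on (W \<times> UNIV) f1" unfolding f1_def by (rule smooth_onD(3)[OF f])
  have f2: "smooth_on (W \<times> UNIV) f2" unfolding f2_def by (rule smooth_onD(3)[OF f1])
  have dx: "((\<lambda>x. g (p, x)) has_real_derivative frechet_derivative g (at (p, x)) (0, 1)) (at x)"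
    if "smooth_on (W \<times> UNIV) g" "p \<in> W" for g :: "(real \<times> real) \<times> real \<Rightarrow> real" and p x
    by (rule DERIV_frechet_chain) 
      (use smooth_onD(2)[OF that(1)] that(2) in \<open>auto intro!: derivative_eq_intros has_vector_derivative_Pair\<close>)
  have dx1: "((\<lambda>x. f (p, x)) has_real_derivative f1 (p, x)) (at x)" if "p \<in> W" for p x
    unfolding f1_def by (rule dx[OF f that])
  have dx2: "((\<lambda>x. f1 (p, x)) has_real_derivative f2 (p, x)) (at x)" if "p \<in> W" for p x
    unfolding f2_def by (rule dx[OF f1 that])
  have wave: "f ((c, q), x) > 0" "f ((c, q), x + l (c, q)) = f ((c, q), x)"
      "f2 ((c, q), x) = (lin1 F q (f ((c, q), x)) * f1 ((c, q), x) - (f ((c, q), x) - (c - q / f ((c, q), x))\<^sup>2)) / (\<delta> * c)"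
      if "(c, q) \<in> W" for c q x
  proof -
    note P = W[OF that]
    from P have "c \<noteq> 0" "l (c, q) \<noteq> 0" and P: "profile_solution \<delta> F (1 / l (c, q)) q c (\<lambda>y. f ((c, q), l (c, q) * y))"
      by auto
    from profile_solution_unscaled[where \<eta> = "\<lambda>x. f ((c, q), x)", OF nz(2,1) this(1,2) P
        dx1[OF that] dx2[OF that]]
    show "f ((c, q), x) > 0" "f ((c, q), x + l (c, q)) = f ((c, q), x)"
      "f2 ((c, q), x) = (lin1 F q (f ((c, q), x)) * f1 ((c, q), x) - (f ((c, q), x) - (c - q / f ((c, q), x))\<^sup>2)) / (\<delta> * c)"
      by auto
  qed
  show "\<eta> x > 0" "\<eta> (x + l (c, q)) = \<eta> x" unfolding \<eta>_def using wave[OF a] by auto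
  show d0: "(\<eta> has_real_derivative \<eta>1 x) (at x)" for x
    unfolding \<eta>_def \<eta>1_def by (rule dx1[OF a])
  have d1': "(\<eta>1 has_real_derivative f2 ((c, q), x)) (at x)" for x
    unfolding \<eta>1_def by (rule dx2[OF a])
  then show "(\<eta>1 has_real_derivative
          (lin1 F q (\<eta> x) * \<eta>1 x - (\<eta> x - (c - q / \<eta> x)\<^sup>2)) / (\<delta> * c)) (at x)"
    unfolding \<eta>_def \<eta>1_def wave(3)[OF a] .
  have e2: "deriv \<eta>1 x = f2 ((c, q), x)" for x by (rule DERIV_imp_deriv) (rule d1')
  show "(h has_real_derivative h1 x) (at x)"
    unfolding h_def h1_def f1_def by (rule smooth_mixed_partials[OF \<open>open W\<close> a f])
  have per: "f (p, x + l p) = f (p, x)" if "p \<in> W" for p x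
    using wave(2) that by (cases p) auto
  have per1: "f1 (p, x + l p) = f1 (p, x)" if "p \<in> W" for p x
    using DERIV_unique[OF dx1[OF that, of "x + l p", THEN DERIV_shift[THEN iffD1], unfolded per[OF that]] dx1[OF that]]
    .
  have diff: "f differentiable (at ((c, q), x))" "f1 differentiable (at ((c, q), x))" for x
    using smooth_onD(2)[OF f] smooth_onD(2)[OF f1] a by auto
  have per2: "f2 ((c, q), x + l (c, q)) = f2 ((c, q), x)" for x
    using DERIV_unique[OF dx2[OF a, of "x + l (c, q)", THEN DERIV_shift[THEN iffD1], unfolded per1[OF a]] dx2[OF a]]
    .
  show "h (x + l (c, q)) = h x - lv * \<eta>1 x"
    using periodic_family_variation[OF \<open>open W\<close> a per diff(1) smooth_onD(2)[OF l a], of x v] per1[OF a]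
    by (simp add: h_def lv_def \<eta>1_def f1_def)
  show "h1 (x + l (c, q)) = h1 x - lv * deriv \<eta>1 x"
    using periodic_family_variation[OF \<open>open W\<close> a per1 diff(2) smooth_onD(2)[OF l a], of x v] per2
    by (simp add: h1_def lv_def e2 f2_def)
  have "(h1 has_real_derivative frechet_derivative f2 (at ((c, q), x)) (v, 0)) (at x)"
    unfolding h1_def f2_def by (rule smooth_mixed_partials[OF \<open>open W\<close> a f1])
  moreover have "frechet_derivative f2 (at ((c, q), x)) (v, 0) =
       (lin1 F q (\<eta> x) * h1 x + lin0 F c q (\<eta> x) (\<eta>1 x) * h x
            + fst v * (2 * (c - q / \<eta> x) - \<delta> * deriv \<eta>1 x)
            - snd v * linq c q (\<eta> x) (\<eta>1 x)) / (\<delta> * c)"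
  proof (rule DERIV_unique)
    have dt: "((\<lambda>t. g ((c, q) + t *\<^sub>R v, x)) has_real_derivative frechet_derivative g (at ((c, q), x)) (v, 0)) (at 0)"
      if "smooth_on (W \<times> UNIV) g" for g :: "(real \<times> real) \<times> real \<Rightarrow> real"
      using DERIV_frechet_chain[OF _ line_derivative[of "(c, q)" v x 0], of g] smooth_onD(2)[OF that, of "((c, q), x)"] a
      by simp
    show "((\<lambda>t. f2 ((c, q) + t *\<^sub>R v, x)) has_real_derivative frechet_derivative f2 (at ((c, q), x)) (v, 0)) (at 0)"
      by (rule dt[OF f2])
    have "((\<lambda>t. (lin1 F (q + t * snd v) (f ((c, q) + t *\<^sub>R v, x)) * f1 ((c, q) + t *\<^sub>R v, x)
        - (f ((c, q) + t *\<^sub>R v, x) - ((c + t * fst v) - (q + t * snd v) / f ((c, q) + t *\<^sub>R v, x))\<^sup>2)) / (\<delta> * (c + t * fst v)))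
      has_real_derivative
       (lin1 F q (\<eta> x) * h1 x + lin0 F c q (\<eta> x) (\<eta>1 x) * h x
            + fst v * (2 * (c - q / \<eta> x) - \<delta> * deriv \<eta>1 x)
            - snd v * linq c q (\<eta> x) (\<eta>1 x)) / (\<delta> * c)) (at 0)"
      using profile_rhs_variation[OF nz _ _ dt[OF f] dt[OF f1], of c q "snd v" "fst v"] W[OF a] wave(1)[OF a, of x]
      by (simp add: e2[unfolded \<eta>1_def] wave(3)[OF a] \<eta>_def \<eta>1_def h_def h1_def)
    note D = this
    obtain r where r: "r > 0" "\<And>t. \<bar>t\<bar> \<le> r \<Longrightarrow> (c, q) + t *\<^sub>R v \<in> W"
      using line_in_open[OF \<open>open W\<close> a] by blast
    show "((\<lambda>t. f2 ((c, q) + t *\<^sub>R v, x)) has_real_derivative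
       (lin1 F q (\<eta> x) * h1 x + lin0 F c q (\<eta> x) (\<eta>1 x) * h x
            + fst v * (2 * (c - q / \<eta> x) - \<delta> * deriv \<eta>1 x)
            - snd v * linq c q (\<eta> x) (\<eta>1 x)) / (\<delta> * c)) (at 0)"
    proof (rule has_field_derivative_transform_within[OF D r(1)])
      fix t :: real assume "dist t 0 < r"
      then have "(c, q) + t *\<^sub>R v \<in> W" using r(2) by simp
      moreover have "(c, q) + t *\<^sub>R v = (c + t * fst v, q + t * snd v)" by (cases v) simp
      ultimately show "(lin1 F (q + t * snd v) (f ((c, q) + t *\<^sub>R v, x)) * f1 ((c, q) + t *\<^sub>R v, x)
        - (f ((c, q) + t *\<^sub>R v, x) - ((c + t * fst v) - (q + t * snd v) / f ((c, q) + t *\<^sub>R v, x))\<^sup>2)) / (\<delta> * (c + t * fst v))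
        = f2 ((c, q) + t *\<^sub>R v, x)"
        using wave(3)[of "c + t * fst v" "q + t * snd v" x] by simp
    qed simp
  qed
  ultimately show "(h1 has_real_derivative
          (lin1 F q (\<eta> x) * h1 x + lin0 F c q (\<eta> x) (\<eta>1 x) * h x
            + fst v * (2 * (c - q / \<eta> x) - \<delta> * deriv \<eta>1 x)
            - snd v * linq c q (\<eta> x) (\<eta>1 x)) / (\<delta> * c)) (at x)" by simp
qed

section \<open>Low-frequency expansion of the Evans function\<close>

theorem lemma1:
  fixes \<delta> F :: real
    and P :: "(real \<times> real) set"
    and cs :: "real \<Rightarrow> real \<Rightarrow> real"
    and Hs :: "real \<Rightarrow> real \<Rightarrow> real \<Rightarrow> real"
    and W :: "(real \<times> real) set"
    and L :: "real \<Rightarrow> real \<Rightarrow> real"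
    and H :: "real \<Rightarrow> real \<Rightarrow> real \<Rightarrow> real"
    and c0 q0 :: real
    and \<Psi> :: "complex \<Rightarrow> real \<Rightarrow> complex ^ 3 ^ 3"
  assumes "\<delta> > 0" and "F > 0"
    \<comment> \<open>scaled waves, parametrized by \<open>(k, q)\<close>\<close>
    and "open P" and "\<And>k q. (k, q) \<in> P \<Longrightarrow> k \<noteq> 0"
    and "\<And>k q. (k, q) \<in> P \<Longrightarrow> profile_solution \<delta> F k q (cs k q) (Hs k q)"
    and "\<And>k q. (k, q) \<in> P \<Longrightarrow> \<not> Hs k q constant_on UNIV"
    and "\<And>k q c h. (k, q) \<in> P \<Longrightarrow> profile_solution \<delta> F k q c h \<Longrightarrow> \<not> h constant_on UNIV \<Longrightarrow>
           c = cs k q \<and> (\<exists>s. \<forall>y. h y = Hs k q (y + s))"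
    and "smooth_on P (\<lambda>(k, q). cs k q)"
    and "smooth_on (P \<times> UNIV) (\<lambda>((k, q), y). Hs k q y)"
    and "\<And>k q. (k, q) \<in> P \<Longrightarrow>
           lin_op_kernel \<delta> F k q (cs k q) (Hs k q) = range (\<lambda>a y. a * deriv (Hs k q) y)"
    and "\<And>k q. (k, q) \<in> P \<Longrightarrow>
           A_omega \<delta> F k q (cs k q) (Hs k q) \<notin> lin_op_range \<delta> F k q (cs k q) (Hs k q)"
    and "\<And>k q. (k, q) \<in> P \<Longrightarrow> deriv (\<lambda>q. mean 1 (Hs k q)) q \<noteq> 0"
    and "\<And>k q. (k, q) \<in> P \<Longrightarrow> deriv (\<lambda>k. cs k q) k \<noteq> 0"
    and "\<And>k q. (k, q) \<in> P \<Longrightarrow> deriv (\<lambda>q. cs k q) q \<noteq> 0"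
    \<comment> \<open>unscaled waves, parametrized by \<open>(c, q)\<close>\<close>
    and "open W" and "(c0, q0) \<in> W" and "c0 \<noteq> 0"
    and "smooth_on W (\<lambda>(c, q). L c q)"
    and "smooth_on (W \<times> UNIV) (\<lambda>((c, q), x). H c q x)"
    and "\<And>c q. (c, q) \<in> W \<Longrightarrow> L c q \<noteq> 0 \<and> (1 / L c q, q) \<in> P"
    and "\<And>c q. (c, q) \<in> W \<Longrightarrow> profile_solution \<delta> F (1 / L c q) q c (\<lambda>y. H c q (L c q * y))"
    and "\<And>c q. (c, q) \<in> W \<Longrightarrow> \<not> H c q constant_on UNIV"
    and "\<And>c q. (c, q) \<in> W \<Longrightarrow> H c q 0 = mean (L c q) (H c q)"
    \<comment> \<open>fundamental matrices of the spectral problem\<close>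
    and "\<And>\<mu>. fundamental_matrix
           (evans_matrix \<delta> F c0 (H c0 q0) (\<lambda>x. c0 * H c0 q0 x - q0) \<mu>) (\<Psi> \<mu>)"
  shows "\<exists>\<Gamma>. \<Gamma> \<noteq> 0 \<and>
     (\<lambda>(\<mu>, \<nu>). evans \<Psi> (L c0 q0) \<mu> (exp \<nu>) - \<Gamma> * whitham_dispersion L H c0 q0 \<mu> \<nu>)
       \<in> O[at (0, 0) within UNIV \<times> {\<nu>. Re \<nu> = 0}](\<lambda>(\<mu>, \<nu>). of_real ((norm \<mu> + norm \<nu>) ^ 3))"
proof -
  have nz: "\<delta> \<noteq> 0" "F \<noteq> 0" using assms(1,2) by auto
  define L0 where "L0 = L c0 q0"
\<comment> \<open>The profile equation can be solved for \<open>H''\<close> only at nonzero speeds.\<close>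
  define W' where "W' = W \<inter> fst -` (- {0})"
  have "open W'"
    unfolding W'_def using assms(15) by (intro open_Int open_vimage continuous_intros) auto
  have a: "(c0, q0) \<in> W'" using assms(16,17) by (simp add: W'_def)
  define f where "f = (\<lambda>((c, q), x). H c q x)"
  define l where "l = (\<lambda>(c, q). L c q)"
  have f: "smooth_on (W' \<times> UNIV) f" and l: "smooth_on W' l"
    unfolding f_def l_def by (rule smooth_on_subset[OF assms(19)] smooth_on_subset[OF assms(18)]; auto simp: W'_def)+
  have W': "c \<noteq> 0 \<and> l (c, q) \<noteq> 0 \<and>
      profile_solution \<delta> F (1 / l (c, q)) q c (\<lambda>y. f ((c, q), l (c, q) * y))" if "(c, q) \<in> W'" for c q
    using assms(20,21)[of c q] that by (simp add: W'_def f_def l_def)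
  define f1 where "f1 = (\<lambda>p. frechet_derivative f (at p) (0, 1))"
  define \<eta> where "\<eta> = H c0 q0"
  define \<eta>1 where "\<eta>1 = (\<lambda>x. f1 ((c0, q0), x))"
  define hc hc1 where "hc = (\<lambda>x. frechet_derivative f (at ((c0, q0), x)) ((1, 0), 0))"
    and "hc1 = (\<lambda>x. frechet_derivative f1 (at ((c0, q0), x)) ((1, 0), 0))"
  define hq hq1 where "hq = (\<lambda>x. frechet_derivative f (at ((c0, q0), x)) ((0, 1), 0))"
    and "hq1 = (\<lambda>x. frechet_derivative f1 (at ((c0, q0), x)) ((0, 1), 0))"
  define Lc Lq where "Lc = frechet_derivative l (at (c0, q0)) (1, 0)"
    and "Lq = frechet_derivative l (at (c0, q0)) (0, 1)"
  have f_eq: "l (c0, q0) = L0" by (simp add: l_def L0_def)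
  have fold: "frechet_derivative f (at ((c0, q0), x)) (0, 1) = \<eta>1 x"
    "frechet_derivative f (at ((c0, q0), x)) ((1, 0), 0) = hc x"
    "frechet_derivative f1 (at ((c0, q0), x)) ((1, 0), 0) = hc1 x"
    "frechet_derivative f (at ((c0, q0), x)) ((0, 1), 0) = hq x"
    "frechet_derivative f1 (at ((c0, q0), x)) ((0, 1), 0) = hq1 x"
    "f ((c0, q0), x) = \<eta> x" for x
    by (simp_all add: \<eta>1_def f1_def hc_def hc1_def hq_def hq1_def f_def \<eta>_def)
  note wave = wave_family_variation(1-4)[OF nz \<open>open W'\<close> a f l W', folded f1_def, unfolded fold f_eq]
  note varc = wave_family_variation(5-8)[where v = "(1, 0)", OF nz \<open>open W'\<close> a f l W', folded f1_def Lc_def,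
      unfolded fold f_eq fst_conv snd_conv]
  note varq = wave_family_variation(5-8)[where v = "(0, 1)", OF nz \<open>open W'\<close> a f l W', folded f1_def Lq_def,
      unfolded fold f_eq fst_conv snd_conv]
  have \<eta>: "(\<eta> has_real_derivative \<eta>1 x) (at x)" and pos: "\<eta> x > 0" and per: "\<eta> (x + L0) = \<eta> x" for x
    using wave(1-3) by simp_all
  have "L0 \<noteq> 0" and P: "(1 / L0, q0) \<in> P" using assms(20)[OF assms(16)] by (simp_all add: L0_def)
\<comment> \<open>By uniqueness up to translation, the hypotheses on the kernel and the range, which concern \<open>Hs\<close>,
    apply to the wave \<open>\<eta>\<close> shifted by some \<open>s\<close>.\<close>
  obtain s where s: "c0 = cs (1 / L0) q0" "Hs (1 / L0) q0 = (\<lambda>y. \<eta> (L0 * (y - s)))"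
  proof -
    have "\<not> (\<lambda>y. H c0 q0 (L c0 q0 * y)) constant_on UNIV"
    proof
      assume "(\<lambda>y. H c0 q0 (L c0 q0 * y)) constant_on UNIV"
      then obtain d where d: "\<And>y. H c0 q0 (L c0 q0 * y) = d" by (auto simp: constant_on_def)
      have "H c0 q0 x = d" for x using d[of "x / L0"] \<open>L0 \<noteq> 0\<close> by (simp add: L0_def)
      then show False using assms(22)[OF assms(16)] by (auto simp: constant_on_def)
    qed
    from assms(7)[OF P assms(21)[OF assms(16), folded L0_def] this[folded L0_def]]
    obtain s where "c0 = cs (1 / L0) q0" and s: "\<And>y. H c0 q0 (L0 * y) = Hs (1 / L0) q0 (y + s)"
      by auto
    moreover have "Hs (1 / L0) q0 y = \<eta> (L0 * (y - s))" for y using s[of "y - s"] by (simp add: \<eta>_def)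
    ultimately show ?thesis by (intro that) auto
  qed
  have der1: "(\<eta>1 has_real_derivative (lin1 F q0 (\<eta> x) * \<eta>1 x - (\<eta> x - (c0 - q0 / \<eta> x)\<^sup>2)) / (\<delta> * c0)) (at x)" for x
    using wave(4) by simp
  have deriv\<eta>1: "(\<eta>1 has_real_derivative deriv \<eta>1 x) (at x)" for x
    using der1[of x] DERIV_imp_deriv by fastforce
  have cont: "continuous_on UNIV \<eta>" "continuous_on UNIV \<eta>1"
    using DERIV_isCont[OF \<eta>] DERIV_isCont[OF der1] by (auto intro: continuous_at_imp_continuous_on)
  have cont2: "continuous_on UNIV (deriv \<eta>1)"
  proof -
    have nx: "\<eta> x \<noteq> 0" for x using pos[of x] by simp
    have "deriv \<eta>1 = (\<lambda>x. (lin1 F q0 (\<eta> x) * \<eta>1 x - (\<eta> x - (c0 - q0 / \<eta> x)\<^sup>2)) / (\<delta> * c0))"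
      by (rule ext, rule DERIV_imp_deriv, rule der1)
    then show ?thesis unfolding lin1_def using nz nx assms(17)
      by (auto intro!: continuous_intros cont)
  qed
  note kernel_range = unscaled_kernel_and_range[OF nz assms(17) \<open>L0 \<noteq> 0\<close> pos \<eta> deriv\<eta>1 cont2, of _ _ q0 s]
  interpret wave_linearization \<delta> F c0 q0 L0 Lc Lq \<eta> \<eta>1 hc hc1 hq hq1
  proof
    show "\<exists>x. \<eta>1 x \<noteq> 0"
    proof (rule ccontr)
      assume "\<nexists>x. \<eta>1 x \<noteq> 0"
      then have "\<forall>x. (\<eta> has_real_derivative 0) (at x)" using \<eta> by simp
      from DERIV_isconst_all[OF this, of _ 0] have "\<eta> constant_on UNIV" by (auto simp: constant_on_def)
      then show False using assms(22)[OF assms(16)] by (simp add: \<eta>_def)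
    qed
    show "\<exists>b. \<forall>x. g x = b * \<eta>1 x"
      if g: "\<And>x. (g has_real_derivative g1 x) (at x)"
        "\<And>x. (g1 has_real_derivative
             (lin1 F q0 (\<eta> x) * g1 x + lin0 F c0 q0 (\<eta> x) (\<eta>1 x) * g x) / (\<delta> * c0)) (at x)"
        "\<And>x. g (x + L0) = g x" for g g1
    proof -
      have "(\<lambda>y. g (L0 * (y - s))) \<in> range (\<lambda>b y. b * deriv (Hs (1 / L0) q0) y)"
        using kernel_range(1)[OF g(1,3,2)] assms(10)[OF P] s by simp
      then obtain b where b: "\<And>y. g (L0 * (y - s)) = b * (L0 * \<eta>1 (L0 * (y - s)))"
        unfolding s(2) deriv_affine[OF \<eta>] by (auto dest: fun_cong)
      have "g x = b * L0 * \<eta>1 x" for x using b[of "x / L0 + s"] \<open>L0 \<noteq> 0\<close> by simp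
      then show ?thesis by blast
    qed
    show False
      if g: "\<And>x. (g has_real_derivative g1 x) (at x)"
        "\<And>x. (g1 has_real_derivative
             (lin1 F q0 (\<eta> x) * g1 x + lin0 F c0 q0 (\<eta> x) (\<eta>1 x) * g x + 2 * (c0 - q0 / \<eta> x)
               - \<delta> * deriv \<eta>1 x) / (\<delta> * c0)) (at x)"
        "\<And>x. g (x + L0) = g x" for g g1
      using kernel_range(2)[OF g(1,3,2) per] assms(11)[OF P] s by simp
    show "(hc1 has_real_derivative
          (lin1 F q0 (\<eta> x) * hc1 x + lin0 F c0 q0 (\<eta> x) (\<eta>1 x) * hc x + 2 * (c0 - q0 / \<eta> x)
            - \<delta> * deriv \<eta>1 x) / (\<delta> * c0)) (at x)" for x
      using varc(2)[of x] by (simp add: algebra_simps)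
    show "(hq1 has_real_derivative
          (lin1 F q0 (\<eta> x) * hq1 x + lin0 F c0 q0 (\<eta> x) (\<eta>1 x) * hq x - linq c0 q0 (\<eta> x) (\<eta>1 x))
            / (\<delta> * c0)) (at x)" for x
      using varq(2)[of x] by (simp add: algebra_simps)
  qed (use nz assms(17) pos \<eta> der1 per varc(1,3,4) varq(1,3,4) in auto)
  have J: "\<exists>J. \<forall>x. (J has_real_derivative h x) (at x)" if "continuous_on UNIV h" for h :: "real \<Rightarrow> real"
    using einterval_antiderivative[of "-\<infinity>" "\<infinity>" h] that
    by (auto simp: continuous_on_eq_continuous_at has_real_derivative_iff_has_vector_derivative)
  obtain Jc Jq where Jc: "\<And>x. (Jc has_real_derivative hc x) (at x)"
    and Jq: "\<And>x. (Jq has_real_derivative hq x) (at x)"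
    using J[OF wave_linearization.cont(4)] J[OF wave_linearization.cont(6)] wave_linearization_axioms by meson
  have fund: "fundamental_matrix (evans_matrix \<delta> F c0 \<eta> (\<lambda>x. c0 * \<eta> x - q0) \<mu>) (\<Psi> \<mu>)" for \<mu>
    using assms(24) by (simp add: \<eta>_def)
  obtain \<Gamma> where "\<Gamma> \<noteq> 0" and \<Gamma>: "vanishes_to_order 3 (\<lambda>p. evans \<Psi> L0 (fst p) (exp (snd p))
    - \<Gamma> * (fst p ^ 2 * of_real (Lc * (Jq L0 - Jq 0) - Lq * (Jc L0 - Jc 0))
      - fst p * snd p * of_real (Lc + (Jq L0 - Jq 0) + \<eta> 0 * Lq) + snd p ^ 2))"
    using evans_expansion[OF fund Jc Jq] by blast
  have diff: "f differentiable (at ((c0, q0), x))" "l differentiable (at (c0, q0))" for x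
    using smooth_onD(2)[OF f] smooth_onD(2)[OF l] a by auto
  have c_curve: "((\<lambda>c. (c, q0)) has_vector_derivative (1, 0)) (at c0)"
    and q_curve: "((\<lambda>q. (c0, q)) has_vector_derivative (0, 1)) (at q0)"
    by (auto intro!: has_vector_derivative_Pair derivative_eq_intros)
  have "((\<lambda>c. ((c, q0), x)) has_vector_derivative ((1, 0), 0)) (at c0)"
    and "((\<lambda>q. ((c0, q), x)) has_vector_derivative ((0, 1), 0)) (at q0)" for x :: real
    by (intro has_vector_derivative_Pair has_vector_derivative_const c_curve q_curve)+
  note DERIV_frechet_chain[OF diff(1) this(1)] DERIV_frechet_chain[OF diff(1) this(2)]
  then have hc_eq: "deriv (\<lambda>c. H c q0 x) c0 = hc x" and hq_eq: "deriv (\<lambda>q. H c0 q x) q0 = hq x" for x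
    unfolding hc_def hq_def by (auto simp: f_def intro!: DERIV_imp_deriv)
  note DERIV_frechet_chain[OF diff(2) c_curve] DERIV_frechet_chain[OF diff(2) q_curve]
  then have Lc_eq: "deriv (\<lambda>c. L c q0) c0 = Lc" and Lq_eq: "deriv (\<lambda>q. L c0 q) q0 = Lq"
    unfolding Lc_def Lq_def by (auto simp: l_def intro!: DERIV_imp_deriv)
  have mean_c: "mean L0 hc = (Jc L0 - Jc 0) / L0" and mean_q: "mean L0 hq = (Jq L0 - Jq 0) / L0"
    unfolding mean_def using LBINT_eq_antiderivative_diff[OF wave_linearization.cont(4) Jc] 
     LBINT_eq_antiderivative_diff[OF wave_linearization.cont(6) Jq] wave_linearization_axioms by auto
\<comment> \<open>The normalization \<open>H 0 = mean H\<close> identifies \<open>\<eta> 0\<close> with the mean height.\<close>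
  have D: "whitham_dispersion L H c0 q0 \<mu> \<nu> = (\<mu> ^ 2 * of_real (Lc * (Jq L0 - Jq 0) - Lq * (Jc L0 - Jc 0))
      - \<mu> * \<nu> * of_real (Lc + (Jq L0 - Jq 0) + \<eta> 0 * Lq) + \<nu> ^ 2) / of_real L0" for \<mu> \<nu>
    unfolding whitham_dispersion_def Let_def hc_eq hq_eq Lc_eq Lq_eq L0_def[symmetric] mean_c mean_q
      assms(23)[OF assms(16), folded L0_def \<eta>_def, symmetric] \<eta>_def[symmetric]
    using \<open>L0 \<noteq> 0\<close> by (simp add: field_simps)
  show ?thesis
  proof (intro exI[of _ "\<Gamma> * of_real L0"] conjI)
    show "\<Gamma> * of_real L0 \<noteq> 0" using \<open>\<Gamma> \<noteq> 0\<close> \<open>L0 \<noteq> 0\<close> by simp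
    show "(\<lambda>(\<mu>, \<nu>). evans \<Psi> (L c0 q0) \<mu> (exp \<nu>) - \<Gamma> * of_real L0 * whitham_dispersion L H c0 q0 \<mu> \<nu>)
       \<in> O[at (0, 0) within UNIV \<times> {\<nu>. Re \<nu> = 0}](\<lambda>(\<mu>, \<nu>). of_real ((norm \<mu> + norm \<nu>) ^ 3))"
      using \<Gamma> \<open>L0 \<noteq> 0\<close> unfolding D vanishes_to_order_def L0_def[symmetric]
      by (simp add: case_prod_unfold)
  qed
qed

end
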